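(* Let $N>0$ and $n>0$ be integers, let $G\le S_N$ be a group, and let $\mathcal{R}_G=\{\rho_1,\ldots,\rho_h\}$ be a traversal for $G$. Then the irreducible representations $$\left\{ \operatorname{Ind}_{G\wr S_\alpha}^{G\wr S_n}\left((\rho_1^{\boxtimes \alpha_1}\boxtimes\cdots\boxtimes\rho_h^{\boxtimes\alpha_h})'\otimes\sigma'\right) : \alpha\models_h n,\ \sigma\in\mathcal{R}_{S_\alpha}\right\}$$ form a traversal for $G\wr S_n$. In particular, let $\mathbf{r}=(r_1,r_2,\ldots)$ be a sequence of positive integers and let $k\ge 1$. If $\mathcal{R}_{W(\mathbf{r}|_{k-1})}=\{\rho_1,\ldots,\rho_h\}$ is a traversal for $W(\mathbf{r}|_{k-1})$, then a traversal for $W(\mathbf{r}|_k)$ is $$\mathcal{R}_{W(\mathbf{r}|_k)}=\left\{ \operatorname{Ind}_{W(\mathbf{r}|_{k-1})\wr S_\alpha}^{W(\mathbf{r}|_k)}\left((\rho_1^{\boxtimes \alpha_1}\boxtimes\cdots\boxtimes\rho_h^{\boxtimes\alpha_h})'\otimes\sigma'\right) : \alpha\models_h r_k,\ \sigma\in\mathcal{R}_{S_\alpha}\right\},$$ where $S_\alpha$ is regarded as a subgroup of $S_{r_k}$.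
   Context: All groups are finite and all representations are over $\mathbb{C}$ (on finite-dimensional vector spaces). A traversal for a finite group $G$ is a set $\mathcal{R}_G$ of irreducible representations of $G$ containing exactly one representative of each isomorphism class of irreducible representations of $G$. When it is written $\{\rho_1,\ldots,\rho_h\}$, the $\rho_i$ are pairwise inequivalent. $\alpha\models_h n$ means that $\alpha=(\alpha_1,\ldots,\alpha_h)$ is a weak composition of $n$ with $h$ parts: each $\alpha_i\ge 0$ is an integer and $\sum_i\alpha_i=n$. For such $\alpha$, $S_\alpha:=S_{\alpha_1}\times\cdots\times S_{\alpha_h}\le S_n$ is the Young subgroup acting on $\{1,\ldots,n\}$ by the full action on $h$ consecutive disjoint blocks of sizes $\alpha_1,\ldots,\alpha_h$ (with $S_0=\{1\}$). $\mathcal{R}_{S_\alpha}$ is a traversal for $S_\alpha$. Wreath product: for $H\le S_n$, $G\wr H$ is the set $G^n\times H$ with multiplication $(a;\pi)(b;\tau)=(ab^\pi;\pi\tau)$, where $b^\pi=(b_{\pi^{-1}(1)},\ldots,b_{\pi^{-1}(n)})$. The iterated wreath products are $W(\mathbf{r}|_0)=\{1\}$ and $W(\mathbf{r}|_k)=W(\mathbf{r}|_{k-1})\wr S_{r_k}$. $\boxtimes$ denotes the outer tensor product: $(\rho\boxtimes\eta)(g,h)=\rho(g)\otimes\eta(h)$ is a representation of a product group. $\rho_i^{\boxtimes\alpha_i}$ is the $\alpha_i$-fold outer tensor power, with the factor omitted (trivial) if $\alpha_i=0$. $\otimes$ denotes the inner tensor product $(\rho\otimes\eta)(g)=\rho(g)\otimes\eta(g)$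 of two representations of the same group. $(\rho_1^{\boxtimes\alpha_1}\boxtimes\cdots\boxtimes\rho_h^{\boxtimes\alpha_h})'$ denotes an extension of the irreducible representation $\rho_1^{\boxtimes\alpha_1}\boxtimes\cdots\boxtimes\rho_h^{\boxtimes\alpha_h}$ of $G^n$ to an irreducible representation of $G\wr S_\alpha$, i.e. a representation of $G\wr S_\alpha$ whose restriction to $G^n$ is $\rho_1^{\boxtimes\alpha_1}\boxtimes\cdots\boxtimes\rho_h^{\boxtimes\alpha_h}$. One such extension is fixed for each $\alpha$. For $\sigma\in\mathcal{R}_{S_\alpha}$, $\sigma'$ is the representation of $G\wr S_\alpha$ obtained by composing $\sigma$ with the projection $G\wr S_\alpha\to S_\alpha$, $(a;\pi)\mapsto\pi$. $\operatorname{Ind}$ is the usual induction of representations. *)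

theory Defs
  imports
    "HOL-Algebra.Algebra"
    "Jordan_Normal_Form.VS_Connect"
begin

section \<open>Complex representations of finite groups\<close>

text \<open>
  Every finite-dimensional complex representation is, after a choice of basis, a group
  homomorphism into some $GL_d(\mathbf{C})$.  Only the values on the carrier of the group matter.
\<close>

definition GL :: "nat \<Rightarrow> complex mat monoid" where
  "GL d = units_of (ring_mat TYPE(complex) d ())"

definition representation :: "('g, 'b) monoid_scheme \<Rightarrow> nat \<Rightarrow> ('g \<Rightarrow> complex mat) \<Rightarrow> bool" where
  "representation G d \<rho> \<longleftrightarrow> \<rho> \<in> hom G (GL d)"

definition irreducible_rep :: "('g, 'b) monoid_scheme \<Rightarrow> ('g \<Rightarrow> complex mat) \<Rightarrow> bool" where
  "irreducible_rep G \<rho> \<longleftrightarrow>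
     (\<exists>d > 0. representation G d \<rho> \<and>
        (\<forall>U. subspace class_ring U (module_vec TYPE(complex) d) \<longrightarrow>
             (\<forall>g\<in>carrier G. \<forall>u\<in>U. \<rho> g *\<^sub>v u \<in> U) \<longrightarrow>
             U = {0\<^sub>v d} \<or> U = carrier_vec d))"

definition equivalent_reps ::
  "('g, 'b) monoid_scheme \<Rightarrow> ('g \<Rightarrow> complex mat) \<Rightarrow> ('g \<Rightarrow> complex mat) \<Rightarrow> bool" where
  "equivalent_reps G \<rho> \<eta> \<longleftrightarrow>
     (\<exists>d. representation G d \<rho> \<and> representation G d \<eta> \<and>
        (\<exists>P\<in>carrier (GL d). \<forall>g\<in>carrier G. P * \<rho> g = \<eta> g * P))"

definition traversal :: "('g, 'b) monoid_scheme \<Rightarrow> ('g \<Rightarrow> complex mat) set \<Rightarrow> bool" where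
  "traversal G R \<longleftrightarrow>
     (\<forall>\<rho>\<in>R. irreducible_rep G \<rho>) \<and>
     (\<forall>\<eta>. irreducible_rep G \<eta> \<longrightarrow> (\<exists>!\<rho>. \<rho> \<in> R \<and> equivalent_reps G \<rho> \<eta>))"

text \<open>
  A traversal written as a family, the members with different indices being inequivalent:
  within a traversal, inequivalent just means different.
\<close>

definition traversal_family ::
  "('g, 'b) monoid_scheme \<Rightarrow> 'i set \<Rightarrow> ('i \<Rightarrow> 'g \<Rightarrow> complex mat) \<Rightarrow> bool" where
  "traversal_family G I \<rho> \<longleftrightarrow> traversal G (\<rho> ` I) \<and> inj_on \<rho> I"

definition kronecker :: "complex mat \<Rightarrow> complex mat \<Rightarrow> complex mat" where
  "kronecker A B =
     mat (dim_row A * dim_row B) (dim_col A * dim_col B)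
       (\<lambda>(i, j). A $$ (i div dim_row B, j div dim_col B) * B $$ (i mod dim_row B, j mod dim_col B))"

definition inner_tensor ::
  "('g \<Rightarrow> complex mat) \<Rightarrow> ('g \<Rightarrow> complex mat) \<Rightarrow> 'g \<Rightarrow> complex mat" where
  "inner_tensor \<rho> \<eta> = (\<lambda>g. kronecker (\<rho> g) (\<eta> g))"

text \<open>
  The outer tensor product of a list of representations of \<open>G\<close>, as a representation of the power
  of \<open>G\<close> whose coordinates are numbered from 1; the empty product is trivial.
\<close>

definition outer_tensor :: "('g \<Rightarrow> complex mat) list \<Rightarrow> (nat \<Rightarrow> 'g) \<Rightarrow> complex mat" where
  "outer_tensor \<rho>s =
     (\<lambda>a. foldr kronecker (map (\<lambda>i. (\<rho>s ! i) (a (Suc i))) [0..<length \<rho>s]) (1\<^sub>m 1))"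

definition left_coset_reps ::
  "('g, 'b) monoid_scheme \<Rightarrow> ('g, 'c) monoid_scheme \<Rightarrow> 'g list \<Rightarrow> bool" where
  "left_coset_reps G H ts \<longleftrightarrow>
     distinct ts \<and> set ts \<subseteq> carrier G \<and>
     (\<forall>g\<in>carrier G. \<exists>!t. t \<in> set ts \<and> g \<in> t <#\<^bsub>G\<^esub> carrier H)"

text \<open>
  Induction from a subgroup \<open>H\<close> of \<open>G\<close> in matrix form: with coset representatives
  $t_1, \ldots, t_m$, the block $(i,j)$ of the matrix of $g$ is $\rho(t_i^{-1} g t_j)$ if
  $t_i^{-1} g t_j$ lies in \<open>H\<close>, and 0 otherwise.  It is the matrix of $g$ on
  $\mathbf{C}[G] \otimes_{\mathbf{C}[H]} V$ in the basis $t_j \otimes v_l$; another choice of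
  representatives gives an equivalent representation.
\<close>

definition induced_rep ::
  "('g, 'b) monoid_scheme \<Rightarrow> ('g, 'c) monoid_scheme \<Rightarrow> ('g \<Rightarrow> complex mat) \<Rightarrow> 'g \<Rightarrow> complex mat" where
  "induced_rep G H \<rho> =
     (let ts = (SOME ts. left_coset_reps G H ts);
          m = length ts;
          d = dim_row (\<rho> \<one>\<^bsub>G\<^esub>)
      in (\<lambda>g. mat (m * d) (m * d)
           (\<lambda>(i, j). let x = inv\<^bsub>G\<^esub> (ts ! (i div d)) \<otimes>\<^bsub>G\<^esub> g \<otimes>\<^bsub>G\<^esub> (ts ! (j div d))
                     in if x \<in> carrier H then \<rho> x $$ (i mod d, j mod d) else 0)))"

section \<open>Young subgroups\<close>

definition weak_compositions :: "nat \<Rightarrow> nat \<Rightarrow> nat list set" where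
  "weak_compositions h n = {\<alpha>. length \<alpha> = h \<and> sum_list \<alpha> = n}"

definition block :: "nat list \<Rightarrow> nat \<Rightarrow> nat set" where
  "block \<alpha> i = {sum_list (take i \<alpha>) <.. sum_list (take (Suc i) \<alpha>)}"

definition young_group :: "nat list \<Rightarrow> (nat \<Rightarrow> nat) monoid" where
  "young_group \<alpha> = (sym_group (sum_list \<alpha>))
     \<lparr>carrier := {\<pi>. \<pi> permutes {1..sum_list \<alpha>} \<and> (\<forall>i<length \<alpha>. \<pi> ` block \<alpha> i = block \<alpha> i)}\<rparr>"

section \<open>Wreath products\<close>

text \<open>
  \<open>Wr a \<pi>\<close> is the pair $(a;\pi)$.  A recursive type is used because the iterated wreath products
  have to be groups over one and the same type, whatever the number of iterations.  \<open>Perm\<close> provides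
  the elements of the groups of permutations to start from.
\<close>

datatype wreath_elem = Perm "nat \<Rightarrow> nat" | Wr "nat \<Rightarrow> wreath_elem" "nat \<Rightarrow> nat"

definition base_sym_group :: "nat \<Rightarrow> wreath_elem monoid" where
  "base_sym_group N = image_group Perm (sym_group N)"

abbreviation power_group :: "wreath_elem monoid \<Rightarrow> nat \<Rightarrow> (nat \<Rightarrow> wreath_elem) monoid" where
  "power_group G n \<equiv> product_group {1..n} (\<lambda>_. G)"

fun wreath_mult ::
  "wreath_elem monoid \<Rightarrow> nat \<Rightarrow> wreath_elem \<Rightarrow> wreath_elem \<Rightarrow> wreath_elem" where
  "wreath_mult G n (Wr a \<pi>) (Wr b \<tau>) =
     Wr (a \<otimes>\<^bsub>power_group G n\<^esub> (\<lambda>i\<in>{1..n}. b (inv_into UNIV \<pi> i))) (\<pi> \<circ> \<tau>)"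
| "wreath_mult G n _ _ = undefined"

text \<open>The group \<open>H\<close> is meant to be a subgroup of \<open>sym_group n\<close>.\<close>

definition wreath :: "wreath_elem monoid \<Rightarrow> nat \<Rightarrow> (nat \<Rightarrow> nat) monoid \<Rightarrow> wreath_elem monoid" where
  "wreath G n H =
     \<lparr>carrier = {Wr a \<pi> | a \<pi>. a \<in> carrier (power_group G n) \<and> \<pi> \<in> carrier H},
      monoid.mult = wreath_mult G n,
      one = Wr \<one>\<^bsub>power_group G n\<^esub> id\<rparr>"

text \<open>The sequence \<open>r\<close> is indexed from 1; the value \<open>r 0\<close> is not used.\<close>

fun iterated_wreath :: "(nat \<Rightarrow> nat) \<Rightarrow> nat \<Rightarrow> wreath_elem monoid" where
  "iterated_wreath r 0 =
     \<lparr>carrier = {Perm id}, monoid.mult = (\<lambda>_ _. Perm id), one = Perm id\<rparr>"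
| "iterated_wreath r (Suc k) = wreath (iterated_wreath r k) (r (Suc k)) (sym_group (r (Suc k)))"

fun inflate :: "((nat \<Rightarrow> nat) \<Rightarrow> complex mat) \<Rightarrow> wreath_elem \<Rightarrow> complex mat" where
  "inflate \<sigma> (Wr a \<pi>) = \<sigma> \<pi>"
| "inflate \<sigma> (Perm _) = undefined"

definition young_tensor ::
  "(wreath_elem \<Rightarrow> complex mat) list \<Rightarrow> nat list \<Rightarrow> (nat \<Rightarrow> wreath_elem) \<Rightarrow> complex mat" where
  "young_tensor \<rho>s \<alpha> = outer_tensor (concat (map2 (\<lambda>\<rho> m. replicate m \<rho>) \<rho>s \<alpha>))"

definition is_extension ::
  "wreath_elem monoid \<Rightarrow> (wreath_elem \<Rightarrow> complex mat) list \<Rightarrow> nat list \<Rightarrow>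
   (wreath_elem \<Rightarrow> complex mat) \<Rightarrow> bool" where
  "is_extension G \<rho>s \<alpha> E \<longleftrightarrow>
     (\<exists>d. representation (wreath G (sum_list \<alpha>) (young_group \<alpha>)) d E) \<and>
     (\<forall>a\<in>carrier (power_group G (sum_list \<alpha>)). E (Wr a id) = young_tensor \<rho>s \<alpha> a)"

end

theory Submission
  imports Defs "Jordan_Normal_Form.Spectral_Radius"
begin

text \<open>
  Everything is reduced to matrix coefficients.  A family of representations of a finite group is a
  traversal as soon as its coefficients satisfy the orthogonality relations (for each member, up to a
  nonzero constant, and between different members) and separate functions on the group; conversely,
  Schur's lemma and Maschke's theorem show that every traversal has these properties.

  A representation of $G^n$ that is a tensor product of members of the given traversal is described
  by a labelling of $\{1,\ldots,n\}$, and \<open>S\<^sub>\<alpha>\<close> is the stabiliser of the labelling that takes the value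
  $k$ on the $k$-th block.  Conjugating by an element of $G \wr S_n$ permutes the labels, so translates
  by different cosets of $G \wr S_\alpha$, and all translates for different $\alpha$, carry different
  labellings; summing over $G^n$ makes their coefficients orthogonal.  What remains is a sum over
  $G \wr S_\alpha$, which factors into sums over $G^n$ and over $S_\alpha$.  For completeness, the indicator
  function of the identity of $G^n$ is by Fourier inversion a combination of products of characters,
  one for each labelling, and every labelling is a translate of one given by a composition.
\<close>

section \<open>Subspaces and matrix factorisations\<close>

text \<open>Matrix coefficients are chosen because they turn the usual ingredients (Clifford theory,
  Frobenius reciprocity, Mackey's criterion, a count of dimensions) into statements about finite
  sums, and such sums factor along G^n and S_\<alpha>. Values at inverses stand where the classical
  relations have complex conjugates, so bases stay arbitrary and no representation has to be made
  unitary. The obstacle is that of an extension to G wr S_\<alpha> only the restriction to G^n is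
  known. But the elements lying over one permutation form a coset of G^n, and there the extension is
  the tensor representation times one fixed invertible matrix; in an orthogonality sum this matrix
  meets its inverse and cancels. Completeness is obtained by separating functions instead of adding
  squares of degrees: f(g) is the value at the identity of the function b -> f(b g) on G^n, and
  Fourier inversion writes this value as a combination of sums that vanish when f is orthogonal to
  every member.\<close>

definition vec_subspace :: "nat \<Rightarrow> complex vec set \<Rightarrow> bool" where
  "vec_subspace d U \<longleftrightarrow> U \<subseteq> carrier_vec d \<and> 0\<^sub>v d \<in> U \<and>
     (\<forall>u\<in>U. \<forall>v\<in>U. u + v \<in> U) \<and> (\<forall>c. \<forall>u\<in>U. c \<cdot>\<^sub>v u \<in> U)"

lemma subspace_iff_vec_subspace:
  "subspace class_ring U (module_vec TYPE(complex) d) \<longleftrightarrow> vec_subspace d U"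
proof -
  interpret vec_module "TYPE(complex)" d .
  have vs: "vectorspace (class_ring :: complex ring) (module_vec TYPE(complex) d)"
    by (rule vec_vs)
  then have "Module.module (class_ring :: complex ring) (module_vec TYPE(complex) d)"
    by (simp add: vectorspace_def)
  with vs show ?thesis
    unfolding subspace_def LinearCombinations.submodule_def vec_subspace_def
    by (auto simp: module_vec_simps class_ring_simps)
qed

lemma mat_eqI_mult_vec:
  assumes "M \<in> carrier_mat m n" "N \<in> carrier_mat m n"
    and "\<And>v. v \<in> carrier_vec n \<Longrightarrow> M *\<^sub>v v = N *\<^sub>v (v :: complex vec)"
  shows "M = N"
proof (rule eq_matI)
  fix i j assume ij: "i < dim_row N" "j < dim_col N"
  have "M *\<^sub>v unit_vec n j = N *\<^sub>v unit_vec n j" using assms(3) by simp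
  then have "(M *\<^sub>v unit_vec n j) $ i = (N *\<^sub>v unit_vec n j) $ i" by simp
  moreover have "(K *\<^sub>v unit_vec n j) $ i = K $$ (i,j)" if "K \<in> carrier_mat m n" for K :: "complex mat"
    using that ij assms by (simp add: scalar_prod_right_unit)
  ultimately show "M $$ (i,j) = N $$ (i,j)" using assms(1,2) by metis
qed (use assms in auto)

text \<open>If \<open>d < e\<close>, zero padding makes both factors square without changing the
  product. A one-sided inverse of a square matrix is two-sided, but row \<open>d\<close> of the
  padded \<open>A\<close> is zero.\<close>

lemma left_inverse_dim_le:
  fixes A B :: "complex mat"
  assumes A: "A \<in> carrier_mat d e" and B: "B \<in> carrier_mat e d" and BA: "B * A = 1\<^sub>m e"
  shows "e \<le> d"
proof (rule ccontr)
  assume "\<not> e \<le> d"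
  then have de: "d < e" by simp
  define A' where "A' = mat e e (\<lambda>(i,j). if i < d then A $$ (i,j) else 0)"
  define B' where "B' = mat e e (\<lambda>(i,j). if j < d then B $$ (i,j) else 0)"
  have car: "A' \<in> carrier_mat e e" "B' \<in> carrier_mat e e" by (auto simp: A'_def B'_def)
  have "B' * A' = 1\<^sub>m e"
  proof (rule eq_matI)
    fix i j assume ij: "i < dim_row (1\<^sub>m e :: complex mat)" "j < dim_col (1\<^sub>m e :: complex mat)"
    have "(B' * A') $$ (i,j) = (\<Sum>k\<in>{0..<e}. (if k < d then B $$ (i,k) * A $$ (k,j) else 0))"
      using ij by (auto simp: A'_def B'_def scalar_prod_def intro!: sum.cong)
    also have "\<dots> = (\<Sum>k\<in>{0..<d}. B $$ (i,k) * A $$ (k,j))"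
      using de by (auto intro!: sum.mono_neutral_cong_right)
    also have "\<dots> = (B * A) $$ (i,j)" using A B ij by (simp add: scalar_prod_def)
    finally show "(B' * A') $$ (i,j) = 1\<^sub>m e $$ (i,j)" by (simp add: BA)
  qed (auto simp: A'_def B'_def)
  from mat_mult_left_right_inverse[OF car(2,1) this]
  have "(A' * B') $$ (d,d) = 1" using de by simp
  moreover have "(A' * B') $$ (d,d) = 0" using de by (simp add: A'_def B'_def scalar_prod_def)
  ultimately show False by simp
qed

text \<open>One step of basis extension. A left inverse encodes the independence of the columns of
  \<open>A\<close>, so enlarging the basis means adding a column to \<open>A\<close> and a matching
  row to \<open>B\<close>.\<close>

lemma vec_subspace_range_extend:
  fixes A B :: "complex mat"
  assumes U: "vec_subspace d U" and A: "A \<in> carrier_mat d e" and B: "B \<in> carrier_mat e d"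
    and BA: "B * A = 1\<^sub>m e" and AU: "\<And>v. v \<in> carrier_vec e \<Longrightarrow> A *\<^sub>v v \<in> U"
    and u: "u \<in> U" "u \<notin> (\<lambda>v. A *\<^sub>v v) ` carrier_vec e"
  obtains A' B' :: "complex mat" where "A' \<in> carrier_mat d (Suc e)" "B' \<in> carrier_mat (Suc e) d"
    "B' * A' = 1\<^sub>m (Suc e)" "\<And>v. v \<in> carrier_vec (Suc e) \<Longrightarrow> A' *\<^sub>v v \<in> U"
proof -
  have uc: "u \<in> carrier_vec d" using U u by (auto simp: vec_subspace_def)
  \<comment> \<open>Removing from \<open>u\<close> its image under the projection
    \<open>A * B\<close> gives a vector killed by \<open>B\<close>, so the old rows of
    \<open>B\<close> can be kept.\<close>
  define w where "w = u + (- 1) \<cdot>\<^sub>v (A *\<^sub>v (B *\<^sub>v u))"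
  have Bu: "B *\<^sub>v u \<in> carrier_vec e" using B uc by simp
  have wc: "w \<in> carrier_vec d" using A uc Bu by (simp add: w_def)
  have wU: "w \<in> U" using U u AU[OF Bu] unfolding vec_subspace_def w_def by blast
  have w0: "w \<noteq> 0\<^sub>v d"
  proof
    assume "w = 0\<^sub>v d"
    have "u $ i = (A *\<^sub>v (B *\<^sub>v u)) $ i" if "i < d" for i
    proof -
      have "w $ i = u $ i - (A *\<^sub>v (B *\<^sub>v u)) $ i"
        using that A uc by (simp add: w_def del: index_mult_mat_vec)
      then show ?thesis using \<open>w = 0\<^sub>v d\<close> that by simp
    qed
    then have "u = A *\<^sub>v (B *\<^sub>v u)" using uc A by (intro eq_vecI) auto
    then show False using u Bu by blast
  qed
  have Bw: "B *\<^sub>v w = 0\<^sub>v e"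
  proof -
    have "B *\<^sub>v w = B *\<^sub>v u + (- 1) \<cdot>\<^sub>v (B *\<^sub>v (A *\<^sub>v (B *\<^sub>v u)))"
      unfolding w_def using A B uc by (subst mult_add_distrib_mat_vec[OF B]) (auto simp: mult_mat_vec)
    also have "B *\<^sub>v (A *\<^sub>v (B *\<^sub>v u)) = B *\<^sub>v u"
      using assoc_mult_mat_vec[OF B A Bu] BA Bu by simp
    also have "B *\<^sub>v u + (- 1) \<cdot>\<^sub>v (B *\<^sub>v u) = 0\<^sub>v e"
    proof -
      have "x + (- 1) \<cdot>\<^sub>v x = 0\<^sub>v e" if "x \<in> carrier_vec e" for x :: "complex vec"
        using that by (intro eq_vecI) auto
      then show ?thesis using Bu by blast
    qed
    finally show ?thesis .
  qed
  obtain k where k: "k < d" "w $ k \<noteq> 0"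
  proof (rule ccontr)
    assume "\<not> thesis"
    then have "\<forall>k<d. w $ k = 0" using that by blast
    then have "w = 0\<^sub>v d" using wc by (intro eq_vecI) auto
    then show False using w0 by simp
  qed
  \<comment> \<open>The complementary projection kills the columns of \<open>A\<close> and fixes
    \<open>w\<close>.\<close>
  define D where "D = 1\<^sub>m d - A * B"
  have D: "D \<in> carrier_mat d d" unfolding D_def by (rule minus_carrier_mat[OF mult_carrier_mat[OF A B]])
  have DA: "D * A = 0\<^sub>m d e"
  proof -
    have "D * A = 1\<^sub>m d * A - A * B * A"
      unfolding D_def by (rule minus_mult_distrib_mat[OF one_carrier_mat mult_carrier_mat[OF A B] A])
    also have "A * B * A = A" using assoc_mult_mat[OF A B A] A by (simp add: BA)
    finally show ?thesis using A by simp
  qed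
  have Dw: "D *\<^sub>v w = w"
  proof -
    have "D *\<^sub>v w = 1\<^sub>m d *\<^sub>v w - A * B *\<^sub>v w"
      unfolding D_def by (rule minus_mult_distrib_mat_vec[OF one_carrier_mat mult_carrier_mat[OF A B] wc])
    also have "A * B *\<^sub>v w = A *\<^sub>v 0\<^sub>v e" using assoc_mult_mat_vec[OF A B wc] by (simp add: Bw)
    also have "A *\<^sub>v 0\<^sub>v e = 0\<^sub>v d" using A by auto
    finally show ?thesis using wc by auto
  qed
  \<comment> \<open>A row of \<open>D\<close>, taken where \<open>w\<close> has a non-zero entry and
    scaled, is 1 on \<open>w\<close> and 0 on the columns of \<open>A\<close>: this is the missing
    row of the left inverse.\<close>
  define c where "c = (1 / w $ k) \<cdot>\<^sub>v row D k"
  have rD: "row D k \<in> carrier_vec d" using row_carrier[of D k] D by simp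
  have cc: "c \<in> carrier_vec d" using rD by (simp add: c_def)
  have cx: "c \<bullet> x = (1 / w $ k) * (D *\<^sub>v x) $ k" if x: "x \<in> carrier_vec d" for x
    using smult_scalar_prod_distrib[OF rD x] k D by (simp add: c_def)
  have cw: "c \<bullet> w = 1" using cx[OF wc] Dw k by simp
  have cA: "c \<bullet> col A j = 0" if "j < e" for j
  proof -
    have "D *\<^sub>v col A j = col (D * A) j" by (rule col_mult2[OF D A that, symmetric])
    also have "\<dots> = 0\<^sub>v d" using that by (simp add: DA)
    moreover have "col A j \<in> carrier_vec d" using A by auto
    ultimately show ?thesis using cx[of "col A j"] k by simp
  qed
  define A' where "A' = mat d (Suc e) (\<lambda>(i,j). if j < e then A $$ (i,j) else w $ i)"
  define B' where "B' = mat (Suc e) d (\<lambda>(i,j). if i < e then B $$ (i,j) else c $ j)"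
  have A': "A' \<in> carrier_mat d (Suc e)" and B': "B' \<in> carrier_mat (Suc e) d"
    by (auto simp: A'_def B'_def)
  have colA: "col A' j = (if j < e then col A j else w)" if "j < Suc e" for j
    using that A wc by (intro eq_vecI) (auto simp: A'_def)
  have rowB: "row B' i = (if i < e then row B i else c)" if "i < Suc e" for i
    using that B cc by (intro eq_vecI) (auto simp: B'_def)
  have "B' * A' = 1\<^sub>m (Suc e)"
  proof (rule eq_matI)
    fix i j assume "i < dim_row (1\<^sub>m (Suc e) :: complex mat)" "j < dim_col (1\<^sub>m (Suc e) :: complex mat)"
    then have ij: "i < Suc e" "j < Suc e" by auto
    have e1: "row B i \<bullet> col A j = (if i = j then 1 else 0)" if "i < e" "j < e"
      using arg_cong[OF BA, of "\<lambda>M. M $$ (i,j)"] that A B by simp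
    have e2: "row B i \<bullet> w = 0" if "i < e"
      using arg_cong[OF Bw, of "\<lambda>M. M $ i"] that B by simp
    have "(B' * A') $$ (i,j) = row B' i \<bullet> col A' j" using ij A' B' by simp
    also have "\<dots> = (if i = j then 1 else 0)"
      using ij e1 e2 cw cA by (auto simp: colA rowB less_Suc_eq)
    finally show "(B' * A') $$ (i,j) = 1\<^sub>m (Suc e) $$ (i,j)" using ij by simp
  qed (use A' B' in auto)
  moreover have "A' *\<^sub>v v \<in> U" if v: "v \<in> carrier_vec (Suc e)" for v
  proof -
    have "A' *\<^sub>v v = A *\<^sub>v vec e (\<lambda>i. v $ i) + v $ e \<cdot>\<^sub>v w"
      using A v wc by (intro eq_vecI) (auto simp: A'_def scalar_prod_def)
    then show ?thesis using U wU AU[of "vec e (\<lambda>i. v $ i)"] by (auto simp: vec_subspace_def)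
  qed
  ultimately show ?thesis using that A' B' by blast
qed

text \<open>Take \<open>e\<close> maximal among the independent families inside \<open>U\<close>.
  Such an \<open>e\<close> exists because \<open>left_inverse_dim_le\<close> bounds it by
  \<open>d\<close>, and a vector of \<open>U\<close> outside the range would extend the
  family.\<close>

lemma vec_subspace_eq_range:
  assumes U: "vec_subspace d U"
  obtains e A B where "A \<in> carrier_mat d e" "B \<in> carrier_mat e d" "B * A = 1\<^sub>m e"
    "(\<lambda>v. A *\<^sub>v v) ` carrier_vec e = U"
proof -
  define Q where "Q e = (\<exists>A B. A \<in> carrier_mat d e \<and> B \<in> carrier_mat e d \<and> B * A = (1\<^sub>m e :: complex mat)
      \<and> (\<forall>v\<in>carrier_vec e. A *\<^sub>v v \<in> U))" for e
  have Q0: "Q 0" unfolding Q_def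
  proof (intro exI conjI ballI)
    fix v :: "complex vec" assume v: "v \<in> carrier_vec 0"
    have "0\<^sub>m d 0 *\<^sub>v v = 0\<^sub>v d" using v by (intro eq_vecI) (auto simp: scalar_prod_def)
    then show "0\<^sub>m d 0 *\<^sub>v v \<in> U" using U by (simp add: vec_subspace_def)
  qed (auto intro!: eq_matI)
  have Qb: "e \<le> d" if "Q e" for e
    using that left_inverse_dim_le unfolding Q_def by blast
  obtain e where e: "Q e" "\<And>e'. Q e' \<Longrightarrow> e' \<le> e"
    using GreatestI_nat[of Q 0 d] Greatest_le_nat[of Q _ d] Q0 Qb by metis
  then obtain A B where AB: "A \<in> carrier_mat d e" "B \<in> carrier_mat e d" "B * A = (1\<^sub>m e :: complex mat)"
      "\<And>v. v\<in>carrier_vec e \<Longrightarrow> A *\<^sub>v v \<in> U"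
    unfolding Q_def by blast
  have "u \<in> (\<lambda>v. A *\<^sub>v v) ` carrier_vec e" if "u \<in> U" for u
  proof (rule ccontr)
    assume "u \<notin> (\<lambda>v. A *\<^sub>v v) ` carrier_vec e"
    from vec_subspace_range_extend[OF U AB that this] have "Q (Suc e)"
      unfolding Q_def by metis
    then show False using e(2) by force
  qed
  then show ?thesis using that[OF AB(1-3)] AB(4) by blast
qed

lemma range_vec_subspace:
  assumes "M \<in> carrier_mat m n"
  shows "vec_subspace m ((\<lambda>v. M *\<^sub>v v) ` carrier_vec n)"
  unfolding vec_subspace_def
proof (intro conjI ballI allI)
  show "(\<lambda>v. M *\<^sub>v v) ` carrier_vec n \<subseteq> carrier_vec m" using assms by auto
  have "M *\<^sub>v 0\<^sub>v n = 0\<^sub>v m" using assms by auto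
  then show "0\<^sub>v m \<in> (\<lambda>v. M *\<^sub>v v) ` carrier_vec n" by (metis imageI zero_carrier_vec)
next
  fix u v assume "u \<in> (\<lambda>v. M *\<^sub>v v) ` carrier_vec n" "v \<in> (\<lambda>v. M *\<^sub>v v) ` carrier_vec n"
  then show "u + v \<in> (\<lambda>v. M *\<^sub>v v) ` carrier_vec n"
    using mult_add_distrib_mat_vec[OF assms] by (auto simp: image_iff) (metis add_carrier_vec)
next
  fix c u assume "u \<in> (\<lambda>v. M *\<^sub>v v) ` carrier_vec n"
  then show "c \<cdot>\<^sub>v u \<in> (\<lambda>v. M *\<^sub>v v) ` carrier_vec n"
    using mult_mat_vec[OF assms] by (auto simp: image_iff) (metis smult_carrier_vec)
qed

text \<open>If the columns of \<open>A\<close> span the range of \<open>P\<close>, then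
  \<open>A * B\<close> projects onto that range, but possibly along another kernel. Replacing
  \<open>B\<close> by \<open>B * P\<close> corrects the kernel.\<close>

lemma idempotent_factor:
  fixes P :: "complex mat"
  assumes P: "P \<in> carrier_mat d d" and PP: "P * P = P"
  obtains e A B where "A \<in> carrier_mat d e" "B \<in> carrier_mat e d" "B * A = 1\<^sub>m e" "A * B = P"
proof -
  obtain e A B where AB: "A \<in> carrier_mat d e" "B \<in> carrier_mat e d" "B * A = 1\<^sub>m e"
    and r: "(\<lambda>v. A *\<^sub>v v) ` carrier_vec e = (\<lambda>v. P *\<^sub>v v) ` carrier_vec d"
    using vec_subspace_eq_range[OF range_vec_subspace[OF P]] by metis
  have PA: "P * A = A"
  proof (rule mat_eqI_mult_vec)
    fix v :: "complex vec" assume v: "v \<in> carrier_vec e"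
    then obtain w where w: "w \<in> carrier_vec d" "A *\<^sub>v v = P *\<^sub>v w" using r by blast
    show "P * A *\<^sub>v v = A *\<^sub>v v"
      using w v P AB PP by (metis assoc_mult_mat_vec)
  qed (use P AB in auto)
  have ABP: "A * (B * P) = P"
  proof (rule mat_eqI_mult_vec)
    fix v :: "complex vec" assume v: "v \<in> carrier_vec d"
    then obtain w where w: "w \<in> carrier_vec e" "P *\<^sub>v v = A *\<^sub>v w" using r by blast
    have "A * (B * P) *\<^sub>v v = A *\<^sub>v (B *\<^sub>v (A *\<^sub>v w))"
      using v P AB w(2) by (smt (verit) assoc_mult_mat_vec mult_carrier_mat mult_mat_vec_carrier)
    also have "B *\<^sub>v (A *\<^sub>v w) = w" using AB w by (metis assoc_mult_mat_vec one_mult_mat_vec)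
    finally show "A * (B * P) *\<^sub>v v = P *\<^sub>v v" using w by simp
  qed (use P AB in auto)
  have "(B * P) * A = 1\<^sub>m e" using P AB PA by (metis assoc_mult_mat)
  then show ?thesis using that[of A e "B * P"] AB P ABP by auto
qed

section \<open>Finite sums of matrices of a fixed size\<close>

definition mat_sum :: "nat \<Rightarrow> nat \<Rightarrow> ('i \<Rightarrow> complex mat) \<Rightarrow> 'i set \<Rightarrow> complex mat" where
  "mat_sum d e F I = mat d e (\<lambda>p. \<Sum>i\<in>I. F i $$ p)"

lemma mat_sum_carrier [simp]: "mat_sum d e F I \<in> carrier_mat d e"
  and mat_sum_dim [simp]: "dim_row (mat_sum d e F I) = d" "dim_col (mat_sum d e F I) = e"
  and mat_sum_index [simp]: "i < d \<Longrightarrow> j < e \<Longrightarrow> mat_sum d e F I $$ (i,j) = (\<Sum>x\<in>I. F x $$ (i,j))"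
  by (auto simp: mat_sum_def)

lemma mat_sum_cong:
  "(\<And>i. i \<in> I \<Longrightarrow> F i = F' i) \<Longrightarrow> mat_sum d e F I = mat_sum d e F' I"
  by (auto simp: mat_sum_def intro!: eq_matI sum.cong)

lemma mult_mat_sum:
  assumes "A \<in> carrier_mat m d" "\<And>i. i \<in> I \<Longrightarrow> F i \<in> carrier_mat d e"
  shows "A * mat_sum d e F I = mat_sum m e (\<lambda>i. A * F i) I"
proof (rule eq_matI)
  fix i j assume "i < dim_row (mat_sum m e (\<lambda>i. A * F i) I)" "j < dim_col (mat_sum m e (\<lambda>i. A * F i) I)"
  then have ij: "i < m" "j < e" by auto
  have "(A * mat_sum d e F I) $$ (i,j) = (\<Sum>k\<in>{0..<d}. \<Sum>x\<in>I. A $$ (i,k) * F x $$ (k,j))"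
    using assms ij by (simp add: scalar_prod_def sum_distrib_left)
  also have "\<dots> = (\<Sum>x\<in>I. \<Sum>k\<in>{0..<d}. A $$ (i,k) * F x $$ (k,j))" by (rule sum.swap)
  also have "\<dots> = (\<Sum>x\<in>I. (A * F x) $$ (i,j))"
  proof (rule sum.cong)
    fix x assume "x \<in> I"
    then show "(\<Sum>k\<in>{0..<d}. A $$ (i,k) * F x $$ (k,j)) = (A * F x) $$ (i,j)"
      using assms(2)[of x] assms(1) ij by (simp add: scalar_prod_def)
  qed simp
  finally show "(A * mat_sum d e F I) $$ (i,j) = mat_sum m e (\<lambda>i. A * F i) I $$ (i,j)" using ij by simp
qed (use assms in auto)

lemma mat_sum_mult:
  assumes "A \<in> carrier_mat e m" "\<And>i. i \<in> I \<Longrightarrow> F i \<in> carrier_mat d e"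
  shows "mat_sum d e F I * A = mat_sum d m (\<lambda>i. F i * A) I"
proof (rule eq_matI)
  fix i j assume "i < dim_row (mat_sum d m (\<lambda>i. F i * A) I)" "j < dim_col (mat_sum d m (\<lambda>i. F i * A) I)"
  then have ij: "i < d" "j < m" by auto
  have "(mat_sum d e F I * A) $$ (i,j) = (\<Sum>k\<in>{0..<e}. \<Sum>x\<in>I. F x $$ (i,k) * A $$ (k,j))"
    using assms ij by (simp add: scalar_prod_def sum_distrib_right)
  also have "\<dots> = (\<Sum>x\<in>I. \<Sum>k\<in>{0..<e}. F x $$ (i,k) * A $$ (k,j))" by (rule sum.swap)
  also have "\<dots> = (\<Sum>x\<in>I. (F x * A) $$ (i,j))"
  proof (rule sum.cong)
    fix x assume "x \<in> I"
    then show "(\<Sum>k\<in>{0..<e}. F x $$ (i,k) * A $$ (k,j)) = (F x * A) $$ (i,j)"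
      using assms(2)[of x] assms(1) ij by (simp add: scalar_prod_def)
  qed simp
  finally show "(mat_sum d e F I * A) $$ (i,j) = mat_sum d m (\<lambda>i. F i * A) I $$ (i,j)" using ij by simp
qed (use assms in auto)

section \<open>Representations by matrices\<close>

text \<open>Prescribing the value at the unit, together with multiplicativity, makes
  \<open>\<rho> (inv g)\<close> inverse to \<open>\<rho> g\<close>; for a group the values therefore
  lie in \<open>GL d\<close> (\<open>representation_iff\<close>).\<close>

definition mat_rep :: "('g, 'b) monoid_scheme \<Rightarrow> nat \<Rightarrow> ('g \<Rightarrow> complex mat) \<Rightarrow> bool" where
  "mat_rep G d \<rho> \<longleftrightarrow> (\<forall>g\<in>carrier G. \<rho> g \<in> carrier_mat d d) \<and> \<rho> \<one>\<^bsub>G\<^esub> = 1\<^sub>m d \<and>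
     (\<forall>g\<in>carrier G. \<forall>h\<in>carrier G. \<rho> (g \<otimes>\<^bsub>G\<^esub> h) = \<rho> g * \<rho> h)"

lemma carrier_GL:
  "P \<in> carrier (GL d) \<longleftrightarrow> P \<in> carrier_mat d d \<and> (\<exists>Q\<in>carrier_mat d d. Q * P = 1\<^sub>m d \<and> P * Q = 1\<^sub>m d)"
  by (auto simp: GL_def units_of_def Units_def ring_mat_def)

lemma mult_GL [simp]: "x \<otimes>\<^bsub>GL d\<^esub> y = x * y"
  by (simp add: GL_def units_of_def ring_mat_def)

lemma one_GL [simp]: "\<one>\<^bsub>GL d\<^esub> = 1\<^sub>m d"
  by (simp add: GL_def units_of_def ring_mat_def)

lemma group_GL: "group (GL d)"
proof -
  have "monoid (ring_mat TYPE(complex) d ())"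
    using ring_mat[where ?'a=complex, of d "()"] by (simp add: ring_def ring_axioms_def)
  then show ?thesis unfolding GL_def by (rule monoid.units_group)
qed

section \<open>Representations of a fixed group and Schur's lemma\<close>

context group
begin

lemma mat_rep_carrier: "mat_rep G d \<rho> \<Longrightarrow> g \<in> carrier G \<Longrightarrow> \<rho> g \<in> carrier_mat d d"
  and mat_rep_one: "mat_rep G d \<rho> \<Longrightarrow> \<rho> \<one> = 1\<^sub>m d"
  and mat_rep_mult: "mat_rep G d \<rho> \<Longrightarrow> g \<in> carrier G \<Longrightarrow> h \<in> carrier G \<Longrightarrow> \<rho> (g \<otimes> h) = \<rho> g * \<rho> h"
  by (auto simp: mat_rep_def)

lemma mat_rep_inv:
  assumes "mat_rep G d \<rho>" "g \<in> carrier G"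
  shows "\<rho> g * \<rho> (inv g) = 1\<^sub>m d" "\<rho> (inv g) * \<rho> g = 1\<^sub>m d"
  using assms mat_rep_mult[OF assms(1), of g "inv g"] mat_rep_mult[OF assms(1), of "inv g" g]
    mat_rep_one[OF assms(1)] by simp_all

lemma mat_rep_dim_unique: "mat_rep G d \<rho> \<Longrightarrow> mat_rep G e \<rho> \<Longrightarrow> d = e"
  by (metis mat_rep_one index_one_mat(2))

lemma representation_iff: "representation G d \<rho> \<longleftrightarrow> mat_rep G d \<rho>"
proof
  assume r: "representation G d \<rho>"
  then have h: "\<rho> \<in> hom G (GL d)" by (simp add: representation_def)
  have "group_hom G (GL d) \<rho>"
    using h group_GL[of d] is_group by (simp add: group_hom_def group_hom_axioms_def)
  then have "\<rho> \<one> = 1\<^sub>m d" using group_hom.hom_one by fastforce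
  then show "mat_rep G d \<rho>" using h by (auto simp: mat_rep_def hom_def carrier_GL Pi_iff)
next
  assume r: "mat_rep G d \<rho>"
  show "representation G d \<rho>"
    unfolding representation_def hom_def
    using r mat_rep_inv[OF r] mat_rep_carrier[OF r] mat_rep_mult[OF r]
    by (auto simp: carrier_GL) (metis inv_closed)
qed

definition irrep :: "nat \<Rightarrow> ('a \<Rightarrow> complex mat) \<Rightarrow> bool" where
  "irrep d \<rho> \<longleftrightarrow> d > 0 \<and> mat_rep G d \<rho> \<and>
     (\<forall>U. vec_subspace d U \<longrightarrow> (\<forall>g\<in>carrier G. \<forall>u\<in>U. \<rho> g *\<^sub>v u \<in> U) \<longrightarrow> U = {0\<^sub>v d} \<or> U = carrier_vec d)"

lemma irreducible_rep_iff: "irreducible_rep G \<rho> \<longleftrightarrow> (\<exists>d. irrep d \<rho>)"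
  by (auto simp: irreducible_rep_def irrep_def representation_iff subspace_iff_vec_subspace)

text \<open>The range of \<open>S\<close> is stable under \<rho> and its kernel is stable under
  \<eta>. Irreducibility and \<open>S\<close> being non-zero leave only the full range and the zero
  kernel.\<close>

lemma schur_invertible:
  assumes r: "irrep d \<rho>" and e: "irrep e \<eta>" and S: "S \<in> carrier_mat d e"
    and comm: "\<And>g. g \<in> carrier G \<Longrightarrow> \<rho> g * S = S * \<eta> g" and S0: "S \<noteq> 0\<^sub>m d e"
  obtains B where "B \<in> carrier_mat e d" "S * B = 1\<^sub>m d" "B * S = 1\<^sub>m e" "d = e"
proof -
  have rr: "mat_rep G d \<rho>" and er: "mat_rep G e \<eta>" using r e by (auto simp: irrep_def)
  note rc = mat_rep_carrier[OF rr] and ec = mat_rep_carrier[OF er]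
  define R where "R = (\<lambda>v. S *\<^sub>v v) ` carrier_vec e"
  define K where "K = {v \<in> carrier_vec e. S *\<^sub>v v = 0\<^sub>v d}"
  have act: "\<rho> g *\<^sub>v (S *\<^sub>v v) = S *\<^sub>v (\<eta> g *\<^sub>v v)" if "g \<in> carrier G" "v \<in> carrier_vec e" for g v
    using assoc_mult_mat_vec[OF rc S] assoc_mult_mat_vec[OF S ec] comm that by metis
  have "vec_subspace d R" unfolding R_def by (rule range_vec_subspace[OF S])
  moreover have "\<forall>g\<in>carrier G. \<forall>u\<in>R. \<rho> g *\<^sub>v u \<in> R"
    using act ec unfolding R_def by (fastforce intro: mult_mat_vec_carrier)
  ultimately have R: "R = {0\<^sub>v d} \<or> R = carrier_vec d" using r unfolding irrep_def by blast
  have "vec_subspace e K"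
    unfolding vec_subspace_def K_def using S
    by (auto simp: mult_add_distrib_mat_vec[OF S] mult_mat_vec[OF S])
  moreover have "\<forall>g\<in>carrier G. \<forall>u\<in>K. \<eta> g *\<^sub>v u \<in> K"
  proof (intro ballI)
    fix g u assume gu: "g \<in> carrier G" "u \<in> K"
    then have "S *\<^sub>v (\<eta> g *\<^sub>v u) = \<rho> g *\<^sub>v 0\<^sub>v d" using act[of g u] by (simp add: K_def)
    also have "\<dots> = 0\<^sub>v d" using rc[OF gu(1)] by auto
    finally show "\<eta> g *\<^sub>v u \<in> K" using gu ec by (auto simp: K_def intro: mult_mat_vec_carrier)
  qed
  ultimately have K: "K = {0\<^sub>v e} \<or> K = carrier_vec e" using e unfolding irrep_def by blast
  have "K \<noteq> carrier_vec e"
  proof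
    assume K: "K = carrier_vec e"
    have "S = 0\<^sub>m d e"
    proof (rule mat_eqI_mult_vec[of _ d e])
      fix v :: "complex vec" assume v: "v \<in> carrier_vec e"
      then have "S *\<^sub>v v = 0\<^sub>v d" using K by (auto simp: K_def)
      also have "\<dots> = 0\<^sub>m d e *\<^sub>v v" using v by (intro eq_vecI) auto
      finally show "S *\<^sub>v v = 0\<^sub>m d e *\<^sub>v v" .
    qed (use S in auto)
    then show False using S0 by simp
  qed
  with K have K: "K = {0\<^sub>v e}" by blast
  have "R \<noteq> {0\<^sub>v d}"
  proof
    assume "R = {0\<^sub>v d}"
    then have "K = carrier_vec e" unfolding R_def K_def by blast
    then show False using \<open>K \<noteq> carrier_vec e\<close> by simp
  qed
  with R have R: "R = carrier_vec d" by blast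
  \<comment> \<open>Preimages of the unit vectors are the columns of a right inverse; the trivial
    kernel then makes it a left inverse too.\<close>
  have "\<forall>i<d. \<exists>v\<in>carrier_vec e. S *\<^sub>v v = unit_vec d i"
    using R unfolding R_def by (metis imageE unit_vec_carrier)
  then obtain w where w: "\<And>i. i < d \<Longrightarrow> w i \<in> carrier_vec e" "\<And>i. i < d \<Longrightarrow> S *\<^sub>v w i = unit_vec d i"
    by metis
  define B where "B = mat e d (\<lambda>(i,j). w j $ i)"
  have B: "B \<in> carrier_mat e d" by (simp add: B_def)
  have colB: "col B j = w j" if "j < d" for j using that w(1)[OF that] by (intro eq_vecI) (auto simp: B_def)
  have SB: "S * B = 1\<^sub>m d"
  proof (rule eq_matI)
    fix i j assume "i < dim_row (1\<^sub>m d :: complex mat)" "j < dim_col (1\<^sub>m d :: complex mat)"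
    then have ij: "i < d" "j < d" by auto
    have "(S * B) $$ (i,j) = (S *\<^sub>v w j) $ i" using ij S B by (simp add: colB)
    then show "(S * B) $$ (i,j) = 1\<^sub>m d $$ (i,j)" using ij w(2)[of j] by simp
  qed (use S B in auto)
  have BS: "B * S = 1\<^sub>m e"
  proof (rule mat_eqI_mult_vec[of _ e e])
    fix v :: "complex vec" assume v: "v \<in> carrier_vec e"
    have bv: "B *\<^sub>v (S *\<^sub>v v) \<in> carrier_vec e" using B S v by (auto intro!: mult_mat_vec_carrier)
    have "S *\<^sub>v (B *\<^sub>v (S *\<^sub>v v)) = S *\<^sub>v v"
      using assoc_mult_mat_vec[OF S B, of "S *\<^sub>v v"] SB S v by (metis mult_mat_vec_carrier one_mult_mat_vec)
    then have "S *\<^sub>v (B *\<^sub>v (S *\<^sub>v v) - v) = 0\<^sub>v d"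
      using mult_minus_distrib_mat_vec[OF S bv v] mult_mat_vec_carrier[OF S v] by simp
    then have "B *\<^sub>v (S *\<^sub>v v) - v \<in> K" using bv v by (auto simp: K_def)
    then have z: "B *\<^sub>v (S *\<^sub>v v) - v = 0\<^sub>v e" using K by simp
    have "x = v" if "x - v = 0\<^sub>v e" "x \<in> carrier_vec e" for x
    proof (rule eq_vecI)
      fix i assume "i < dim_vec v"
      then show "x $ i = v $ i" using arg_cong[OF that(1), of "\<lambda>u. u $ i"] v that(2) by simp
    qed (use v that in auto)
    then have "B *\<^sub>v (S *\<^sub>v v) = v" using z bv by blast
    then show "B * S *\<^sub>v v = 1\<^sub>m e *\<^sub>v v" using assoc_mult_mat_vec[OF B S v] v by simp
  qed (use B S in auto)
  have "d = e" using left_inverse_dim_le[OF S B BS] left_inverse_dim_le[OF B S SB] by simp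
  with that B SB BS show ?thesis by blast
qed

text \<open>For an eigenvalue \<open>c\<close> of \<open>S\<close>, the matrix
  \<open>S - c 1\<close> still commutes with \<rho> and kills an eigenvector, so by
  \<open>schur_invertible\<close> it can only be zero.\<close>

lemma schur_scalar:
  assumes r: "irrep d \<rho>" and S: "S \<in> carrier_mat d d"
    and comm: "\<And>g. g \<in> carrier G \<Longrightarrow> \<rho> g * S = S * \<rho> g"
  obtains c where "S = c \<cdot>\<^sub>m 1\<^sub>m d"
proof -
  have d: "d > 0" and rr: "mat_rep G d \<rho>" using r by (auto simp: irrep_def)
  note rc = mat_rep_carrier[OF rr]
  obtain c where "eigenvalue S c" using spectrum_non_empty[OF S d] by (auto simp: spectrum_def)
  then obtain v where v: "v \<in> carrier_vec d" "v \<noteq> 0\<^sub>v d" "S *\<^sub>v v = c \<cdot>\<^sub>v v"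
    using S by (auto simp: eigenvalue_def eigenvector_def)
  define T where "T = S - c \<cdot>\<^sub>m 1\<^sub>m d"
  have T: "T \<in> carrier_mat d d" by (simp add: T_def minus_carrier_mat)
  have Tv: "T *\<^sub>v v = 0\<^sub>v d"
  proof -
    have "T *\<^sub>v v = S *\<^sub>v v - (c \<cdot>\<^sub>m 1\<^sub>m d) *\<^sub>v v"
      unfolding T_def by (rule minus_mult_distrib_mat_vec[OF S _ v(1)]) simp
    also have "(c \<cdot>\<^sub>m 1\<^sub>m d) *\<^sub>v v = c \<cdot>\<^sub>v v"
      using v(1) by (intro eq_vecI) auto
    finally show ?thesis using v by simp
  qed
  have "T = 0\<^sub>m d d"
  proof (rule ccontr)
    assume T0: "T \<noteq> 0\<^sub>m d d"
    have cT: "\<rho> g * T = T * \<rho> g" if g: "g \<in> carrier G" for g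
    proof -
      have "\<rho> g * T = \<rho> g * S - \<rho> g * (c \<cdot>\<^sub>m 1\<^sub>m d)"
        unfolding T_def by (rule mult_minus_distrib_mat[OF rc[OF g] S]) simp
      also have "\<dots> = S * \<rho> g - (c \<cdot>\<^sub>m 1\<^sub>m d) * \<rho> g"
        using comm[OF g] mult_smult_distrib[OF rc[OF g], of "1\<^sub>m d" d c]
          mult_smult_assoc_mat[of "1\<^sub>m d" d d "\<rho> g" d c] rc[OF g] by simp
      also have "\<dots> = T * \<rho> g"
        unfolding T_def by (rule minus_mult_distrib_mat[symmetric, OF S _ rc[OF g]]) simp
      finally show ?thesis .
    qed
    obtain B where B: "B \<in> carrier_mat d d" "B * T = 1\<^sub>m d"
      using schur_invertible[OF r r T cT T0] by metis
    have "v = B *\<^sub>v (T *\<^sub>v v)" using B T v by (metis assoc_mult_mat_vec one_mult_mat_vec)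
    also have "\<dots> = 0\<^sub>v d" using B Tv by auto
    finally show False using v by simp
  qed
  have "S = c \<cdot>\<^sub>m 1\<^sub>m d"
  proof (rule eq_matI)
    fix i j assume "i < dim_row (c \<cdot>\<^sub>m 1\<^sub>m d)" "j < dim_col (c \<cdot>\<^sub>m 1\<^sub>m d)"
    then have ij: "i < d" "j < d" by auto
    show "S $$ (i,j) = (c \<cdot>\<^sub>m 1\<^sub>m d) $$ (i,j)"
      using arg_cong[OF \<open>T = 0\<^sub>m d d\<close>, of "\<lambda>M. M $$ (i,j)"] ij S by (simp add: T_def)
  qed (use S in auto)
  then show ?thesis by (rule that)
qed

text \<open>Up to the factor |G|, this is the standard projection of matrices onto the intertwiners
  from \<eta> to \<rho>.\<close>

definition intertwiner_avg :: "nat \<Rightarrow> nat \<Rightarrow> ('a \<Rightarrow> complex mat) \<Rightarrow> ('a \<Rightarrow> complex mat) \<Rightarrow> complex mat \<Rightarrow> complex mat"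
  where "intertwiner_avg d e \<rho> \<eta> M = mat_sum d e (\<lambda>g. \<rho> g * M * \<eta> (inv g)) (carrier G)"

lemma intertwiner_avg_carrier [simp]: "intertwiner_avg d e \<rho> \<eta> M \<in> carrier_mat d e"
  by (simp add: intertwiner_avg_def)

lemma intertwiner_avg_commute:
  assumes r: "mat_rep G d \<rho>" and e: "mat_rep G e \<eta>" and M: "M \<in> carrier_mat d e" and h: "h \<in> carrier G"
  shows "\<rho> h * intertwiner_avg d e \<rho> \<eta> M = intertwiner_avg d e \<rho> \<eta> M * \<eta> h" (is "?L = _")
proof -
  note rc = mat_rep_carrier[OF r] and ec = mat_rep_carrier[OF e]
  have "?L = mat_sum d e (\<lambda>g. \<rho> h * (\<rho> g * M * \<eta> (inv g))) (carrier G)"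
    unfolding intertwiner_avg_def
    by (rule mult_mat_sum) (use rc ec M h in \<open>auto intro!: mult_carrier_mat\<close>)
  \<comment> \<open>Written in terms of \<open>h \<otimes> g\<close>, the summand only asks for a
    change of summation variable and leaves \<open>\<eta> h\<close> on the right.\<close>
  also have "\<dots> = mat_sum d e (\<lambda>g. (\<rho> (h \<otimes> g) * M * \<eta> (inv (h \<otimes> g))) * \<eta> h) (carrier G)"
  proof (rule mat_sum_cong)
    fix g assume g: "g \<in> carrier G"
    have "\<eta> (inv (h \<otimes> g)) * \<eta> h = \<eta> (inv (h \<otimes> g) \<otimes> h)" using g h by (simp add: mat_rep_mult[OF e])
    also have "inv (h \<otimes> g) \<otimes> h = inv g" using g h by (simp add: inv_mult_group m_assoc)
    finally have 1: "\<eta> (inv (h \<otimes> g)) * \<eta> h = \<eta> (inv g)" .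
    have hg: "h \<otimes> g \<in> carrier G" "inv (h \<otimes> g) \<in> carrier G" "inv g \<in> carrier G" using g h by auto
    have "(\<rho> (h \<otimes> g) * M * \<eta> (inv (h \<otimes> g))) * \<eta> h = \<rho> (h \<otimes> g) * M * (\<eta> (inv (h \<otimes> g)) * \<eta> h)"
      by (rule assoc_mult_mat[OF mult_carrier_mat[OF rc[OF hg(1)] M] ec[OF hg(2)] ec[OF h]])
    also have "\<dots> = \<rho> h * \<rho> g * M * \<eta> (inv g)" using 1 mat_rep_mult[OF r h g] by simp
    also have "\<dots> = \<rho> h * (\<rho> g * M * \<eta> (inv g))"
      using assoc_mult_mat[OF rc[OF h] rc[OF g] M]
        assoc_mult_mat[OF rc[OF h] mult_carrier_mat[OF rc[OF g] M] ec[OF hg(3)]] by simp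
    finally show "\<rho> h * (\<rho> g * M * \<eta> (inv g)) = (\<rho> (h \<otimes> g) * M * \<eta> (inv (h \<otimes> g))) * \<eta> h" by simp
  qed
  also have "\<dots> = mat_sum d e (\<lambda>g. (\<rho> g * M * \<eta> (inv g)) * \<eta> h) (carrier G)"
  proof -
    have b: "bij_betw (\<lambda>g. h \<otimes> g) (carrier G) (carrier G)"
      by (rule bij_betw_byWitness[where f' = "\<lambda>g. inv h \<otimes> g"]) (use h in \<open>auto simp: m_assoc[symmetric]\<close>)
    show ?thesis
      unfolding mat_sum_def
      by (rule eq_matI) (auto intro: sum.reindex_bij_betw[OF b, of "\<lambda>g. (\<rho> g * M * \<eta> (inv g) * \<eta> h) $$ p" for p])
  qed
  also have "\<dots> = intertwiner_avg d e \<rho> \<eta> M * \<eta> h"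
    unfolding intertwiner_avg_def
    by (rule mat_sum_mult[symmetric]) (use rc ec M h in \<open>auto intro!: mult_carrier_mat\<close>)
  finally show ?thesis .
qed

end

section \<open>Schur orthogonality\<close>

lemma sum_swap2: "(\<Sum>x\<in>A. \<Sum>b\<in>B. \<Sum>c\<in>C. f x b c) = (\<Sum>b\<in>B. \<Sum>c\<in>C. \<Sum>x\<in>A. f x b c)"
  by (subst sum.swap) (rule sum.cong[OF refl], rule sum.swap)

text \<open>Averaging a matrix unit therefore produces a single coefficient sum in each entry
  (\<open>intertwiner_avg_unit_index\<close>); this is how Schur's lemma is turned into
  orthogonality relations.\<close>

lemma mult_matrix_unit_index:
  fixes A C :: "complex mat"
  assumes "A \<in> carrier_mat m d" "C \<in> carrier_mat e n" "i < m" "l < n" "j < d" "k < e"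
  shows "(A * mat d e (\<lambda>(a,b). if a = j \<and> b = k then 1 else 0) * C) $$ (i,l) = A $$ (i,j) * C $$ (k,l)" (is "?L = _")
proof -
  have 1: "(A * mat d e (\<lambda>(a,b). if a = j \<and> b = k then 1 else 0)) $$ (i,b) = (if b = k then A $$ (i,j) else 0)"
    if "b < e" for b
  proof -
    have "(A * mat d e (\<lambda>(a,b). if a = j \<and> b = k then 1 else 0)) $$ (i,b) =
      (\<Sum>a\<in>{0..<d}. if a = j then (if b = k then A $$ (i,a) else 0) else 0)"
      using that assms by (auto simp: scalar_prod_def simp del: sum.delta' sum.delta intro!: sum.cong)
    also have "\<dots> = (if b = k then A $$ (i,j) else 0)" using assms by (simp add: sum.delta)
    finally show ?thesis .
  qed
  have "?L =
      (\<Sum>b\<in>{0..<e}. (A * mat d e (\<lambda>(a,b). if a = j \<and> b = k then 1 else 0)) $$ (i,b) * C $$ (b,l))"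
    using assms by (simp add: scalar_prod_def del: assoc_mult_mat)
  also have "\<dots> = (\<Sum>b\<in>{0..<e}. if b = k then A $$ (i,j) * C $$ (b,l) else 0)"
    by (rule sum.cong) (auto simp: 1)
  also have "\<dots> = A $$ (i,j) * C $$ (k,l)" using assms by (simp add: sum.delta)
  finally show ?thesis .
qed

lemma inverse_intertwines:
  fixes A B C S :: "complex mat"
  assumes A: "A \<in> carrier_mat d d" and C: "C \<in> carrier_mat e e" and S: "S \<in> carrier_mat d e"
    and B: "B \<in> carrier_mat e d" and SB: "S * B = 1\<^sub>m d" and BS: "B * S = 1\<^sub>m e" and AS: "A * S = S * C"
  shows "B * A = C * B"
proof -
  have "A = A * (S * B)" using A by (simp add: SB)
  also have "\<dots> = (A * S) * B" by (rule assoc_mult_mat[symmetric, OF A S B])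
  also have "\<dots> = S * (C * B)" unfolding AS by (rule assoc_mult_mat[OF S C B])
  finally have "B * A = B * (S * (C * B))" by simp
  also have "\<dots> = (B * S) * (C * B)" by (rule assoc_mult_mat[symmetric, OF B S mult_carrier_mat[OF C B]])
  also have "\<dots> = C * B" unfolding BS by (rule left_mult_one_mat[OF mult_carrier_mat[OF C B]])
  finally show ?thesis .
qed

lemma mult3_index:
  fixes A B C :: "complex mat"
  assumes "A \<in> carrier_mat m d" "B \<in> carrier_mat d e" "C \<in> carrier_mat e n" "i < m" "l < n"
  shows "(A * B * C) $$ (i,l) = (\<Sum>j<d. \<Sum>k<e. B $$ (j,k) * (A $$ (i,j) * C $$ (k,l)))"
proof -
  have "(A * B * C) $$ (i,l) = (\<Sum>k\<in>{0..<e}. (A * B) $$ (i,k) * C $$ (k,l))"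
    using assms by (simp add: scalar_prod_def del: assoc_mult_mat)
  also have "\<dots> = (\<Sum>k<e. \<Sum>j<d. B $$ (j,k) * (A $$ (i,j) * C $$ (k,l)))"
  proof (rule sum.cong)
    fix k assume "k \<in> {..<e}"
    then have "(A * B) $$ (i,k) = (\<Sum>j<d. A $$ (i,j) * B $$ (j,k))"
      using assms by (simp add: scalar_prod_def atLeast0LessThan)
    then show "(A * B) $$ (i,k) * C $$ (k,l) = (\<Sum>j<d. B $$ (j,k) * (A $$ (i,j) * C $$ (k,l)))"
      by (simp add: sum_distrib_right sum_distrib_left mult_ac)
  qed auto
  also have "\<dots> = (\<Sum>j<d. \<Sum>k<e. B $$ (j,k) * (A $$ (i,j) * C $$ (k,l)))" by (rule sum.swap)
  finally show ?thesis .
qed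

lemma vec_subspace_sum:
  assumes "vec_subspace d U" "finite I" "\<And>x. x \<in> I \<Longrightarrow> f x \<in> U"
  shows "vec d (\<lambda>i. \<Sum>x\<in>I. a x * f x $ i) \<in> U"
  using assms(2,3)
proof (induction I)
  case empty
  have "vec d (\<lambda>i. \<Sum>x\<in>{}. a x * f x $ i) = 0\<^sub>v d" by auto
  then show ?case using assms(1) by (simp add: vec_subspace_def)
next
  case (insert x I)
  then have fx: "f x \<in> U" and I: "vec d (\<lambda>i. \<Sum>x\<in>I. a x * f x $ i) \<in> U" by auto
  have "f x \<in> carrier_vec d" using assms(1) fx by (auto simp: vec_subspace_def)
  then have "vec d (\<lambda>i. \<Sum>x\<in>insert x I. a x * f x $ i) = a x \<cdot>\<^sub>v f x + vec d (\<lambda>i. \<Sum>x\<in>I. a x * f x $ i)"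
    using insert by (intro eq_vecI) auto
  then show ?case using assms(1) fx I by (simp add: vec_subspace_def)
qed

section \<open>Orthogonality relations for coefficients and their converse\<close>

context group
begin

text \<open>The value at \<open>inv g\<close> takes the place of the complex conjugate of a value at
  \<open>g\<close>, which makes the pairing meaningful in any basis.\<close>

abbreviation coeff_sum ::
  "('a \<Rightarrow> complex mat) \<Rightarrow> nat \<times> nat \<Rightarrow> ('a \<Rightarrow> complex mat) \<Rightarrow> nat \<times> nat \<Rightarrow> complex" where
  "coeff_sum \<rho> p \<eta> q \<equiv> \<Sum>g\<in>carrier G. \<rho> g $$ p * \<eta> (inv g) $$ q"

definition coeff_orth :: "nat \<Rightarrow> ('a \<Rightarrow> complex mat) \<Rightarrow> nat \<Rightarrow> ('a \<Rightarrow> complex mat) \<Rightarrow> bool" where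
  "coeff_orth d \<rho> e \<eta> \<longleftrightarrow> (\<forall>i<d. \<forall>j<d. \<forall>k<e. \<forall>l<e.
     coeff_sum \<rho> (i,j) \<eta> (k,l) = 0)"

text \<open>For an irreducible representation the constant is |G| / d
  (\<open>schur_orthogonality\<close>). It is left open so that constants arising as products for
  induced representations fit as well.\<close>

definition self_orth :: "nat \<Rightarrow> ('a \<Rightarrow> complex mat) \<Rightarrow> bool" where
  "self_orth d \<rho> \<longleftrightarrow> (\<exists>c. c \<noteq> 0 \<and> (\<forall>i<d. \<forall>j<d. \<forall>k<d. \<forall>l<d.
     coeff_sum \<rho> (i,j) \<rho> (k,l) = (if i = l \<and> j = k then c else 0)))"

lemma intertwiner_avg_index:
  assumes r: "mat_rep G d \<rho>" and e: "mat_rep G e \<eta>" and M: "M \<in> carrier_mat d e" and "i < d" "l < e"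
  shows "intertwiner_avg d e \<rho> \<eta> M $$ (i,l) =
    (\<Sum>j<d. \<Sum>k<e. M $$ (j,k) * coeff_sum \<rho> (i,j) \<eta> (k,l))" (is "?L = _")
proof -
  have "?L = (\<Sum>g\<in>carrier G. (\<rho> g * M * \<eta> (inv g)) $$ (i,l))"
    using assms by (simp add: intertwiner_avg_def)
  also have "\<dots> = (\<Sum>g\<in>carrier G. \<Sum>j<d. \<Sum>k<e. M $$ (j,k) * (\<rho> g $$ (i,j) * \<eta> (inv g) $$ (k,l)))"
    by (rule sum.cong) (use mult3_index[OF mat_rep_carrier[OF r] M mat_rep_carrier[OF e]] assms in auto)
  also have "\<dots> = (\<Sum>j<d. \<Sum>k<e. \<Sum>g\<in>carrier G. M $$ (j,k) * (\<rho> g $$ (i,j) * \<eta> (inv g) $$ (k,l)))"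
    by (rule sum_swap2)
  finally show ?thesis by (simp add: sum_distrib_left)
qed

lemma intertwiner_avg_unit_index:
  assumes r: "mat_rep G d \<rho>" and e: "mat_rep G e \<eta>" and "i < d" "l < e" "j < d" "k < e"
  shows "intertwiner_avg d e \<rho> \<eta> (mat d e (\<lambda>(a,b). if a = j \<and> b = k then 1 else 0)) $$ (i,l) =
    coeff_sum \<rho> (i,j) \<eta> (k,l)"
  using assms mult_matrix_unit_index[OF mat_rep_carrier[OF r] mat_rep_carrier[OF e]]
  by (simp add: intertwiner_avg_def)

text \<open>The average of a matrix unit is an intertwiner. If it were non-zero it would be
  invertible by \<open>schur_invertible\<close>, and its inverse would be an equivalence.\<close>

lemma inequivalent_coeff_orth:
  assumes r: "irrep d \<rho>" and e: "irrep e \<eta>" and ne: "\<not> equivalent_reps G \<rho> \<eta>"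
  shows "coeff_orth d \<rho> e \<eta>"
  unfolding coeff_orth_def
proof (intro allI impI)
  fix i j k l assume ijkl: "i < d" "j < d" "k < e" "l < e"
  have rr: "mat_rep G d \<rho>" and er: "mat_rep G e \<eta>" using r e by (auto simp: irrep_def)
  let ?M = "mat d e (\<lambda>(a,b). if a = j \<and> b = k then 1 else 0 :: complex)"
  let ?S = "intertwiner_avg d e \<rho> \<eta> ?M"
  have M: "?M \<in> carrier_mat d e" by simp
  note comm = intertwiner_avg_commute[OF rr er M]
  have "?S = 0\<^sub>m d e"
  proof (rule ccontr)
    assume "?S \<noteq> 0\<^sub>m d e"
    then obtain B where B: "B \<in> carrier_mat e d" "?S * B = 1\<^sub>m d" "B * ?S = 1\<^sub>m e" "d = e"
      using schur_invertible[OF r e intertwiner_avg_carrier comm] by metis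
    have "B * \<rho> g = \<eta> g * B" if g: "g \<in> carrier G" for g
      by (rule inverse_intertwines[OF mat_rep_carrier[OF rr g] mat_rep_carrier[OF er g]
            intertwiner_avg_carrier B(1-3) comm[OF g]])
    moreover have "B \<in> carrier (GL d)"
      unfolding carrier_GL using B intertwiner_avg_carrier by blast
    ultimately have "equivalent_reps G \<rho> \<eta>"
      unfolding equivalent_reps_def representation_iff using rr er B(4) by blast
    then show False using ne by simp
  qed
  then show "coeff_sum \<rho> (i,j) \<eta> (k,l) = 0"
    using intertwiner_avg_unit_index[OF rr er ijkl(1,4,2,3)] ijkl by simp
qed

text \<open>The average of the matrix unit at (j,k) is a scalar matrix. Its trace determines the
  scalar: summed over the diagonal, the products collapse to
  \<open>\<rho> (inv g) * \<rho> g\<close>, the identity.\<close>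

lemma schur_orthogonality:
  assumes r: "irrep d \<rho>" and ijkl: "i < d" "j < d" "k < d" "l < d"
  shows "coeff_sum \<rho> (i,j) \<rho> (k,l) =
    (if i = l \<and> j = k then of_nat (card (carrier G)) / of_nat d else 0)"
proof -
  have rr: "mat_rep G d \<rho>" and d: "d > 0" using r by (auto simp: irrep_def)
  let ?M = "mat d d (\<lambda>(a,b). if a = j \<and> b = k then 1 else 0 :: complex)"
  let ?S = "intertwiner_avg d d \<rho> \<rho> ?M"
  have M: "?M \<in> carrier_mat d d" by simp
  obtain c where c: "?S = c \<cdot>\<^sub>m 1\<^sub>m d"
    using schur_scalar[OF r intertwiner_avg_carrier intertwiner_avg_commute[OF rr rr M]] by metis
  have "of_nat d * c = (\<Sum>a<d. ?S $$ (a,a))" by (simp add: c)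
  also have "\<dots> = (\<Sum>a<d. \<Sum>g\<in>carrier G. \<rho> g $$ (a,j) * \<rho> (inv g) $$ (k,a))"
    using intertwiner_avg_unit_index[OF rr rr _ _ ijkl(2,3)] by simp
  also have "\<dots> = (\<Sum>g\<in>carrier G. \<Sum>a<d. \<rho> (inv g) $$ (k,a) * \<rho> g $$ (a,j))"
    by (subst sum.swap) (simp add: mult.commute)
  also have "\<dots> = (\<Sum>g\<in>carrier G. (\<rho> (inv g) * \<rho> g) $$ (k,j))"
  proof (rule sum.cong[OF refl])
    fix g assume g: "g \<in> carrier G"
    show "(\<Sum>a<d. \<rho> (inv g) $$ (k,a) * \<rho> g $$ (a,j)) = (\<rho> (inv g) * \<rho> g) $$ (k,j)"
      using mat_rep_carrier[OF rr g] mat_rep_carrier[OF rr inv_closed[OF g]] ijkl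
      by (simp add: scalar_prod_def atLeast0LessThan)
  qed
  also have "\<dots> = (if j = k then of_nat (card (carrier G)) else 0)"
    using mat_rep_inv(2)[OF rr] ijkl by simp
  finally have "c = (if j = k then of_nat (card (carrier G)) / of_nat d else 0)"
    using d by (auto simp: field_simps split: if_splits)
  moreover have "coeff_sum \<rho> (i,j) \<rho> (k,l) = (c \<cdot>\<^sub>m 1\<^sub>m d) $$ (i,l)"
    using intertwiner_avg_unit_index[OF rr rr ijkl(1,4,2,3)] by (simp only: c)
  ultimately show ?thesis using ijkl by simp
qed

lemma irrep_self_orth:
  assumes "irrep d \<rho>" "finite (carrier G)"
  shows "self_orth d \<rho>"
proof -
  have "carrier G \<noteq> {}" by auto
  then have "of_nat (card (carrier G)) / of_nat d \<noteq> (0 :: complex)"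
    using assms by (simp add: irrep_def)
  then show ?thesis unfolding self_orth_def using schur_orthogonality[OF assms(1)] by blast
qed

text \<open>Let \<open>U\<close> contain \<open>u\<close> with \<open>u $ k\<close> non-zero.
  Summing the vectors \<open>\<rho> g *\<^sub>v u\<close> with weights
  \<open>\<rho> (inv g) $$ (k,l)\<close> stays in \<open>U\<close> and gives
  \<open>c * u $ k\<close> times the unit vector \<open>l\<close>, so \<open>U\<close> contains all
  unit vectors.\<close>

lemma self_orth_irrep:
  assumes r: "mat_rep G d \<rho>" and d: "d > 0" and s: "self_orth d \<rho>" and fin: "finite (carrier G)"
  shows "irrep d \<rho>"
  unfolding irrep_def
proof (intro conjI allI impI)
  fix U assume U: "vec_subspace d U" and inv: "\<forall>g\<in>carrier G. \<forall>u\<in>U. \<rho> g *\<^sub>v u \<in> U"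
  have Uc: "U \<subseteq> carrier_vec d" and U0: "0\<^sub>v d \<in> U" using U by (auto simp: vec_subspace_def)
  show "U = {0\<^sub>v d} \<or> U = carrier_vec d"
  proof (cases "U = {0\<^sub>v d}")
    case False
    then obtain u where u: "u \<in> U" "u \<noteq> 0\<^sub>v d" using U0 by blast
    have uc: "u \<in> carrier_vec d" using u Uc by blast
    obtain k where k: "k < d" "u $ k \<noteq> 0"
    proof (rule ccontr)
      assume "\<not> thesis"
      then have "\<forall>k<d. u $ k = 0" using that by blast
      then have "u = 0\<^sub>v d" using uc by (intro eq_vecI) auto
      then show False using u by simp
    qed
    obtain c where c: "c \<noteq> 0" and s': "\<And>i j k l. i<d \<Longrightarrow> j<d \<Longrightarrow> k<d \<Longrightarrow> l<d \<Longrightarrow>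
       coeff_sum \<rho> (i,j) \<rho> (k,l) = (if i = l \<and> j = k then c else 0)"
      using s unfolding self_orth_def by blast
    have e: "unit_vec d l \<in> U" if l: "l < d" for l
    proof -
      let ?w = "vec d (\<lambda>i. \<Sum>g\<in>carrier G. \<rho> (inv g) $$ (k,l) * (\<rho> g *\<^sub>v u) $ i)"
      have "?w \<in> U" by (rule vec_subspace_sum[OF U fin]) (use inv u in blast)
      moreover have "?w = (c * u $ k) \<cdot>\<^sub>v unit_vec d l"
      proof (rule eq_vecI)
        fix i assume "i < dim_vec ((c * u $ k) \<cdot>\<^sub>v unit_vec d l)"
        then have i: "i < d" by simp
        have "?w $ i = (\<Sum>g\<in>carrier G. \<Sum>j<d. u $ j * (\<rho> g $$ (i,j) * \<rho> (inv g) $$ (k,l)))"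
        proof -
          have "\<rho> (inv g) $$ (k,l) * (\<rho> g *\<^sub>v u) $ i = (\<Sum>j<d. u $ j * (\<rho> g $$ (i,j) * \<rho> (inv g) $$ (k,l)))"
            if g: "g \<in> carrier G" for g
            using mat_rep_carrier[OF r g] uc i
            by (simp add: scalar_prod_def atLeast0LessThan sum_distrib_left mult_ac)
          then show ?thesis using i by simp
        qed
        also have "\<dots> = (\<Sum>j<d. u $ j * coeff_sum \<rho> (i,j) \<rho> (k,l))"
          by (subst sum.swap) (simp add: sum_distrib_left)
        also have "\<dots> = (\<Sum>j<d. if j = k then (if i = l then c * u $ k else 0) else 0)"
          using s' i k l by (intro sum.cong) auto
        also have "\<dots> = (if i = l then c * u $ k else 0)" using k by (simp add: sum.delta)
        finally show "?w $ i = ((c * u $ k) \<cdot>\<^sub>v unit_vec d l) $ i" using i l by simp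
      qed simp
      ultimately have "(c * u $ k) \<cdot>\<^sub>v unit_vec d l \<in> U" by simp
      then have "(1 / (c * u $ k)) \<cdot>\<^sub>v ((c * u $ k) \<cdot>\<^sub>v unit_vec d l) \<in> U"
        using U unfolding vec_subspace_def by blast
      then show ?thesis using c k by (simp add: smult_smult_assoc)
    qed
    have "v \<in> U" if v: "v \<in> carrier_vec d" for v
    proof -
      have "vec d (\<lambda>i. \<Sum>l\<in>{..<d}. v $ l * unit_vec d l $ i) \<in> U"
        by (rule vec_subspace_sum[OF U]) (use e in auto)
      moreover have "vec d (\<lambda>i. \<Sum>l\<in>{..<d}. v $ l * unit_vec d l $ i) = v"
      proof (rule eq_vecI)
        fix i assume "i < dim_vec v"
        then have i: "i < d" using v by simp
        have "(\<Sum>l\<in>{..<d}. v $ l * unit_vec d l $ i) = (\<Sum>l\<in>{..<d}. if l = i then v $ l else 0)"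
          by (rule sum.cong) (use i in auto)
        then show "vec d (\<lambda>i. \<Sum>l\<in>{..<d}. v $ l * unit_vec d l $ i) $ i = v $ i" using i by (simp add: sum.delta)
      qed (use v in simp)
      ultimately show ?thesis by simp
    qed
    then show ?thesis using Uc by blast
  qed simp
qed (use assms in auto)

text \<open>An intertwiner equals its own average up to the factor |G|, and the entries of an
  average are combinations of coefficient sums, all of which vanish here.\<close>

lemma coeff_orth_intertwiner:
  assumes o: "coeff_orth d \<rho> e \<eta>" and r: "mat_rep G d \<rho>" "mat_rep G e \<eta>" and S: "S \<in> carrier_mat d e"
    and comm: "\<And>g. g \<in> carrier G \<Longrightarrow> \<rho> g * S = S * \<eta> g" and fin: "finite (carrier G)"
  shows "S = 0\<^sub>m d e"
proof -
  let ?N = "of_nat (card (carrier G)) :: complex"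
  have "carrier G \<noteq> {}" by auto
  then have N: "?N \<noteq> 0" using fin by simp
  have "\<rho> g * S * \<eta> (inv g) = S" if g: "g \<in> carrier G" for g
    unfolding comm[OF g] assoc_mult_mat[OF S mat_rep_carrier[OF r(2) g] mat_rep_carrier[OF r(2) inv_closed[OF g]]]
      mat_rep_inv(1)[OF r(2) g] by (rule right_mult_one_mat[OF S])
  then have avg: "intertwiner_avg d e \<rho> \<eta> S = mat_sum d e (\<lambda>g. S) (carrier G)"
    unfolding intertwiner_avg_def by (intro mat_sum_cong)
  show ?thesis
  proof (rule eq_matI)
    fix i j assume "i < dim_row (0\<^sub>m d e :: complex mat)" "j < dim_col (0\<^sub>m d e :: complex mat)"
    then have ij: "i < d" "j < e" by auto
    have "?N * S $$ (i,j) = intertwiner_avg d e \<rho> \<eta> S $$ (i,j)" unfolding avg using ij by simp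
    also have "\<dots> = 0" using intertwiner_avg_index[OF r S ij] o ij by (simp add: coeff_orth_def)
    finally show "S $$ (i,j) = 0\<^sub>m d e $$ (i,j)" using N ij by simp
  qed (use S in auto)
qed

lemma equivalent_repsE:
  assumes "equivalent_reps G \<rho> \<eta>" "mat_rep G d \<rho>"
  obtains P Q where "P \<in> carrier_mat d d" "Q \<in> carrier_mat d d" "Q * P = 1\<^sub>m d" "P * Q = 1\<^sub>m d"
    "\<And>g. g \<in> carrier G \<Longrightarrow> P * \<rho> g = \<eta> g * P" "mat_rep G d \<eta>"
proof -
  obtain k P where r: "mat_rep G k \<rho>" "mat_rep G k \<eta>" "P \<in> carrier (GL k)"
      "\<forall>g\<in>carrier G. P * \<rho> g = \<eta> g * P"
    using assms(1) by (auto simp: equivalent_reps_def representation_iff)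
  have "k = d" using mat_rep_dim_unique[OF r(1) assms(2)] .
  then show ?thesis using that r by (auto simp: carrier_GL)
qed

text \<open>Two equivalences with the same \<theta> compose to an invertible intertwiner from \<eta>
  to \<rho>, whereas \<open>coeff_orth_intertwiner\<close> makes it zero. The third representation
  is there because a traversal asks for a unique member equivalent to a given one.\<close>

lemma coeff_orth_no_common_equivalent:
  assumes o: "coeff_orth d \<rho> e \<eta>" and r: "mat_rep G d \<rho>" "mat_rep G e \<eta>" and d: "d > 0"
    and fin: "finite (carrier G)" and eq: "equivalent_reps G \<rho> \<theta>" "equivalent_reps G \<eta> \<theta>"
  shows False
proof -
  obtain P Q where P: "P \<in> carrier_mat d d" "Q \<in> carrier_mat d d" "Q * P = 1\<^sub>m d" "P * Q = 1\<^sub>m d"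
    "\<And>g. g \<in> carrier G \<Longrightarrow> P * \<rho> g = \<theta> g * P" and t: "mat_rep G d \<theta>"
    using equivalent_repsE[OF eq(1) r(1)] by metis
  obtain R R' where R: "R \<in> carrier_mat e e" "R' \<in> carrier_mat e e" "R' * R = 1\<^sub>m e" "R * R' = 1\<^sub>m e"
    "\<And>g. g \<in> carrier G \<Longrightarrow> R * \<eta> g = \<theta> g * R" and t': "mat_rep G e \<theta>"
    using equivalent_repsE[OF eq(2) r(2)] by metis
  have de: "e = d" by (rule mat_rep_dim_unique[OF t' t])
  note R = R[unfolded de]
  have er: "mat_rep G d \<eta>" using r(2) de by simp
  have "Q * R = 0\<^sub>m d d"
  proof (rule coeff_orth_intertwiner[OF o[unfolded de] r(1) er mult_carrier_mat[OF P(2) R(1)] _ fin])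
    fix g assume g: "g \<in> carrier G"
    note c = mat_rep_carrier[OF r(1) g] mat_rep_carrier[OF er g] mat_rep_carrier[OF t g]
    have "\<rho> g * Q = Q * \<theta> g"
      by (rule inverse_intertwines[OF c(3,1) P(1,2,4,3) P(5)[OF g, symmetric], symmetric])
    then show "\<rho> g * (Q * R) = Q * R * \<eta> g"
      using assoc_mult_mat[OF c(1) P(2) R(1)] assoc_mult_mat[OF P(2) c(3) R(1)]
        assoc_mult_mat[OF P(2) R(1) c(2)] R(5)[OF g] by simp
  qed
  then have "P * (Q * R) * R' = 0\<^sub>m d d" using P(1) R(2) by simp
  moreover have "P * (Q * R) * R' = 1\<^sub>m d"
    using assoc_mult_mat[OF P(1,2) R(1)] P(4) R(1,4) by simp
  ultimately have "(1\<^sub>m d :: complex mat) = 0\<^sub>m d d" by simp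
  then have "(1\<^sub>m d :: complex mat) $$ (0,0) = 0" using d by (metis index_zero_mat(1))
  then show False using d by simp
qed

end

section \<open>Complete reducibility and completeness of matrix coefficients\<close>

context group
begin

text \<open>The action of the group algebra element with coefficient function \<open>f\<close>. It
  vanishes exactly when \<open>f\<close> has zero pairing with every coefficient of \<rho>
  (\<open>rep_sum_eq_0_iff\<close>).\<close>

definition rep_sum :: "nat \<Rightarrow> ('a \<Rightarrow> complex mat) \<Rightarrow> ('a \<Rightarrow> complex) \<Rightarrow> complex mat" where
  "rep_sum d \<rho> f = mat_sum d d (\<lambda>g. f g \<cdot>\<^sub>m \<rho> g) (carrier G)"

lemma rep_sum_carrier [simp]: "rep_sum d \<rho> f \<in> carrier_mat d d"
  by (simp add: rep_sum_def)

lemma rep_sum_index: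
  assumes "mat_rep G d \<rho>" "i < d" "j < d"
  shows "rep_sum d \<rho> f $$ (i,j) = (\<Sum>g\<in>carrier G. f g * \<rho> g $$ (i,j))"
proof -
  have "(f g \<cdot>\<^sub>m \<rho> g) $$ (i,j) = f g * \<rho> g $$ (i,j)" if "g \<in> carrier G" for g
    using mat_rep_carrier[OF assms(1) that] assms by simp
  then show ?thesis using assms by (simp add: rep_sum_def)
qed

lemma rep_sum_eq_0_iff:
  assumes "mat_rep G d \<rho>"
  shows "rep_sum d \<rho> f = 0\<^sub>m d d \<longleftrightarrow> (\<forall>i<d. \<forall>j<d. (\<Sum>g\<in>carrier G. f g * \<rho> g $$ (i,j)) = 0)"
proof
  assume "rep_sum d \<rho> f = 0\<^sub>m d d"
  then show "\<forall>i<d. \<forall>j<d. (\<Sum>g\<in>carrier G. f g * \<rho> g $$ (i,j)) = 0"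
    using rep_sum_index[OF assms, of _ _ f] by simp
next
  assume "\<forall>i<d. \<forall>j<d. (\<Sum>g\<in>carrier G. f g * \<rho> g $$ (i,j)) = 0"
  then show "rep_sum d \<rho> f = 0\<^sub>m d d"
    using rep_sum_index[OF assms, of _ _ f] rep_sum_carrier[of d \<rho> f]
    by (intro eq_matI) (auto simp del: rep_sum_carrier)
qed

lemma rep_sum_intertwine:
  assumes r: "mat_rep G d \<rho>" and e: "mat_rep G e \<eta>" and A: "A \<in> carrier_mat d e"
    and c: "\<And>g. g \<in> carrier G \<Longrightarrow> \<rho> g * A = A * \<eta> g"
  shows "rep_sum d \<rho> f * A = A * rep_sum e \<eta> f"
proof -
  note rc = mat_rep_carrier[OF r] and ec = mat_rep_carrier[OF e]
  have "rep_sum d \<rho> f * A = mat_sum d e (\<lambda>g. (f g \<cdot>\<^sub>m \<rho> g) * A) (carrier G)"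
    unfolding rep_sum_def by (rule mat_sum_mult[OF A]) (use rc in auto)
  also have "\<dots> = mat_sum d e (\<lambda>g. A * (f g \<cdot>\<^sub>m \<eta> g)) (carrier G)"
    by (rule mat_sum_cong)
      (use c mult_smult_assoc_mat[OF rc A] mult_smult_distrib[OF A ec] in simp)
  also have "\<dots> = A * rep_sum e \<eta> f"
    unfolding rep_sum_def by (rule mult_mat_sum[symmetric, OF A]) (use ec in auto)
  finally show ?thesis .
qed

text \<open>Averaging a projection onto \<open>U\<close> over the group keeps the range and makes
  the projection commute with the action. The last two conclusions ensure that a proper non-zero
  \<open>U\<close> gives an idempotent other than 0 and 1.\<close>

lemma maschke:
  assumes r: "mat_rep G d \<eta>" and U: "vec_subspace d U" and fin: "finite (carrier G)"
    and inv: "\<And>g u. g \<in> carrier G \<Longrightarrow> u \<in> U \<Longrightarrow> \<eta> g *\<^sub>v u \<in> U"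
  obtains P where "P \<in> carrier_mat d d" "P * P = P" "\<And>g. g \<in> carrier G \<Longrightarrow> \<eta> g * P = P * \<eta> g"
    "P = 1\<^sub>m d \<Longrightarrow> U = carrier_vec d" "P = 0\<^sub>m d d \<Longrightarrow> U = {0\<^sub>v d}"
proof -
  obtain e A B where A: "A \<in> carrier_mat d e" and B: "B \<in> carrier_mat e d" and BA: "B * A = 1\<^sub>m e"
    and ran: "(\<lambda>v. A *\<^sub>v v) ` carrier_vec e = U"
    using vec_subspace_eq_range[OF U] by metis
  note rc = mat_rep_carrier[OF r]
  let ?N = "of_nat (card (carrier G)) :: complex"
  have "carrier G \<noteq> {}" by auto
  then have N: "?N \<noteq> 0" using fin by simp
  \<comment> \<open>\<open>A * B\<close> is the identity on \<open>U\<close>, and \<open>U\<close>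
    contains the range of \<open>\<eta> g * A\<close>.\<close>
  have int: "A * (B * (\<eta> g * A)) = \<eta> g * A" if g: "g \<in> carrier G" for g
  proof (rule mat_eqI_mult_vec[of _ d e])
    note gA = mult_carrier_mat[OF rc[OF g] A]
    fix v :: "complex vec" assume v: "v \<in> carrier_vec e"
    have gv: "\<eta> g * A *\<^sub>v v = \<eta> g *\<^sub>v (A *\<^sub>v v)" by (rule assoc_mult_mat_vec[OF rc[OF g] A v])
    have "A *\<^sub>v v \<in> U" using ran v by blast
    then obtain w where w: "w \<in> carrier_vec e" "\<eta> g *\<^sub>v (A *\<^sub>v v) = A *\<^sub>v w" using inv[OF g] ran by blast
    have "A * (B * (\<eta> g * A)) *\<^sub>v v = A *\<^sub>v (B *\<^sub>v (\<eta> g * A *\<^sub>v v))"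
      using assoc_mult_mat_vec[OF A mult_carrier_mat[OF B gA] v] assoc_mult_mat_vec[OF B gA v] by simp
    also have "B *\<^sub>v (\<eta> g * A *\<^sub>v v) = w"
      unfolding gv w(2) using assoc_mult_mat_vec[OF B A w(1)] BA w(1) by simp
    finally show "A * (B * (\<eta> g * A)) *\<^sub>v v = \<eta> g * A *\<^sub>v v" unfolding gv w(2) .
  qed (use A B rc[OF g] in auto)
  \<comment> \<open>\<open>intertwiner_avg\<close> is a plain sum over the group, so the factor 1 /
    |G| of the average is put into the projection beforehand.\<close>
  define C where "C = (1 / ?N) \<cdot>\<^sub>m B"
  have C: "C \<in> carrier_mat e d" using B by (simp add: C_def)
  note M = mult_carrier_mat[OF A C]
  define P where "P = intertwiner_avg d d \<eta> \<eta> (A * C)"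
  have P: "P \<in> carrier_mat d d" by (simp add: P_def)
  have tm: "\<eta> g * (A * C) * \<eta> (inv g) = (\<eta> g * A) * (C * \<eta> (inv g))" if g: "g \<in> carrier G" for g
  proof -
    note gc = rc[OF g] rc[OF inv_closed[OF g]]
    show ?thesis
      by (simp only: assoc_mult_mat[OF gc(1) M gc(2)] assoc_mult_mat[OF A C gc(2)]
          assoc_mult_mat[OF gc(1) A mult_carrier_mat[OF C gc(2)]])
  qed
  have pc: "\<eta> g * (A * C) * \<eta> (inv g) \<in> carrier_mat d d" if g: "g \<in> carrier G" for g
    by (rule mult_carrier_mat[OF mult_carrier_mat[OF rc[OF g] M] rc[OF inv_closed[OF g]]])
  have "P * A = mat_sum d e (\<lambda>g. \<eta> g * (A * C) * \<eta> (inv g) * A) (carrier G)"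
    unfolding P_def intertwiner_avg_def
    by (rule mat_sum_mult[OF A pc])
  also have "\<dots> = mat_sum d e (\<lambda>g. (1 / ?N) \<cdot>\<^sub>m A) (carrier G)"
  proof (rule mat_sum_cong)
    fix g assume g: "g \<in> carrier G"
    note gc = rc[OF g] rc[OF inv_closed[OF g]]
    note iA = mult_carrier_mat[OF gc(2) A]
    have "A * (C * (\<eta> (inv g) * A)) = (1 / ?N) \<cdot>\<^sub>m (A * (B * (\<eta> (inv g) * A)))"
      unfolding C_def mult_smult_assoc_mat[OF B iA] by (rule mult_smult_distrib[OF A mult_carrier_mat[OF B iA]])
    also have "\<dots> = (1 / ?N) \<cdot>\<^sub>m (\<eta> (inv g) * A)" by (simp only: int[OF inv_closed[OF g]])
    finally have "\<eta> g * (A * (C * (\<eta> (inv g) * A))) = (1 / ?N) \<cdot>\<^sub>m (\<eta> g * (\<eta> (inv g) * A))"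
      using mult_smult_distrib[OF gc(1) iA] by simp
    also have "\<eta> g * (\<eta> (inv g) * A) = A"
      using assoc_mult_mat[OF gc A] mat_rep_inv(1)[OF r g] A by simp
    finally show "\<eta> g * (A * C) * \<eta> (inv g) * A = (1 / ?N) \<cdot>\<^sub>m A"
      by (simp only: tm[OF g] assoc_mult_mat[OF mult_carrier_mat[OF gc(1) A] mult_carrier_mat[OF C gc(2)] A]
          assoc_mult_mat[OF C gc(2) A] assoc_mult_mat[OF gc(1) A mult_carrier_mat[OF C iA]])
  qed
  also have "\<dots> = A" using A N by (intro eq_matI) auto
  finally have PA: "P * A = A" .
  \<comment> \<open>Every summand of \<open>P\<close> has its range in \<open>U\<close>, where
    \<open>A * B\<close> is the identity; together with \<open>P * A = A\<close> this gives
    idempotence.\<close>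
  have "A * (B * P) = A * mat_sum e d (\<lambda>g. B * (\<eta> g * (A * C) * \<eta> (inv g))) (carrier G)"
    unfolding P_def intertwiner_avg_def by (rule arg_cong[OF mult_mat_sum[OF B pc]])
  also have "\<dots> = mat_sum d d (\<lambda>g. A * (B * (\<eta> g * (A * C) * \<eta> (inv g)))) (carrier G)"
    by (rule mult_mat_sum[OF A mult_carrier_mat[OF B pc]])
  also have "\<dots> = P"
    unfolding P_def intertwiner_avg_def
  proof (rule mat_sum_cong)
    fix g assume g: "g \<in> carrier G"
    note gA = mult_carrier_mat[OF rc[OF g] A] and Y = mult_carrier_mat[OF C rc[OF inv_closed[OF g]]]
    have "A * (B * ((\<eta> g * A) * (C * \<eta> (inv g)))) = A * (B * (\<eta> g * A)) * (C * \<eta> (inv g))"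
      using assoc_mult_mat[OF B gA Y] assoc_mult_mat[OF A mult_carrier_mat[OF B gA] Y] by simp
    then show "A * (B * (\<eta> g * (A * C) * \<eta> (inv g))) = \<eta> g * (A * C) * \<eta> (inv g)"
      unfolding tm[OF g] int[OF g] .
  qed
  finally have ABP: "A * (B * P) = P" .
  have "P * P = P" using assoc_mult_mat[OF P A mult_carrier_mat[OF B P]] PA ABP by simp
  moreover have "\<eta> g * P = P * \<eta> g" if "g \<in> carrier G" for g
    unfolding P_def by (rule intertwiner_avg_commute[OF r r M that])
  moreover have "U = carrier_vec d" if "P = 1\<^sub>m d"
  proof -
    have "A * B = 1\<^sub>m d" using ABP B unfolding that by simp
    then have "v \<in> U" if "v \<in> carrier_vec d" for v
      using assoc_mult_mat_vec[OF A B that] that mult_mat_vec_carrier[OF B that] ran by (metis imageI one_mult_mat_vec)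
    then show ?thesis using U by (auto simp: vec_subspace_def)
  qed
  moreover have "U = {0\<^sub>v d}" if "P = 0\<^sub>m d d"
  proof -
    have "A = 0\<^sub>m d e" using PA A unfolding that by simp
    then have "A *\<^sub>v v = 0\<^sub>v d" if "v \<in> carrier_vec e" for v using that by (intro eq_vecI) auto
    then have "U \<subseteq> {0\<^sub>v d}" using ran by auto
    then show ?thesis using U by (auto simp: vec_subspace_def)
  qed
  ultimately show ?thesis using that[OF P] by blast
qed

text \<open>The range of \<open>P\<close> carries a subrepresentation, written in the basis
  \<open>A\<close> as \<open>B * (\<eta> g * A)\<close>. Since \<open>P\<close> is not the identity
  its degree is below \<open>d\<close>, so the induction hypothesis of \<open>rep_sum_eq_0\<close>
  applies to it.\<close>

lemma rep_sum_idempotent: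
  assumes r: "mat_rep G d \<eta>" and P: "P \<in> carrier_mat d d" "P * P = P" "P \<noteq> 1\<^sub>m d"
    and comm: "\<And>g. g \<in> carrier G \<Longrightarrow> \<eta> g * P = P * \<eta> g"
    and IH: "\<And>e \<rho>. e < d \<Longrightarrow> mat_rep G e \<rho> \<Longrightarrow> rep_sum e \<rho> f = 0\<^sub>m e e"
  shows "rep_sum d \<eta> f * P = 0\<^sub>m d d"
proof -
  obtain e A B where AB: "A \<in> carrier_mat d e" "B \<in> carrier_mat e d" "B * A = 1\<^sub>m e" "A * B = P"
    using idempotent_factor[OF P(1,2)] by metis
  note rc = mat_rep_carrier[OF r]
  have "e \<le> d" using left_inverse_dim_le[OF AB(1-3)] .
  moreover have "e \<noteq> d"
  proof
    assume "e = d"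
    then have "A * B = 1\<^sub>m d" using mat_mult_left_right_inverse[of B d A] AB by simp
    then show False using P AB by simp
  qed
  ultimately have ed: "e < d" by simp
  define \<rho> where "\<rho> g = B * (\<eta> g * A)" for g
  have rhoc: "\<rho> g \<in> carrier_mat e e" if "g \<in> carrier G" for g
    unfolding \<rho>_def by (rule mult_carrier_mat[OF AB(2) mult_carrier_mat[OF rc[OF that] AB(1)]])
  have PA: "P * A = A"
    using assoc_mult_mat[OF AB(1,2,1)] AB by simp
  have int: "\<eta> g * A = A * \<rho> g" if g: "g \<in> carrier G" for g
  proof -
    have "A * \<rho> g = P * (\<eta> g * A)"
      unfolding \<rho>_def AB(4)[symmetric]
      by (rule assoc_mult_mat[symmetric, OF AB(1,2) mult_carrier_mat[OF rc[OF g] AB(1)]])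
    also have "\<dots> = (P * \<eta> g) * A" by (rule assoc_mult_mat[symmetric, OF P(1) rc[OF g] AB(1)])
    also have "\<dots> = (\<eta> g * P) * A" using comm[OF g] by simp
    also have "\<dots> = \<eta> g * (P * A)" by (rule assoc_mult_mat[OF rc[OF g] P(1) AB(1)])
    finally show ?thesis using PA by simp
  qed
  have BAx: "B * (A * x) = x" if "x \<in> carrier_mat e e" for x
    using assoc_mult_mat[OF AB(2,1) that] that AB(3) by simp
  have "mat_rep G e \<rho>"
    unfolding mat_rep_def
  proof (intro conjI ballI)
    show "\<rho> \<one> = 1\<^sub>m e" using AB mat_rep_one[OF r] by (simp add: \<rho>_def)
    fix g h assume g: "g \<in> carrier G" and h: "h \<in> carrier G"
    have "\<eta> (g \<otimes> h) * A = \<eta> g * (\<eta> h * A)"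
      unfolding mat_rep_mult[OF r g h] by (rule assoc_mult_mat[OF rc[OF g] rc[OF h] AB(1)])
    also have "\<dots> = (\<eta> g * A) * \<rho> h"
      unfolding int[OF h] by (rule assoc_mult_mat[symmetric, OF rc[OF g] AB(1) rhoc[OF h]])
    also have "\<dots> = A * (\<rho> g * \<rho> h)"
      unfolding int[OF g] by (rule assoc_mult_mat[OF AB(1) rhoc[OF g] rhoc[OF h]])
    finally show "\<rho> (g \<otimes> h) = \<rho> g * \<rho> h"
      using BAx[OF mult_carrier_mat[OF rhoc[OF g] rhoc[OF h]]] by (simp add: \<rho>_def[of "g \<otimes> h"])
  qed (use rhoc in auto)
  then have "rep_sum d \<eta> f * A = A * 0\<^sub>m e e"
    using rep_sum_intertwine[OF r _ AB(1) int] IH[OF ed] by metis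
  then have "rep_sum d \<eta> f * A = 0\<^sub>m d e" using AB by simp
  moreover have "rep_sum d \<eta> f * P = (rep_sum d \<eta> f * A) * B"
    unfolding AB(4)[symmetric] by (rule assoc_mult_mat[symmetric, OF rep_sum_carrier AB(1,2)])
  ultimately show ?thesis using AB by simp
qed

text \<open>Complete reducibility as an induction on the degree: a reducible representation has a
  commuting idempotent \<open>P\<close> other than 0 and 1, and \<open>f\<close> acts as zero on the
  ranges of both \<open>P\<close> and \<open>1 - P\<close>. No decomposition into irreducibles is
  ever written down.\<close>

lemma rep_sum_eq_0:
  assumes fin: "finite (carrier G)" and irr: "\<And>d \<rho>. irrep d \<rho> \<Longrightarrow> rep_sum d \<rho> f = 0\<^sub>m d d"
  shows "mat_rep G d \<eta> \<Longrightarrow> rep_sum d \<eta> f = 0\<^sub>m d d"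
proof (induction d arbitrary: \<eta> rule: less_induct)
  case (less d)
  note r = less.prems and IH = less.IH
  note rc = mat_rep_carrier[OF r]
  show ?case
  proof (cases "d = 0 \<or> irrep d \<eta>")
    case True
    then show ?thesis
    proof
      assume "d = 0"
      then show ?thesis using rep_sum_carrier[of 0 \<eta> f] by (intro eq_matI) (auto simp del: rep_sum_carrier)
    qed (use irr in auto)
  next
    case False
    then have "d > 0" "\<not> irrep d \<eta>" by auto
    then obtain U where U: "vec_subspace d U" "\<forall>g\<in>carrier G. \<forall>u\<in>U. \<eta> g *\<^sub>v u \<in> U"
      "U \<noteq> {0\<^sub>v d}" "U \<noteq> carrier_vec d"
      using r unfolding irrep_def by blast
    obtain P where P: "P \<in> carrier_mat d d" "P * P = P" "\<And>g. g \<in> carrier G \<Longrightarrow> \<eta> g * P = P * \<eta> g"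
      and P1: "P \<noteq> 1\<^sub>m d" and P0: "P \<noteq> 0\<^sub>m d d"
      using maschke[OF r U(1) fin] U(2-4) by metis
    define Q where "Q = 1\<^sub>m d - P"
    have Q: "Q \<in> carrier_mat d d" using P(1) by (simp add: Q_def minus_carrier_mat)
    have PQ: "P * Q = 0\<^sub>m d d"
      unfolding Q_def using mult_minus_distrib_mat[OF P(1) one_carrier_mat P(1)] P by simp
    have QQ: "Q * Q = Q"
    proof -
      have "Q * Q = 1\<^sub>m d * Q - P * Q"
        by (subst (1) Q_def) (rule minus_mult_distrib_mat[OF one_carrier_mat P(1) Q])
      also have "\<dots> = Q" using Q PQ by (intro eq_matI) auto
      finally show ?thesis .
    qed
    have Q1: "Q \<noteq> 1\<^sub>m d"
    proof
      assume q: "Q = 1\<^sub>m d"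
      have "P = 0\<^sub>m d d"
      proof (rule eq_matI)
        fix i j assume "i < dim_row (0\<^sub>m d d :: complex mat)" "j < dim_col (0\<^sub>m d d :: complex mat)"
        then show "P $$ (i,j) = 0\<^sub>m d d $$ (i,j)"
          using arg_cong[OF q, of "\<lambda>M. M $$ (i,j)"] P(1) by (simp add: Q_def)
      qed (use P in auto)
      then show False using P0 by simp
    qed
    have Qc: "\<eta> g * Q = Q * \<eta> g" if g: "g \<in> carrier G" for g
      unfolding Q_def using mult_minus_distrib_mat[OF rc[OF g] one_carrier_mat P(1)]
        minus_mult_distrib_mat[OF one_carrier_mat P(1) rc[OF g]] P(3)[OF g] rc[OF g] by simp
    let ?F = "rep_sum d \<eta> f"
    have FP: "?F * P = 0\<^sub>m d d" by (rule rep_sum_idempotent[OF r P(1,2) P1 P(3) IH])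
    have FQ: "?F * Q = 0\<^sub>m d d" by (rule rep_sum_idempotent[OF r Q QQ Q1 Qc IH])
    have "?F * Q = ?F * 1\<^sub>m d - ?F * P"
      unfolding Q_def by (rule mult_minus_distrib_mat[OF rep_sum_carrier one_carrier_mat P(1)])
    then have "0\<^sub>m d d = ?F - 0\<^sub>m d d" using FP FQ right_mult_one_mat[OF rep_sum_carrier] by simp
    also have "\<dots> = ?F"
    proof -
      have "x - 0\<^sub>m d d = x" if "x \<in> carrier_mat d d" for x :: "complex mat"
        using that by (intro eq_matI) auto
      then show ?thesis by simp
    qed
    finally show ?thesis by simp
  qed
qed

end

section \<open>Induced representations\<close>

lemma div_mod_bounds: "x < m * d \<Longrightarrow> x div d < m \<and> x mod d < (d::nat)"
  by (cases "d = 0") (auto simp: less_mult_imp_div_less)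

lemma mult_add_less: "k < m \<Longrightarrow> r < d \<Longrightarrow> k * d + r < m * (d::nat)"
  using mult_le_mono1[of "Suc k" m d] by simp

lemma sum_div_mod:
  fixes F :: "nat \<Rightarrow> nat \<Rightarrow> 'a :: comm_monoid_add"
  shows "(\<Sum>x<m * d. F (x div d) (x mod d)) = (\<Sum>k<m. \<Sum>r<d. F k r)"
proof (cases "d = 0")
  case False
  have "(\<Sum>k<m. \<Sum>r<d. F k r) = (\<Sum>(k,r)\<in>{..<m}\<times>{..<d}. F k r)" by (rule sum.cartesian_product)
  also have "\<dots> = (\<Sum>x<m * d. F (x div d) (x mod d))"
  proof (rule sum.reindex_bij_witness[where i = "\<lambda>x. (x div d, x mod d)" and j = "\<lambda>(k,r). k * d + r"])
    fix a assume "a \<in> {..<m} \<times> {..<d}"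
    then show "(case a of (k, r) \<Rightarrow> k * d + r) \<in> {..<m * d}" by (auto intro: mult_add_less)
  qed (use False in \<open>auto simp: less_mult_imp_div_less\<close>)
  finally show ?thesis by simp
qed simp

section \<open>Coset representatives and induced matrices\<close>

context group
begin

lemma mat_rep_subgroup_iff:
  "mat_rep (G\<lparr>carrier := S\<rparr>) d V \<longleftrightarrow> (\<forall>x\<in>S. V x \<in> carrier_mat d d) \<and> V \<one> = 1\<^sub>m d \<and>
     (\<forall>x\<in>S. \<forall>y\<in>S. V (x \<otimes> y) = V x * V y)"
  by (simp add: mat_rep_def)

text \<open>Uniqueness is required of the index, since the blocks of an induced matrix are numbered
  by positions in the list.\<close>

definition left_transversal :: "'a set \<Rightarrow> 'a list \<Rightarrow> bool" where
  "left_transversal S ts \<longleftrightarrow> set ts \<subseteq> carrier G \<and>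
     (\<forall>g\<in>carrier G. \<exists>!i. i < length ts \<and> inv (ts ! i) \<otimes> g \<in> S)"

lemma mem_lcoset_iff:
  assumes "S \<subseteq> carrier G" "t \<in> carrier G" "g \<in> carrier G"
  shows "g \<in> t <# S \<longleftrightarrow> inv t \<otimes> g \<in> S"
proof
  assume "g \<in> t <# S"
  then obtain s where "s \<in> S" "g = t \<otimes> s" by (auto simp: l_coset_def)
  then show "inv t \<otimes> g \<in> S" using assms by (auto simp: m_assoc[symmetric] subset_iff)
next
  assume "inv t \<otimes> g \<in> S"
  moreover have "g = t \<otimes> (inv t \<otimes> g)" using assms by (simp add: m_assoc[symmetric])
  ultimately show "g \<in> t <# S" unfolding l_coset_def by blast
qed

lemma left_coset_reps_transversal:
  assumes ts: "left_coset_reps G H ts" and S: "carrier H = S" "S \<subseteq> carrier G"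
  shows "left_transversal S ts"
  unfolding left_transversal_def
proof (intro conjI ballI)
  show sub: "set ts \<subseteq> carrier G" using ts by (simp add: left_coset_reps_def)
  fix g assume g: "g \<in> carrier G"
  have d: "distinct ts" using ts by (simp add: left_coset_reps_def)
  have m: "g \<in> t <# S \<longleftrightarrow> inv t \<otimes> g \<in> S" if "t \<in> set ts" for t
    using mem_lcoset_iff[OF S(2) _ g, of t] that sub by blast
  have "\<exists>!t. t \<in> set ts \<and> g \<in> t <# S" using ts g S by (simp add: left_coset_reps_def)
  then obtain t where t: "t \<in> set ts" "g \<in> t <# S" and u: "\<And>t'. t' \<in> set ts \<Longrightarrow> g \<in> t' <# S \<Longrightarrow> t' = t"
    by blast
  obtain i where i: "i < length ts" "ts ! i = t" using t by (auto simp: in_set_conv_nth)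
  show "\<exists>!i. i < length ts \<and> inv (ts ! i) \<otimes> g \<in> S"
  proof (rule ex1I[of _ i])
    show "i < length ts \<and> inv (ts ! i) \<otimes> g \<in> S" using i t m by simp
    fix j assume j: "j < length ts \<and> inv (ts ! j) \<otimes> g \<in> S"
    then have "ts ! j = t" using u[of "ts ! j"] m[of "ts ! j"] by simp
    then show "j = i" using nth_eq_iff_index_eq[OF d, of j i] i j by simp
  qed
qed

text \<open>The predicate that defines the chosen representative \<open>r g\<close> is the same for
  all elements of a coset (\<open>req\<close>), so \<open>r\<close> is constant on cosets and its
  image meets each of them once.\<close>

lemma ex_left_coset_reps:
  assumes S: "subgroup S G" and fin: "finite (carrier G)" and H: "carrier H = S"
  shows "\<exists>ts. left_coset_reps G H ts"
proof -
  interpret S: subgroup S G by fact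
  define r where "r g = (SOME y. y \<in> carrier G \<and> inv y \<otimes> g \<in> S)" for g
  have r: "r g \<in> carrier G" "inv (r g) \<otimes> g \<in> S" if "g \<in> carrier G" for g
    using someI[of "\<lambda>y. y \<in> carrier G \<and> inv y \<otimes> g \<in> S" g] that by (auto simp: r_def)
  have step: "inv y \<otimes> h \<in> S" if "inv y \<otimes> g \<in> S" "inv g \<otimes> h \<in> S" "y \<in> carrier G" "g \<in> carrier G" "h \<in> carrier G" for y g h
  proof -
    have "inv y \<otimes> h = (inv y \<otimes> g) \<otimes> (inv g \<otimes> h)" using that
      by (metis inv_closed inv_solve_left m_assoc m_closed)
    then show ?thesis using that by simp
  qed
  have symm: "inv g \<otimes> y \<in> S" if "inv y \<otimes> g \<in> S" "y \<in> carrier G" "g \<in> carrier G" for y g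
    using S.m_inv_closed[OF that(1)] that by (simp add: inv_mult_group)
  have req: "r g = r h" if "inv g \<otimes> h \<in> S" "g \<in> carrier G" "h \<in> carrier G" for g h
  proof -
    have "(y \<in> carrier G \<and> inv y \<otimes> g \<in> S) \<longleftrightarrow> (y \<in> carrier G \<and> inv y \<otimes> h \<in> S)" for y
      using step[of y g h] step[of y h g] symm[of g h] that by blast
    then show ?thesis by (simp add: r_def)
  qed
  obtain ts where ts: "set ts = r ` carrier G" "distinct ts"
    using finite_distinct_list[of "r ` carrier G"] fin by auto
  have sub: "set ts \<subseteq> carrier G" using ts r by auto
  have "left_coset_reps G H ts"
    unfolding left_coset_reps_def H
  proof (intro conjI ballI)
    fix g assume g: "g \<in> carrier G"
    show "\<exists>!t. t \<in> set ts \<and> g \<in> t <# S"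
    proof (rule ex1I[of _ "r g"])
      show "r g \<in> set ts \<and> g \<in> r g <# S"
        using mem_lcoset_iff[OF S.subset r(1)[OF g] g] r[OF g] ts g by blast
      fix t assume t: "t \<in> set ts \<and> g \<in> t <# S"
      then obtain h where h: "h \<in> carrier G" "t = r h" using ts by auto
      have tc: "t \<in> carrier G" using t sub by blast
      have tg: "inv t \<otimes> g \<in> S" using mem_lcoset_iff[OF S.subset tc g] t by blast
      have "inv t \<otimes> h \<in> S" using r(2)[OF h(1)] h by simp
      then have "inv g \<otimes> h \<in> S" using step[of g t h] symm[OF tg tc g] tc g h by blast
      then show "t = r g" using req[of g h] g h by simp
    qed
  qed (use ts sub in auto)
  then show ?thesis by blast
qed

text \<open>Extending entries by zero makes each entry of an induced matrix a function on the whole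
  group, so that sums over the group can be reindexed freely.\<close>

definition zero_ext :: "'a set \<Rightarrow> ('a \<Rightarrow> complex mat) \<Rightarrow> 'a \<Rightarrow> nat \<times> nat \<Rightarrow> complex" where
  "zero_ext S V x p = (if x \<in> S then V x $$ p else 0)"

text \<open>The formula of \<open>induced_rep\<close> with the coset representatives and the degree
  turned into arguments.\<close>

definition induced_mat :: "'a list \<Rightarrow> 'a set \<Rightarrow> nat \<Rightarrow> ('a \<Rightarrow> complex mat) \<Rightarrow> 'a \<Rightarrow> complex mat" where
  "induced_mat ts S d V g = mat (length ts * d) (length ts * d)
     (\<lambda>(i, j). zero_ext S V (inv (ts ! (i div d)) \<otimes> g \<otimes> (ts ! (j div d))) (i mod d, j mod d))"

lemma induced_rep_eq_induced_mat:
  assumes S: "subgroup S G" "carrier H = S" and fin: "finite (carrier G)"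
  obtains ts where "left_transversal S ts"
    "\<And>V d. dim_row (V \<one>) = d \<Longrightarrow> induced_rep G H V = induced_mat ts S d V"
proof -
  let ?ts = "SOME ts. left_coset_reps G H ts"
  have "left_coset_reps G H ?ts"
    using someI_ex[OF ex_left_coset_reps[OF S(1) fin S(2)]] .
  from left_coset_reps_transversal[OF this S(2) subgroup.subset[OF S(1)]]
  have "left_transversal S ?ts" .
  moreover have "induced_rep G H V = induced_mat ?ts S d V" if d: "dim_row (V \<one>) = d" for V d
    by (rule ext, unfold induced_rep_def induced_mat_def Let_def zero_ext_def d S(2)) (rule refl)
  ultimately show ?thesis by (rule that)
qed

text \<open>A factor from \<open>S\<close> does not affect membership in \<open>S\<close>, so the
  extension by zero remains multiplicative as long as one of the two arguments lies in
  \<open>S\<close>.\<close>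

lemma zero_ext_mult_right:
  assumes S: "subgroup S G" and V: "mat_rep (G\<lparr>carrier := S\<rparr>) d V"
    and x: "x \<in> carrier G" and y: "y \<in> S" and pq: "p < d" "q < d"
  shows "zero_ext S V (x \<otimes> y) (p,q) = (\<Sum>u<d. zero_ext S V x (p,u) * V y $$ (u,q))"
proof -
  interpret S: subgroup S G by fact
  have iff: "x \<otimes> y \<in> S \<longleftrightarrow> x \<in> S"
  proof
    assume "x \<otimes> y \<in> S"
    then have "(x \<otimes> y) \<otimes> inv y \<in> S" using y by simp
    then show "x \<in> S" using x y by (simp add: m_assoc)
  qed (use y in auto)
  show ?thesis
  proof (cases "x \<in> S")
    case True
    then have "V x \<in> carrier_mat d d" "V y \<in> carrier_mat d d" "V (x \<otimes> y) = V x * V y"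
      using V y by (auto simp: mat_rep_subgroup_iff)
    then show ?thesis using True y pq by (simp add: zero_ext_def scalar_prod_def atLeast0LessThan)
  qed (simp add: zero_ext_def iff)
qed

lemma zero_ext_mult_left:
  assumes S: "subgroup S G" and V: "mat_rep (G\<lparr>carrier := S\<rparr>) d V"
    and x: "x \<in> carrier G" and y: "y \<in> S" and pq: "p < d" "q < d"
  shows "zero_ext S V (y \<otimes> x) (p,q) = (\<Sum>u<d. V y $$ (p,u) * zero_ext S V x (u,q))"
proof -
  interpret S: subgroup S G by fact
  have iff: "y \<otimes> x \<in> S \<longleftrightarrow> x \<in> S"
  proof
    assume "y \<otimes> x \<in> S"
    then have "inv y \<otimes> (y \<otimes> x) \<in> S" using y by simp
    then show "x \<in> S" using x y by (simp add: m_assoc[symmetric])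
  qed (use y in auto)
  show ?thesis
  proof (cases "x \<in> S")
    case True
    then have "V x \<in> carrier_mat d d" "V y \<in> carrier_mat d d" "V (y \<otimes> x) = V y * V x"
      using V y by (auto simp: mat_rep_subgroup_iff)
    then show ?thesis using True y pq by (simp add: zero_ext_def scalar_prod_def atLeast0LessThan)
  qed (simp add: zero_ext_def iff)
qed

lemma mat_rep_induced_mat:
  assumes S: "subgroup S G" and ts: "left_transversal S ts" and V: "mat_rep (G\<lparr>carrier := S\<rparr>) d V"
  shows "mat_rep G (length ts * d) (induced_mat ts S d V)"
proof -
  interpret S: subgroup S G by fact
  let ?m = "length ts"
  have tc: "ts ! i \<in> carrier G" if "i < ?m" for i
    using ts that by (auto simp: left_transversal_def)
  have uniq: "i = j" if "i < ?m" "j < ?m" "g \<in> carrier G" "inv (ts!i) \<otimes> g \<in> S" "inv (ts!j) \<otimes> g \<in> S" for i j g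
    using ts that unfolding left_transversal_def by blast
  show ?thesis
    unfolding mat_rep_def
  proof (intro conjI ballI)
    show "induced_mat ts S d V \<one> = 1\<^sub>m (?m * d)"
    proof (rule eq_matI)
      fix i j assume "i < dim_row (1\<^sub>m (?m * d) :: complex mat)" "j < dim_col (1\<^sub>m (?m * d) :: complex mat)"
      then have ij: "i < ?m * d" "j < ?m * d" by auto
      note b = div_mod_bounds[OF ij(1)] div_mod_bounds[OF ij(2)]
      let ?x = "inv (ts ! (i div d)) \<otimes> \<one> \<otimes> ts ! (j div d)"
      have x: "?x = inv (ts ! (i div d)) \<otimes> ts ! (j div d)" using b tc by simp
      show "induced_mat ts S d V \<one> $$ (i,j) = 1\<^sub>m (?m * d) $$ (i,j)"
      proof (cases "i div d = j div d")
        case True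
        then have "?x = \<one>" using b tc x by simp
        then have "induced_mat ts S d V \<one> $$ (i,j) = (if i mod d = j mod d then 1 else 0)"
          using ij b V by (simp add: induced_mat_def zero_ext_def mat_rep_subgroup_iff)
        moreover have "i mod d = j mod d \<longleftrightarrow> i = j" using True by (metis div_mult_mod_eq)
        ultimately show ?thesis using ij by simp
      next
        case False
        have "?x \<notin> S"
        proof
          assume "?x \<in> S"
          then have "i div d = j div d"
            using uniq[of "i div d" "j div d" "ts ! (j div d)"] b tc x by simp
          then show False using False by simp
        qed
        then show ?thesis using ij False by (auto simp: induced_mat_def zero_ext_def)
      qed
    qed (auto simp: induced_mat_def)
  next
    fix g h assume g: "g \<in> carrier G" and h: "h \<in> carrier G"
    show "induced_mat ts S d V (g \<otimes> h) = induced_mat ts S d V g * induced_mat ts S d V h"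
    proof (rule eq_matI)
      fix i j assume "i < dim_row (induced_mat ts S d V g * induced_mat ts S d V h)"
        "j < dim_col (induced_mat ts S d V g * induced_mat ts S d V h)"
      then have ij: "i < ?m * d" "j < ?m * d" by (auto simp: induced_mat_def)
      define a b p q where "a = ts ! (i div d)" "b = ts ! (j div d)" "p = i mod d" "q = j mod d"
      have pq: "p < d" "q < d" and ab: "a \<in> carrier G" "b \<in> carrier G"
        using div_mod_bounds[OF ij(1)] div_mod_bounds[OF ij(2)] tc by (auto simp: a_b_p_q_def)
      \<comment> \<open>The coset of \<open>h \<otimes> b\<close> selects the only block that
        contributes to the sum over the inner block index.\<close>
      obtain k where k: "k < ?m" "inv (ts ! k) \<otimes> (h \<otimes> b) \<in> S"
        using ts m_closed[OF h ab(2)] unfolding left_transversal_def by blast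
      let ?F = "\<lambda>k. \<Sum>r<d. zero_ext S V (inv a \<otimes> g \<otimes> ts ! k) (p,r) * zero_ext S V (inv (ts ! k) \<otimes> h \<otimes> b) (r,q)"
      have "(induced_mat ts S d V g * induced_mat ts S d V h) $$ (i,j) =
        (\<Sum>x<?m * d. zero_ext S V (inv a \<otimes> g \<otimes> ts ! (x div d)) (p, x mod d) *
           zero_ext S V (inv (ts ! (x div d)) \<otimes> h \<otimes> b) (x mod d, q))"
        using ij by (simp add: induced_mat_def scalar_prod_def atLeast0LessThan a_b_p_q_def)
      also have "\<dots> = (\<Sum>k<?m. ?F k)" by (rule sum_div_mod)
      also have "\<dots> = (\<Sum>k'<?m. if k' = k then ?F k' else 0)"
      proof (rule sum.cong[OF refl])
        fix k' assume k': "k' \<in> {..<?m}"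
        show "?F k' = (if k' = k then ?F k' else 0)"
        proof (cases "k' = k")
          case False
          then have "inv (ts ! k') \<otimes> h \<otimes> b \<notin> S"
            using uniq[of k' k "h \<otimes> b"] k k' h ab tc by (auto simp: m_assoc)
          then show ?thesis using False by (simp add: zero_ext_def)
        qed simp
      qed
      also have "\<dots> = ?F k" using k by (simp add: sum.delta)
      also have "\<dots> = (\<Sum>r<d. zero_ext S V (inv a \<otimes> g \<otimes> ts ! k) (p,r) * V (inv (ts ! k) \<otimes> h \<otimes> b) $$ (r,q))"
        using k h ab tc by (simp add: zero_ext_def m_assoc)
      also have "\<dots> = zero_ext S V ((inv a \<otimes> g \<otimes> ts ! k) \<otimes> (inv (ts ! k) \<otimes> h \<otimes> b)) (p,q)"
        by (rule zero_ext_mult_right[OF S V _ _ pq, symmetric])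
          (use k h g ab tc in \<open>auto simp: m_assoc\<close>)
      also have "(inv a \<otimes> g \<otimes> ts ! k) \<otimes> (inv (ts ! k) \<otimes> h \<otimes> b) = inv a \<otimes> (g \<otimes> h) \<otimes> b"
      proof -
        have "ts ! k \<otimes> (inv (ts ! k) \<otimes> (h \<otimes> b)) = h \<otimes> b"
          using k tc[OF k(1)] h ab by (simp add: m_assoc[symmetric])
        then show ?thesis using tc[OF k(1)] h g ab by (simp add: m_assoc)
      qed
      finally show "induced_mat ts S d V (g \<otimes> h) $$ (i,j) = (induced_mat ts S d V g * induced_mat ts S d V h) $$ (i,j)"
        using ij by (simp add: induced_mat_def a_b_p_q_def)
    qed (auto simp: induced_mat_def)
  qed (simp add: induced_mat_def)
qed

text \<open>A finite normal subgroup of the whole group that lies in \<open>S\<close>; it will be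
  the base group G^n.\<close>

definition conj_stable :: "'a set \<Rightarrow> 'a set \<Rightarrow> bool" where
  "conj_stable B S \<longleftrightarrow> finite B \<and> subgroup B G \<and> B \<subseteq> S \<and> (\<forall>t\<in>carrier G. \<forall>z\<in>B. inv t \<otimes> z \<otimes> t \<in> B)"

text \<open>Orthogonality over \<open>B\<close> between the conjugate of \<open>V\<close> by
  \<open>b\<close> and the conjugate of \<open>W\<close> by \<open>x\<close>: the coefficient form
  of the disjointness condition in Mackey's criterion.\<close>

definition twisted_orth ::
  "'a set \<Rightarrow> nat \<Rightarrow> ('a \<Rightarrow> complex mat) \<Rightarrow> nat \<Rightarrow> ('a \<Rightarrow> complex mat) \<Rightarrow> 'a \<Rightarrow> 'a \<Rightarrow> bool" where
  "twisted_orth B d V e W b x \<longleftrightarrow> (\<forall>u<d. \<forall>q<d. \<forall>r<e. \<forall>v<e.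
     (\<Sum>z\<in>B. V (inv b \<otimes> z \<otimes> b) $$ (u,q) * W (inv x \<otimes> inv z \<otimes> x) $$ (r,v)) = 0)"

text \<open>Averaging the product of the two coefficients over right translation by the elements of \<open>B\<close>
  reduces its sum over the whole group to sums over \<open>B\<close>.\<close>

lemma zero_ext_orth:
  assumes S: "subgroup S G" "mat_rep (G\<lparr>carrier := S\<rparr>) d V" and T: "subgroup T G" "mat_rep (G\<lparr>carrier := T\<rparr>) e W"
    and B: "conj_stable B S" "conj_stable B T"
    and c: "a \<in> carrier G" "b \<in> carrier G" "x \<in> carrier G" "y \<in> carrier G"
    and pq: "p < d" "q < d" "r < e" "s < e"
    and orth: "twisted_orth B d V e W b x"
  shows "(\<Sum>g\<in>carrier G. zero_ext S V (inv a \<otimes> g \<otimes> b) (p,q) * zero_ext T W (inv x \<otimes> inv g \<otimes> y) (r,s)) = 0"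
    (is "sum ?F _ = 0")
proof -
  interpret B: subgroup B G using B by (simp add: conj_stable_def)
  let ?G = "\<lambda>g z u v. (zero_ext S V (inv a \<otimes> g \<otimes> b) (p,u) * zero_ext T W (inv x \<otimes> inv g \<otimes> y) (v,s)) *
    (V (inv b \<otimes> z \<otimes> b) $$ (u,q) * W (inv x \<otimes> inv z \<otimes> x) $$ (r,v))"
  have sh: "(\<Sum>g\<in>carrier G. ?F (g \<otimes> z)) = sum ?F (carrier G)" if z: "z \<in> B" for z
    by (rule sum.reindex_bij_betw, rule bij_betw_byWitness[where f' = "\<lambda>g. g \<otimes> inv z"])
      (use B.mem_carrier[OF z] in \<open>auto simp: m_assoc\<close>)
  have e: "?F (g \<otimes> z) = (\<Sum>u<d. \<Sum>v<e. ?G g z u v)" if g: "g \<in> carrier G" and z: "z \<in> B" for g z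
  proof -
    have zc: "z \<in> carrier G" by (rule B.mem_carrier[OF z])
    have bS: "inv b \<otimes> z \<otimes> b \<in> S" using B(1) c z by (auto simp: conj_stable_def)
    have bT: "inv x \<otimes> inv z \<otimes> x \<in> T" using B(2) c B.m_inv_closed[OF z] by (auto simp: conj_stable_def)
    have "b \<otimes> (inv b \<otimes> (z \<otimes> b)) = z \<otimes> b" using c zc by (simp add: m_assoc[symmetric])
    then have 1: "inv a \<otimes> (g \<otimes> z) \<otimes> b = (inv a \<otimes> g \<otimes> b) \<otimes> (inv b \<otimes> z \<otimes> b)" using c zc g by (simp add: m_assoc)
    have "x \<otimes> (inv x \<otimes> (inv g \<otimes> y)) = inv g \<otimes> y" using c g by (simp add: m_assoc[symmetric])
    then have 2: "inv x \<otimes> inv (g \<otimes> z) \<otimes> y = (inv x \<otimes> inv z \<otimes> x) \<otimes> (inv x \<otimes> inv g \<otimes> y)"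
      using c zc g by (simp add: m_assoc inv_mult_group)
    have ag: "inv a \<otimes> g \<otimes> b \<in> carrier G" "inv x \<otimes> inv g \<otimes> y \<in> carrier G" using c g by simp_all
    show ?thesis
      unfolding 1 2 zero_ext_mult_right[OF S ag(1) bS pq(1,2)] zero_ext_mult_left[OF T ag(2) bT pq(3,4)]
      by (simp only: sum_product mult_ac)
  qed
  have "of_nat (card B) * sum ?F (carrier G) = (\<Sum>z\<in>B. \<Sum>g\<in>carrier G. ?F (g \<otimes> z))" using sh by simp
  also have "\<dots> = (\<Sum>g\<in>carrier G. \<Sum>z\<in>B. ?F (g \<otimes> z))" by (rule sum.swap)
  also have "\<dots> = (\<Sum>g\<in>carrier G. 0)"
  proof (rule sum.cong[OF refl])
    fix g assume g: "g \<in> carrier G"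
    have "(\<Sum>z\<in>B. ?F (g \<otimes> z)) = (\<Sum>z\<in>B. \<Sum>u<d. \<Sum>v<e. ?G g z u v)" by (rule sum.cong[OF refl e[OF g]])
    also have "\<dots> = (\<Sum>u<d. \<Sum>v<e. \<Sum>z\<in>B. ?G g z u v)" by (rule sum_swap2)
    also have "\<dots> = 0" using orth pq by (simp add: sum_distrib_left[symmetric] twisted_orth_def)
    finally show "(\<Sum>z\<in>B. ?F (g \<otimes> z)) = 0" .
  qed
  finally have "of_nat (card B) * sum ?F (carrier G) = 0" by simp
  moreover have "finite B" using B(1) by (simp add: conj_stable_def)
  then have "card B \<noteq> 0" using B.one_closed card_gt_0_iff[of B] by fastforce
  ultimately show ?thesis by simp
qed

text \<open>If both arguments lie in \<open>S\<close>, so does their product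
  \<open>inv (ts!i) \<otimes> ts!l\<close>, which forces \<open>i = l\<close>. In that case the
  second argument is the inverse of the first, and a change of variable leaves a sum over
  \<open>S\<close>.\<close>

lemma zero_ext_same_coset:
  assumes S: "subgroup S G" and ts: "left_transversal S ts" and fin: "finite (carrier G)"
    and ijl: "i < length ts" "j < length ts" "l < length ts"
  shows "(\<Sum>g\<in>carrier G. zero_ext S V (inv (ts!i) \<otimes> g \<otimes> ts!j) (p,q) * zero_ext S W (inv (ts!j) \<otimes> inv g \<otimes> ts!l) (r,s)) =
    (if i = l then \<Sum>h\<in>S. V h $$ (p,q) * W (inv h) $$ (r,s) else 0)" (is "?L = _")
proof -
  interpret S: subgroup S G by fact
  have tc: "ts ! i \<in> carrier G" if "i < length ts" for i
    using ts that by (auto simp: left_transversal_def)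
  have uniq: "i = j" if "i < length ts" "j < length ts" "g \<in> carrier G" "inv (ts!i) \<otimes> g \<in> S" "inv (ts!j) \<otimes> g \<in> S" for i j g
    using ts that unfolding left_transversal_def by blast
  note c = tc[OF ijl(1)] tc[OF ijl(2)] tc[OF ijl(3)]
  show ?thesis
  proof (cases "i = l")
    case False
    have "zero_ext S V (inv (ts!i) \<otimes> g \<otimes> ts!j) (p,q) * zero_ext S W (inv (ts!j) \<otimes> inv g \<otimes> ts!l) (r,s) = 0"
      if g: "g \<in> carrier G" for g
    proof (rule ccontr)
      assume "\<not> ?thesis"
      then have xy: "inv (ts!i) \<otimes> g \<otimes> ts!j \<in> S" "inv (ts!j) \<otimes> inv g \<otimes> ts!l \<in> S"
        by (auto simp: zero_ext_def split: if_splits)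
      have "(inv (ts!i) \<otimes> g \<otimes> ts!j) \<otimes> (inv (ts!j) \<otimes> inv g \<otimes> ts!l) = inv (ts!i) \<otimes> ts!l"
      proof -
        have "ts!j \<otimes> (inv (ts!j) \<otimes> (inv g \<otimes> ts!l)) = inv g \<otimes> ts!l" using c g by (simp add: m_assoc[symmetric])
        moreover have "g \<otimes> (inv g \<otimes> ts!l) = ts!l" using c g by (simp add: m_assoc[symmetric])
        ultimately show ?thesis using c g by (simp add: m_assoc)
      qed
      then have "inv (ts!i) \<otimes> ts!l \<in> S" using S.m_closed[OF xy] by simp
      moreover have "inv (ts!l) \<otimes> ts!l \<in> S" using c by simp
      ultimately have "i = l" using uniq[OF ijl(1,3) c(3)] by blast
      then show False using False by simp
    qed
    then show ?thesis using False by simp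
  next
    case True
    let ?H = "\<lambda>x. if x \<in> S then V x $$ (p,q) * W (inv x) $$ (r,s) else 0"
    have "zero_ext S V (inv (ts!i) \<otimes> g \<otimes> ts!j) (p,q) * zero_ext S W (inv (ts!j) \<otimes> inv g \<otimes> ts!l) (r,s) =
      ?H (inv (ts!i) \<otimes> g \<otimes> ts!j)" if g: "g \<in> carrier G" for g
    proof -
      have "inv (ts!j) \<otimes> inv g \<otimes> ts!l = inv (inv (ts!i) \<otimes> g \<otimes> ts!j)"
        using c g True by (simp add: inv_mult_group m_assoc)
      then show ?thesis by (auto simp: zero_ext_def)
    qed
    then have "?L =
      (\<Sum>g\<in>carrier G. ?H (inv (ts!i) \<otimes> g \<otimes> ts!j))" by (rule sum.cong[OF refl])
    also have "\<dots> = (\<Sum>x\<in>carrier G. ?H x)"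
    proof (rule sum.reindex_bij_betw[of _ _ _ ?H])
      have 1: "ts ! i \<otimes> (inv (ts ! i) \<otimes> w) = w" "inv (ts ! i) \<otimes> (ts ! i \<otimes> w) = w" if "w \<in> carrier G" for w
        using c that by (auto simp: m_assoc[symmetric])
      show "bij_betw (\<lambda>g. inv (ts!i) \<otimes> g \<otimes> ts!j) (carrier G) (carrier G)"
        by (rule bij_betw_byWitness[where f' = "\<lambda>g. ts!i \<otimes> g \<otimes> inv (ts!j)"]) (use c 1 in \<open>auto simp: m_assoc\<close>)
    qed
    also have "\<dots> = (\<Sum>h\<in>S. V h $$ (p,q) * W (inv h) $$ (r,s))"
      using S.subset fin by (simp add: sum.If_cases Int_absorb1)
    finally show ?thesis using True by simp
  qed
qed


section \<open>A criterion for traversals\<close>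

lemma irrep_mat_rep: "irrep d \<rho> \<Longrightarrow> mat_rep G d \<rho>"
  and irrep_dim_pos: "irrep d \<rho> \<Longrightarrow> d > 0"
  by (simp_all add: irrep_def)

text \<open>The regular representation is obtained by inducing the trivial representation of the
  trivial subgroup. Its entry in the row of \<open>g\<close> and the column of the unit is the
  indicator function of \<open>g\<close>, and \<open>rep_sum_eq_0\<close> applies to it.\<close>

lemma irreps_separate:
  assumes fin: "finite (carrier G)" and irr: "\<And>d \<rho>. irrep d \<rho> \<Longrightarrow> rep_sum d \<rho> f = 0\<^sub>m d d"
    and g: "g \<in> carrier G"
  shows "f g = 0"
proof -
  let ?V = "\<lambda>x::'a. 1\<^sub>m 1 :: complex mat"
  have S: "subgroup {\<one>} G" by (rule triv_subgroup)
  have V: "mat_rep (G\<lparr>carrier := {\<one>}\<rparr>) 1 ?V" by (simp add: mat_rep_subgroup_iff)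
  obtain ts where ts: "left_transversal {\<one>} ts"
    using left_coset_reps_transversal[of "G\<lparr>carrier := {\<one>}\<rparr>" _ "{\<one>}"]
      ex_left_coset_reps[OF S fin, of "G\<lparr>carrier := {\<one>}\<rparr>"] by auto
  have tc: "ts ! i \<in> carrier G" if "i < length ts" for i
    using ts that by (auto simp: left_transversal_def)
  have ex: "\<exists>i<length ts. ts ! i = x" if x: "x \<in> carrier G" for x
  proof -
    obtain i where i: "i < length ts" "inv (ts ! i) \<otimes> x = \<one>"
      using ts x unfolding left_transversal_def by blast
    then have "x = ts ! i" using inv_solve_left'[of \<one> "ts ! i" x] tc[OF i(1)] x by simp
    then show ?thesis using i by blast
  qed
  obtain i j where ij: "i < length ts" "j < length ts" "ts ! i = g" "ts ! j = \<one>"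
    using ex[OF g] ex[OF one_closed] by blast
  let ?L = "induced_mat ts {\<one>} 1 ?V"
  have L: "mat_rep G (length ts) ?L" using mat_rep_induced_mat[OF S ts V] by simp
  have "rep_sum (length ts) ?L f = 0\<^sub>m (length ts) (length ts)" by (rule rep_sum_eq_0[OF fin irr L])
  then have "0 = (\<Sum>x\<in>carrier G. f x * ?L x $$ (i,j))" using rep_sum_eq_0_iff[OF L, of f] ij by simp
  also have "\<dots> = (\<Sum>x\<in>carrier G. if x = g then f x else 0)"
  proof (rule sum.cong[OF refl])
    fix x assume x: "x \<in> carrier G"
    have "inv g \<otimes> x \<otimes> \<one> = \<one> \<longleftrightarrow> x = g" using inv_solve_left'[of \<one> g x] x g by auto
    then show "f x * ?L x $$ (i,j) = (if x = g then f x else 0)"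
      using ij by (simp add: induced_mat_def zero_ext_def)
  qed
  also have "\<dots> = f g" using g fin by (simp add: sum.delta)
  finally show ?thesis by simp
qed

lemma equivalent_reps_refl:
  assumes r: "mat_rep G d \<rho>"
  shows "equivalent_reps G \<rho> \<rho>"
  unfolding equivalent_reps_def representation_iff
proof (intro exI[of _ d] conjI bexI[of _ "1\<^sub>m d"] ballI r)
  show "1\<^sub>m d * \<rho> g = \<rho> g * 1\<^sub>m d" if "g \<in> carrier G" for g
    using mat_rep_carrier[OF r that] by simp
  show "1\<^sub>m d \<in> carrier (GL d)" unfolding carrier_GL by (intro conjI bexI[of _ "1\<^sub>m d"]) auto
qed

lemma rep_sum_equivalent:
  assumes eq: "equivalent_reps G \<rho> \<eta>" and r: "mat_rep G d \<rho>" and z: "rep_sum d \<rho> f = 0\<^sub>m d d"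
  shows "rep_sum d \<eta> f = 0\<^sub>m d d"
proof -
  obtain P Q where P: "P \<in> carrier_mat d d" "Q \<in> carrier_mat d d" "P * Q = 1\<^sub>m d"
    and c: "\<And>g. g \<in> carrier G \<Longrightarrow> P * \<rho> g = \<eta> g * P" and e: "mat_rep G d \<eta>"
    using equivalent_repsE[OF eq r] by metis
  have "rep_sum d \<eta> f * P = P * rep_sum d \<rho> f"
    by (rule rep_sum_intertwine[OF e r P(1)]) (simp add: c)
  then have "rep_sum d \<eta> f * P = 0\<^sub>m d d" using z P by simp
  moreover have "rep_sum d \<eta> f * P * Q = rep_sum d \<eta> f"
    using assoc_mult_mat[OF rep_sum_carrier P(1,2)] right_mult_one_mat[OF rep_sum_carrier] by (simp add: P(3))
  ultimately show ?thesis using P by simp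
qed

lemma traversal_dim:
  assumes "traversal G R" "\<rho> \<in> R"
  obtains d where "irrep d \<rho>"
  using assms by (auto simp: traversal_def irreducible_rep_iff)

lemma traversal_coeff_orth:
  assumes R: "traversal G R" and m: "\<rho> \<in> R" "\<eta> \<in> R" "\<rho> \<noteq> \<eta>" and i: "irrep d \<rho>" "irrep e \<eta>"
  shows "coeff_orth d \<rho> e \<eta>"
proof (rule inequivalent_coeff_orth[OF i], rule notI)
  assume "equivalent_reps G \<rho> \<eta>"
  moreover have "equivalent_reps G \<eta> \<eta>" by (rule equivalent_reps_refl[OF irrep_mat_rep[OF i(2)]])
  moreover have "irreducible_rep G \<eta>" using i by (auto simp: irreducible_rep_iff)
  ultimately show False using R m unfolding traversal_def by blast
qed

lemma traversal_separates:
  assumes R: "traversal G R" and fin: "finite (carrier G)"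
    and z: "\<And>\<rho> d. \<rho> \<in> R \<Longrightarrow> irrep d \<rho> \<Longrightarrow> rep_sum d \<rho> f = 0\<^sub>m d d"
    and g: "g \<in> carrier G"
  shows "f g = 0"
proof (rule irreps_separate[OF fin _ g])
  fix d \<eta> assume e: "irrep d \<eta>"
  then have "irreducible_rep G \<eta>" by (auto simp: irreducible_rep_iff)
  then obtain \<rho> where r: "\<rho> \<in> R" "equivalent_reps G \<rho> \<eta>"
    using R unfolding traversal_def by blast
  obtain d' where d': "irrep d' \<rho>" using traversal_dim[OF R r(1)] .
  have "d' = d"
    using equivalent_repsE[OF r(2) irrep_mat_rep[OF d']] mat_rep_dim_unique[OF _ irrep_mat_rep[OF e]] by metis
  then show "rep_sum d \<eta> f = 0\<^sub>m d d"
    using rep_sum_equivalent[OF r(2) irrep_mat_rep[OF d']] z[OF r(1) d'] by simp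
qed

text \<open>If an irreducible \<eta> were equivalent to no member, the function sending
  \<open>g\<close> to \<open>\<eta> (inv g) $$ (0,0)\<close> would have zero pairing with all
  members. Separation would make it vanish, but its value at the unit is 1.\<close>

lemma traversal_familyI:
  assumes fin: "finite (carrier G)" and D: "\<And>i. i \<in> I \<Longrightarrow> D i > 0"
    and V: "\<And>i. i \<in> I \<Longrightarrow> mat_rep G (D i) (V i)"
    and self: "\<And>i. i \<in> I \<Longrightarrow> self_orth (D i) (V i)"
    and orth: "\<And>i j. i \<in> I \<Longrightarrow> j \<in> I \<Longrightarrow> i \<noteq> j \<Longrightarrow> coeff_orth (D i) (V i) (D j) (V j)"
    and sep: "\<And>f g. (\<And>i. i \<in> I \<Longrightarrow> rep_sum (D i) (V i) f = 0\<^sub>m (D i) (D i)) \<Longrightarrow> g \<in> carrier G \<Longrightarrow> f g = 0"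
  shows "traversal_family G I V"
proof -
  have irr: "irrep (D i) (V i)" if "i \<in> I" for i
    using self_orth_irrep[OF V D self fin] that by blast
  have neq: "i = j" if "i \<in> I" "j \<in> I" "equivalent_reps G (V i) \<eta>" "equivalent_reps G (V j) \<eta>" for i j \<eta>
    using coeff_orth_no_common_equivalent[OF orth V V D fin] that by blast
  have "inj_on V I"
  proof (rule inj_onI)
    fix i j assume "i \<in> I" "j \<in> I" "V i = V j"
    then show "i = j" using neq[of i j "V j"] equivalent_reps_refl[OF V, of j] by simp
  qed
  moreover have "traversal G (V ` I)"
    unfolding traversal_def
  proof (intro conjI ballI allI impI)
    fix \<rho> assume "\<rho> \<in> V ` I"
    then show "irreducible_rep G \<rho>" using irr by (auto simp: irreducible_rep_iff)
  next
    fix \<eta> assume "irreducible_rep G \<eta>"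
    then obtain e where e: "irrep e \<eta>" by (auto simp: irreducible_rep_iff)
    then have er: "mat_rep G e \<eta>" and e0: "e > 0" by (auto dest: irrep_mat_rep irrep_dim_pos)
    have "\<exists>i\<in>I. equivalent_reps G (V i) \<eta>"
    proof (rule ccontr)
      assume n: "\<not> ?thesis"
      have "\<eta> (inv \<one>) $$ (0,0) = 0"
      proof (rule sep[of "\<lambda>g. \<eta> (inv g) $$ (0,0)", OF _ one_closed])
        fix i assume i: "i \<in> I"
        have "\<not> equivalent_reps G (V i) \<eta>" using n i by blast
        then have "coeff_orth (D i) (V i) e \<eta>" by (rule inequivalent_coeff_orth[OF irr[OF i] e])
        then show "rep_sum (D i) (V i) (\<lambda>g. \<eta> (inv g) $$ (0, 0)) = 0\<^sub>m (D i) (D i)"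
          using e0 by (simp add: rep_sum_eq_0_iff[OF V[OF i]] coeff_orth_def mult.commute)
      qed
      then show False using mat_rep_one[OF er] e0 by simp
    qed
    then obtain i where i: "i \<in> I" "equivalent_reps G (V i) \<eta>" by blast
    show "\<exists>!\<rho>. \<rho> \<in> V ` I \<and> equivalent_reps G \<rho> \<eta>"
    proof (rule ex1I[of _ "V i"])
      fix \<rho> assume "\<rho> \<in> V ` I \<and> equivalent_reps G \<rho> \<eta>"
      then obtain j where j: "j \<in> I" "\<rho> = V j" "equivalent_reps G (V j) \<eta>" by blast
      have "i = j" by (rule neq[OF i(1) j(1) i(2) j(3)])
      then show "\<rho> = V i" using j by simp
    qed (use i in blast)
  qed
  ultimately show ?thesis by (simp add: traversal_family_def)
qed

text \<open>Fourier inversion at the unit: the regular character divided by |G|. By separation it is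
  enough that both sides pair equally with the coefficients of each member, which Schur
  orthogonality computes.\<close>

lemma traversal_delta:
  fixes \<rho>s :: "('a \<Rightarrow> complex mat) list"
  assumes fin: "finite (carrier G)" and R: "traversal_family G {..<length \<rho>s} (\<lambda>i. \<rho>s ! i)"
    and D: "\<And>k. k < length \<rho>s \<Longrightarrow> irrep (D k) (\<rho>s ! k)" and y: "y \<in> carrier G"
  shows "(\<Sum>k<length \<rho>s. of_nat (D k) / of_nat (card (carrier G)) * (\<Sum>p<D k. (\<rho>s ! k) y $$ (p,p))) =
    (if y = \<one> then 1 else 0)"
proof -
  let ?N = "of_nat (card (carrier G)) :: complex"
  have "carrier G \<noteq> {}" by auto
  then have N: "?N \<noteq> 0" using fin by simp
  define \<chi> where "\<chi> x = (\<Sum>k<length \<rho>s. of_nat (D k) / ?N * (\<Sum>p<D k. (\<rho>s ! k) x $$ (p,p)))" for x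
  have tr: "traversal G (set \<rho>s)" and inj: "inj_on (\<lambda>i. \<rho>s ! i) {..<length \<rho>s}"
    using R by (simp_all add: traversal_family_def lessThan_atLeast0 nth_image)
  \<comment> \<open>The difference of the two sides is read at inverses, so that its pairings with a
    member become sums of the form \<open>coeff_sum\<close>.\<close>
  define f where "f x = (if inv x = \<one> then 1 else 0) - \<chi> (inv x)" for x
  have "f (inv y) = 0"
  proof (rule traversal_separates[OF tr fin])
    fix \<rho> d assume r: "\<rho> \<in> set \<rho>s" and dr: "irrep d \<rho>"
    obtain l where l: "l < length \<rho>s" "\<rho> = \<rho>s ! l" using r by (auto simp: in_set_conv_nth)
    have rr: "mat_rep G d \<rho>" by (rule irrep_mat_rep[OF dr])
    have dl: "d = D l" using mat_rep_dim_unique[OF rr] irrep_mat_rep[OF D[OF l(1)]] l by simp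
    have "(\<Sum>x\<in>carrier G. f x * \<rho> x $$ (i,j)) = 0" if ij: "i < d" "j < d" for i j
    proof -
      have inner: "(\<Sum>x\<in>carrier G. (\<Sum>p<D k. (\<rho>s ! k) (inv x) $$ (p,p)) * \<rho> x $$ (i,j)) =
          (if k = l then ?N / of_nat d * (if i = j then 1 else 0) else 0)" if k: "k < length \<rho>s" for k
      proof -
        have "(\<Sum>x\<in>carrier G. (\<Sum>p<D k. (\<rho>s ! k) (inv x) $$ (p,p)) * \<rho> x $$ (i,j)) =
          (\<Sum>x\<in>carrier G. \<Sum>p<D k. \<rho> x $$ (i,j) * (\<rho>s ! k) (inv x) $$ (p,p))"
          by (simp add: sum_distrib_left mult.commute)
        also have "\<dots> = (\<Sum>p<D k. \<Sum>x\<in>carrier G. \<rho> x $$ (i,j) * (\<rho>s ! k) (inv x) $$ (p,p))"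
          by (rule sum.swap)
        also have "\<dots> = (if k = l then ?N / of_nat d * (if i = j then 1 else 0) else 0)"
        proof (cases "k = l")
          case True
          then have "(\<Sum>p<D k. \<Sum>x\<in>carrier G. \<rho> x $$ (i,j) * (\<rho>s ! k) (inv x) $$ (p,p)) =
            (\<Sum>p<d. if p = i then (if i = j then ?N / of_nat d else 0) else 0)"
            using schur_orthogonality[OF dr ij(1,2)] dl l by (intro sum.cong) auto
          then show ?thesis using True ij by (simp add: sum.delta)
        next
          case False
          then have "\<rho>s ! k \<noteq> \<rho>" using inj k l by (auto simp: inj_on_def)
          then have "coeff_orth d \<rho> (D k) (\<rho>s ! k)"
            using traversal_coeff_orth[OF tr r _ _ dr D[OF k]] k by auto
          then show ?thesis using False ij by (simp add: coeff_orth_def)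
        qed
        finally show ?thesis .
      qed
      have "(\<Sum>x\<in>carrier G. f x * \<rho> x $$ (i,j)) =
        (\<Sum>x\<in>carrier G. (if inv x = \<one> then 1 else 0) * \<rho> x $$ (i,j)) - (\<Sum>x\<in>carrier G. \<chi> (inv x) * \<rho> x $$ (i,j))"
        by (simp add: f_def left_diff_distrib sum_subtractf)
      also have "(\<Sum>x\<in>carrier G. (if inv x = \<one> then 1 else 0) * \<rho> x $$ (i,j)) =
        (\<Sum>x\<in>carrier G. if x = \<one> then \<rho> x $$ (i,j) else 0)"
        by (rule sum.cong) auto
      also have "\<dots> = (if i = j then 1 else 0)" using fin ij mat_rep_one[OF rr] by (simp add: sum.delta)
      also have "(\<Sum>x\<in>carrier G. \<chi> (inv x) * \<rho> x $$ (i,j)) =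
        (\<Sum>k<length \<rho>s. of_nat (D k) / ?N * (\<Sum>x\<in>carrier G. (\<Sum>p<D k. (\<rho>s ! k) (inv x) $$ (p,p)) * \<rho> x $$ (i,j)))"
        unfolding \<chi>_def sum_distrib_right sum_distrib_left
        by (subst sum.swap) (simp add: mult.assoc)
      also have "\<dots> = (\<Sum>k<length \<rho>s. if k = l then (if i = j then 1 else 0) else 0)"
        using inner N dl irrep_dim_pos[OF dr] by (intro sum.cong) auto
      also have "\<dots> = (if i = j then 1 else 0)" using l by (simp add: sum.delta)
      finally show ?thesis by simp
    qed
    then show "rep_sum d \<rho> f = 0\<^sub>m d d" by (simp add: rep_sum_eq_0_iff[OF rr])
  qed (use y in auto)
  then show ?thesis using y by (simp add: f_def \<chi>_def)
qed


section \<open>Orthogonality and completeness of induced coefficients\<close>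

lemma induced_coeff:
  assumes "i < length ts * d" "j < length ts * d" "k < length ss * e" "l < length ss * e"
  shows "coeff_sum (induced_mat ts S d V) (i,j) (induced_mat ss T e W) (k,l) =
    (\<Sum>g\<in>carrier G. zero_ext S V (inv (ts ! (i div d)) \<otimes> g \<otimes> ts ! (j div d)) (i mod d, j mod d) *
      zero_ext T W (inv (ss ! (k div e)) \<otimes> inv g \<otimes> ss ! (l div e)) (k mod e, l mod e))"
  using assms by (simp add: induced_mat_def)

lemma induced_coeff_orth:
  assumes S: "subgroup S G" "left_transversal S ts" "mat_rep (G\<lparr>carrier := S\<rparr>) d V"
    and T: "subgroup T G" "left_transversal T ss" "mat_rep (G\<lparr>carrier := T\<rparr>) e W"
    and B: "conj_stable B S" "conj_stable B T"
    and orth: "\<And>j k. j < length ts \<Longrightarrow> k < length ss \<Longrightarrow> twisted_orth B d V e W (ts ! j) (ss ! k)"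
  shows "coeff_orth (length ts * d) (induced_mat ts S d V) (length ss * e) (induced_mat ss T e W)"
  unfolding coeff_orth_def
proof (intro allI impI)
  fix i j k l assume i: "i < length ts * d" "j < length ts * d" "k < length ss * e" "l < length ss * e"
  note b = div_mod_bounds[OF i(1)] div_mod_bounds[OF i(2)] div_mod_bounds[OF i(3)] div_mod_bounds[OF i(4)]
  have "ts ! a \<in> carrier G" if "a < length ts" for a using S(2) that by (auto simp: left_transversal_def)
  moreover have "ss ! a \<in> carrier G" if "a < length ss" for a using T(2) that by (auto simp: left_transversal_def)
  ultimately show "coeff_sum (induced_mat ts S d V) (i,j) (induced_mat ss T e W) (k,l) = 0"
    unfolding induced_coeff[OF i] using b by (intro zero_ext_orth[OF S(1,3) T(1,3) B] orth) auto
qed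

text \<open>If the inner block indices differ, twisted orthogonality gives zero; if they agree, the
  sum descends to \<open>S\<close>. The alternative \<open>c = 0 \<or> d = e\<close> admits two
  members of different degree, while for non-zero \<open>c\<close> equal degrees let block and
  remainder determine the index.\<close>

lemma induced_same_orth:
  assumes S: "subgroup S G" "left_transversal S ts" "mat_rep (G\<lparr>carrier := S\<rparr>) d V" "mat_rep (G\<lparr>carrier := S\<rparr>) e W"
    and fin: "finite (carrier G)" and B: "conj_stable B S"
    and orth: "\<And>j k. j < length ts \<Longrightarrow> k < length ts \<Longrightarrow> j \<noteq> k \<Longrightarrow> twisted_orth B d V e W (ts ! j) (ts ! k)"
    and sum: "\<And>p q r s. p < d \<Longrightarrow> q < d \<Longrightarrow> r < e \<Longrightarrow> s < e \<Longrightarrow>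
      (\<Sum>h\<in>S. V h $$ (p,q) * W (inv h) $$ (r,s)) = (if p = s \<and> q = r then c else 0)"
    and c: "c = 0 \<or> d = e"
    and i: "i < length ts * d" "j < length ts * d" "k < length ts * e" "l < length ts * e"
  shows "coeff_sum (induced_mat ts S d V) (i,j) (induced_mat ts S e W) (k,l) = (if i = l \<and> j = k then c else 0)"
proof -
  note b = div_mod_bounds[OF i(1)] div_mod_bounds[OF i(2)] div_mod_bounds[OF i(3)] div_mod_bounds[OF i(4)]
  have tc: "ts ! a \<in> carrier G" if "a < length ts" for a using S(2) that by (auto simp: left_transversal_def)
  have eq: "x = y \<longleftrightarrow> x div d = y div d \<and> x mod d = y mod d" for x y :: nat
    by (metis div_mult_mod_eq)
  show ?thesis
  proof (cases "j div d = k div e")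
    case True
    have "coeff_sum (induced_mat ts S d V) (i,j) (induced_mat ts S e W) (k,l) =
      (if i div d = l div e then if i mod d = l mod e \<and> j mod d = k mod e then c else 0 else 0)"
      unfolding induced_coeff[OF i] True[symmetric]
        zero_ext_same_coset[OF S(1,2) fin conjunct1[OF b(1)] conjunct1[OF b(2)] conjunct1[OF b(4)]]
        sum[OF conjunct2[OF b(1)] conjunct2[OF b(2)] conjunct2[OF b(3)] conjunct2[OF b(4)]] by (rule refl)
    then show ?thesis using c True eq[of i l] eq[of j k] by auto
  next
    case False
    have "coeff_sum (induced_mat ts S d V) (i,j) (induced_mat ts S e W) (k,l) = 0"
      unfolding induced_coeff[OF i] using b False tc
      by (intro zero_ext_orth[OF S(1,3) S(1,4) B B] orth) auto
    then show ?thesis using c False by auto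
  qed
qed

text \<open>An entry of block (i,j) is a sum of \<open>f\<close> over the translate of
  \<open>S\<close> by the i-th representative on the left and the inverse of the j-th on the right.
  Any set \<open>x S y\<close> is such a translate, and passing to the chosen representatives only
  mixes the coefficients of \<open>V\<close>.\<close>

lemma rep_sum_induced_mat:
  assumes S: "subgroup S G" "left_transversal S ts" "mat_rep (G\<lparr>carrier := S\<rparr>) d V"
    and fin: "finite (carrier G)"
    and z: "rep_sum (length ts * d) (induced_mat ts S d V) f = 0\<^sub>m (length ts * d) (length ts * d)"
    and x: "x \<in> carrier G" and y: "y \<in> carrier G" and p: "p < d" "q < d"
  shows "(\<Sum>h\<in>S. f (x \<otimes> h \<otimes> y) * V h $$ (p,q)) = 0" (is "?L = _")
proof -
  interpret S: subgroup S G by (rule S(1))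
  obtain i j where i: "i < length ts" "j < length ts" "inv (ts ! i) \<otimes> x \<in> S" "inv (ts ! j) \<otimes> inv y \<in> S"
    using S(2) x inv_closed[OF y] unfolding left_transversal_def by metis
  define t u where "t = ts ! i" "u = ts ! j"
  have c: "t \<in> carrier G" "u \<in> carrier G"
    using S(2) i by (auto simp: left_transversal_def t_u_def)
  have cancel: "v \<otimes> (inv v \<otimes> w) = w" "inv v \<otimes> (v \<otimes> w) = w" if "v \<in> carrier G" "w \<in> carrier G" for v w
    using that by (auto simp: m_assoc[symmetric])
  have coset: "(\<Sum>h\<in>S. f (t \<otimes> h \<otimes> inv u) * V h $$ (a,b)) = 0" if ab: "a < d" "b < d" for a b
  proof -
    have "0 = (\<Sum>g\<in>carrier G. f g * induced_mat ts S d V g $$ (i * d + a, j * d + b))"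
      using z rep_sum_eq_0_iff[OF mat_rep_induced_mat[OF S], of f] mult_add_less[OF i(1) ab(1)] mult_add_less[OF i(2) ab(2)]
      by simp
    also have "\<dots> = (\<Sum>g\<in>carrier G. f g * zero_ext S V (inv t \<otimes> g \<otimes> u) (a,b))"
      using ab mult_add_less[OF i(1) ab(1)] mult_add_less[OF i(2) ab(2)] by (simp add: induced_mat_def t_u_def)
    also have "\<dots> = (\<Sum>h\<in>carrier G. f (t \<otimes> h \<otimes> inv u) * zero_ext S V (inv t \<otimes> (t \<otimes> h \<otimes> inv u) \<otimes> u) (a,b))"
      by (rule sum.reindex_bij_betw[symmetric], rule bij_betw_byWitness[where f' = "\<lambda>g. inv t \<otimes> g \<otimes> u"])
        (use c cancel in \<open>auto simp: m_assoc\<close>)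
    also have "\<dots> = (\<Sum>h\<in>carrier G. if h \<in> S then f (t \<otimes> h \<otimes> inv u) * V h $$ (a,b) else 0)"
    proof (rule sum.cong[OF refl])
      fix h assume h: "h \<in> carrier G"
      have "inv t \<otimes> (t \<otimes> h \<otimes> inv u) \<otimes> u = h" using c h cancel by (simp add: m_assoc)
      then show "f (t \<otimes> h \<otimes> inv u) * zero_ext S V (inv t \<otimes> (t \<otimes> h \<otimes> inv u) \<otimes> u) (a,b) =
        (if h \<in> S then f (t \<otimes> h \<otimes> inv u) * V h $$ (a,b) else 0)"
        by (simp add: zero_ext_def)
    qed
    also have "\<dots> = (\<Sum>h\<in>S. f (t \<otimes> h \<otimes> inv u) * V h $$ (a,b))"
      using S.subset fin by (simp add: sum.If_cases Int_absorb1)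
    finally show ?thesis by simp
  qed
  \<comment> \<open>The corrections in \<open>S\<close> with \<open>x \<otimes> s = t\<close> and
    \<open>s' \<otimes> y = inv u\<close>.\<close>
  define s s' where "s = inv x \<otimes> t" "s' = inv u \<otimes> inv y"
  have s: "s \<in> S" using S.m_inv_closed[OF i(3)] x c by (simp add: s_s'_def t_u_def inv_mult_group)
  have s': "s' \<in> S" using i(4) by (simp add: s_s'_def t_u_def)
  have Vc: "V h \<in> carrier_mat d d" if "h \<in> S" for h using S(3) that by (simp add: mat_rep_subgroup_iff)
  have "?L = (\<Sum>k\<in>S. f (x \<otimes> (s \<otimes> k \<otimes> s') \<otimes> y) * V (s \<otimes> k \<otimes> s') $$ (p,q))"
  proof (rule sum.reindex_bij_betw[symmetric])
    show "bij_betw (\<lambda>k. s \<otimes> k \<otimes> s') S S"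
      by (rule bij_betw_byWitness[where f' = "\<lambda>k. inv s \<otimes> k \<otimes> inv s'"])
        (use s s' cancel S.mem_carrier in \<open>auto simp: m_assoc\<close>)
  qed
  also have "\<dots> = (\<Sum>k\<in>S. \<Sum>a<d. \<Sum>b<d. (V s $$ (p,a) * V s' $$ (b,q)) * (f (t \<otimes> k \<otimes> inv u) * V k $$ (a,b)))"
  proof (rule sum.cong[OF refl])
    fix k assume k: "k \<in> S"
    have "x \<otimes> (s \<otimes> k \<otimes> s') \<otimes> y = t \<otimes> k \<otimes> inv u"
      using x y c S.mem_carrier[OF k] cancel by (simp add: s_s'_def m_assoc)
    moreover have "V (s \<otimes> k \<otimes> s') = V s * V k * V s'" using S(3) s s' k by (simp add: mat_rep_subgroup_iff)
    ultimately show "f (x \<otimes> (s \<otimes> k \<otimes> s') \<otimes> y) * V (s \<otimes> k \<otimes> s') $$ (p,q) =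
      (\<Sum>a<d. \<Sum>b<d. (V s $$ (p,a) * V s' $$ (b,q)) * (f (t \<otimes> k \<otimes> inv u) * V k $$ (a,b)))"
      using mult3_index[OF Vc[OF s] Vc[OF k] Vc[OF s'] p] by (simp add: sum_distrib_left mult_ac)
  qed
  also have "\<dots> = (\<Sum>a<d. \<Sum>b<d. \<Sum>k\<in>S. (V s $$ (p,a) * V s' $$ (b,q)) * (f (t \<otimes> k \<otimes> inv u) * V k $$ (a,b)))"
    by (rule sum_swap2)
  also have "\<dots> = 0" using coset by (simp add: sum_distrib_left[symmetric])
  finally show ?thesis .
qed

end

declare One_nat_def [simp del] \<comment> \<open>keeps \<open>{1..n}\<close> from being rewritten to \<open>{Suc 0..n}\<close>\<close>

section \<open>Tensor products\<close>

lemma kronecker_carrier: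
  "A \<in> carrier_mat a b \<Longrightarrow> B \<in> carrier_mat c d \<Longrightarrow> kronecker A B \<in> carrier_mat (a * c) (b * d)"
  by (auto simp: kronecker_def)

lemma kronecker_index:
  assumes "A \<in> carrier_mat a b" "B \<in> carrier_mat c d" "i < a * c" "j < b * d"
  shows "kronecker A B $$ (i,j) = A $$ (i div c, j div d) * B $$ (i mod c, j mod d)"
  using assms by (auto simp: kronecker_def)

lemma kronecker_mult:
  assumes A: "A \<in> carrier_mat d d" "A' \<in> carrier_mat d d" and B: "B \<in> carrier_mat e e" "B' \<in> carrier_mat e e"
  shows "kronecker A B * kronecker A' B' = kronecker (A * A') (B * B')"
proof (rule eq_matI)
  note K = kronecker_carrier[OF A(1) B(1)] kronecker_carrier[OF A(2) B(2)]
  have AA: "A * A' \<in> carrier_mat d d" and BB: "B * B' \<in> carrier_mat e e" using A B by auto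
  fix i j assume "i < dim_row (kronecker (A * A') (B * B'))" "j < dim_col (kronecker (A * A') (B * B'))"
  then have ij: "i < d * e" "j < d * e" using kronecker_carrier[OF AA BB] by auto
  note b = div_mod_bounds[OF ij(1)] div_mod_bounds[OF ij(2)]
  have "(kronecker A B * kronecker A' B') $$ (i,j) =
    (\<Sum>x<d * e. kronecker A B $$ (i,x) * kronecker A' B' $$ (x,j))"
    using K ij by (simp add: scalar_prod_def atLeast0LessThan)
  also have "\<dots> = (\<Sum>x<d * e. (A $$ (i div e, x div e) * B $$ (i mod e, x mod e)) *
      (A' $$ (x div e, j div e) * B' $$ (x mod e, j mod e)))"
    by (rule sum.cong[OF refl]) (use ij kronecker_index[OF A(1) B(1)] kronecker_index[OF A(2) B(2)] in auto)
  also have "\<dots> = (\<Sum>k<d. \<Sum>r<e. (A $$ (i div e, k) * B $$ (i mod e, r)) * (A' $$ (k, j div e) * B' $$ (r, j mod e)))"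
    by (rule sum_div_mod)
  also have "\<dots> = (\<Sum>k<d. A $$ (i div e, k) * A' $$ (k, j div e)) * (\<Sum>r<e. B $$ (i mod e, r) * B' $$ (r, j mod e))"
    by (simp add: sum_product mult_ac)
  also have "(\<Sum>k<d. A $$ (i div e, k) * A' $$ (k, j div e)) = (A * A') $$ (i div e, j div e)"
    using A b by (simp add: scalar_prod_def atLeast0LessThan)
  also have "(\<Sum>r<e. B $$ (i mod e, r) * B' $$ (r, j mod e)) = (B * B') $$ (i mod e, j mod e)"
    using B b by (simp add: scalar_prod_def atLeast0LessThan)
  also have "(A * A') $$ (i div e, j div e) * (B * B') $$ (i mod e, j mod e) = kronecker (A * A') (B * B') $$ (i,j)"
    by (rule kronecker_index[OF AA BB ij, symmetric])
  finally show "(kronecker A B * kronecker A' B') $$ (i,j) = kronecker (A * A') (B * B') $$ (i,j)" .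
qed (use assms in \<open>auto simp: kronecker_def\<close>)

lemma kronecker_one: "kronecker (1\<^sub>m d) (1\<^sub>m e) = 1\<^sub>m (d * e)"
proof (rule eq_matI)
  fix i j assume "i < dim_row (1\<^sub>m (d * e) :: complex mat)" "j < dim_col (1\<^sub>m (d * e) :: complex mat)"
  then have ij: "i < d * e" "j < d * e" by auto
  have eq: "x = y \<longleftrightarrow> x div e = y div e \<and> x mod e = y mod e" for x y :: nat
    by (metis div_mult_mod_eq)
  show "kronecker (1\<^sub>m d) (1\<^sub>m e) $$ (i,j) = 1\<^sub>m (d * e) $$ (i,j)"
    using ij div_mod_bounds[OF ij(1)] div_mod_bounds[OF ij(2)] eq[of i j]
    by (simp add: kronecker_index[OF one_carrier_mat one_carrier_mat])
qed (auto simp: kronecker_def)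

text \<open>Mixed radix digits, most significant first: the indices in the single factors that
  belong to position \<open>p\<close> of an iterated Kronecker product.\<close>

fun digit :: "nat list \<Rightarrow> nat \<Rightarrow> nat \<Rightarrow> nat" where
  "digit [] i p = 0"
| "digit (d # ds) 0 p = p div prod_list ds"
| "digit (d # ds) (Suc i) p = digit ds i (p mod prod_list ds)"

lemma digit_less: "p < prod_list ds \<Longrightarrow> i < length ds \<Longrightarrow> digit ds i p < ds ! i"
proof (induction ds i p rule: digit.induct)
  case (2 d ds p)
  then show ?case using div_mod_bounds[of p d "prod_list ds"] by simp
next
  case (3 d ds i p)
  then show ?case using div_mod_bounds[of p d "prod_list ds"] by simp
qed simp

lemma digit_inject:
  "p < prod_list ds \<Longrightarrow> q < prod_list ds \<Longrightarrow> (\<And>i. i < length ds \<Longrightarrow> digit ds i p = digit ds i q) \<Longrightarrow> p = q"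
proof (induction ds arbitrary: p q)
  case (Cons d ds)
  have "p div prod_list ds = q div prod_list ds" using Cons.prems(3)[of 0] by simp
  moreover have "p mod prod_list ds = q mod prod_list ds"
  proof (rule Cons.IH)
    show "p mod prod_list ds < prod_list ds" "q mod prod_list ds < prod_list ds"
      using div_mod_bounds[of p d "prod_list ds"] div_mod_bounds[of q d "prod_list ds"] Cons.prems by auto
    show "digit ds i (p mod prod_list ds) = digit ds i (q mod prod_list ds)" if "i < length ds" for i
      using Cons.prems(3)[of "Suc i"] that by simp
  qed
  ultimately show ?case by (metis div_mult_mod_eq)
qed simp

lemma foldr_kronecker_carrier:
  "list_all2 (\<lambda>M d. M \<in> carrier_mat d d) Ms ds \<Longrightarrow>
    foldr kronecker Ms (1\<^sub>m 1) \<in> carrier_mat (prod_list ds) (prod_list ds)"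
  by (induction rule: list_all2_induct) (auto intro!: kronecker_carrier)

lemma foldr_kronecker_index:
  assumes "list_all2 (\<lambda>M d. M \<in> carrier_mat d d) Ms ds" "p < prod_list ds" "q < prod_list ds"
  shows "foldr kronecker Ms (1\<^sub>m 1) $$ (p,q) = (\<Prod>i<length ds. (Ms ! i) $$ (digit ds i p, digit ds i q))"
  using assms
proof (induction arbitrary: p q rule: list_all2_induct)
  case (Cons M Ms d ds)
  note b = div_mod_bounds[of p d "prod_list ds"] div_mod_bounds[of q d "prod_list ds"]
  have "foldr kronecker (M # Ms) (1\<^sub>m 1) $$ (p,q) =
    M $$ (p div prod_list ds, q div prod_list ds) * foldr kronecker Ms (1\<^sub>m 1) $$ (p mod prod_list ds, q mod prod_list ds)"
    using Cons.hyps Cons.prems by (simp add: kronecker_index[OF _ foldr_kronecker_carrier])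
  also have "foldr kronecker Ms (1\<^sub>m 1) $$ (p mod prod_list ds, q mod prod_list ds) =
    (\<Prod>i<length ds. (Ms ! i) $$ (digit ds i (p mod prod_list ds), digit ds i (q mod prod_list ds)))"
    using Cons.IH b Cons.prems by simp
  finally show ?case by (simp del: prod.lessThan_Suc add: prod.lessThan_Suc_shift)
qed simp

lemma foldr_kronecker_trace:
  assumes "list_all2 (\<lambda>M d. M \<in> carrier_mat d d) Ms ds"
  shows "(\<Sum>p<prod_list ds. foldr kronecker Ms (1\<^sub>m 1) $$ (p,p)) = (\<Prod>i<length ds. \<Sum>r<ds ! i. (Ms ! i) $$ (r,r))"
  using assms
proof (induction rule: list_all2_induct)
  case (Cons M Ms d ds)
  let ?K = "foldr kronecker Ms (1\<^sub>m 1)" and ?m = "prod_list ds"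
  have "(\<Sum>p<d * ?m. foldr kronecker (M # Ms) (1\<^sub>m 1) $$ (p,p)) =
    (\<Sum>p<d * ?m. M $$ (p div ?m, p div ?m) * ?K $$ (p mod ?m, p mod ?m))"
    using Cons.hyps by (simp add: kronecker_index[OF _ foldr_kronecker_carrier])
  also have "\<dots> = (\<Sum>k<d. \<Sum>r<?m. M $$ (k,k) * ?K $$ (r,r))" by (rule sum_div_mod)
  also have "\<dots> = (\<Sum>k<d. M $$ (k,k)) * (\<Sum>r<?m. ?K $$ (r,r))" by (simp add: sum_product)
  finally show ?case using Cons.IH by (simp del: prod.lessThan_Suc add: prod.lessThan_Suc_shift)
qed simp

section \<open>Wreath products\<close>

abbreviation pinv :: "(nat \<Rightarrow> nat) \<Rightarrow> nat \<Rightarrow> nat" where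
  "pinv \<equiv> inv_into UNIV"

lemma wreath_mult_eq:
  "Wr a \<pi> \<otimes>\<^bsub>wreath G n H\<^esub> Wr b \<tau> = Wr (\<lambda>i\<in>{1..n}. a i \<otimes>\<^bsub>G\<^esub> b (pinv \<pi> i)) (\<pi> \<circ> \<tau>)"
  by (auto simp: wreath_def intro!: restrict_ext)

lemma wreath_one_eq: "\<one>\<^bsub>wreath G n H\<^esub> = Wr (\<lambda>i\<in>{1..n}. \<one>\<^bsub>G\<^esub>) id"
  by (simp add: wreath_def)

lemma carrier_wreath:
  "carrier (wreath G n H) = {Wr a \<pi> | a \<pi>. a \<in> (\<Pi>\<^sub>E i\<in>{1..n}. carrier G) \<and> \<pi> \<in> carrier H}"
  by (simp add: wreath_def)

text \<open>Product and unit do not mention the group of permutations, so passing to another one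
  changes only the carrier.\<close>

lemma wreath_subgroup_eq: "wreath G n H = (wreath G n K)\<lparr>carrier := carrier (wreath G n H)\<rparr>"
  by (simp add: wreath_def)

definition stab :: "nat \<Rightarrow> (nat \<Rightarrow> nat) \<Rightarrow> (nat \<Rightarrow> nat) set" where
  "stab n l = {\<pi>. \<pi> permutes {1..n} \<and> (\<forall>i\<in>{1..n}. l (\<pi> i) = l i)}"

locale wreath_group = G: group G for G :: "wreath_elem monoid" (structure) +
  fixes n :: nat
  assumes fin_G: "finite (carrier G)"
begin

abbreviation "N \<equiv> {1..n}"
abbreviation "P \<equiv> (\<Pi>\<^sub>E i\<in>{1..n}. carrier G)"
abbreviation "W \<equiv> wreath G n (sym_group n)"

definition base :: "wreath_elem set" where
  "base = {Wr a id | a. a \<in> P}"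

definition stab_wreath :: "(nat \<Rightarrow> nat) \<Rightarrow> wreath_elem set" where
  "stab_wreath l = {Wr a \<pi> | a \<pi>. a \<in> P \<and> \<pi> \<in> stab n l}"

lemma carrier_W: "carrier W = {Wr a \<pi> | a \<pi>. a \<in> P \<and> \<pi> permutes N}"
  by (simp add: carrier_wreath sym_group_def)

lemma Wr_in_carrier_W [simp]: "Wr a \<pi> \<in> carrier W \<longleftrightarrow> a \<in> P \<and> \<pi> permutes N"
  by (auto simp: carrier_W)

lemma Wr_in_base [simp]: "Wr a \<pi> \<in> base \<longleftrightarrow> a \<in> P \<and> \<pi> = id"
  by (auto simp: base_def)

lemma Wr_in_stab_wreath [simp]: "Wr a \<pi> \<in> stab_wreath l \<longleftrightarrow> a \<in> P \<and> \<pi> \<in> stab n l"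
  by (auto simp: stab_wreath_def)

lemma inv_perm_in: "\<pi> permutes N \<Longrightarrow> i \<in> N \<Longrightarrow> pinv \<pi> i \<in> N"
  using permutes_in_image[OF permutes_inv, of \<pi> N i] by simp

lemma perm_in: "\<pi> permutes N \<Longrightarrow> i \<in> N \<Longrightarrow> \<pi> i \<in> N"
  using permutes_in_image[of \<pi> N i] by simp

lemma Wr_restrict_eqI:
  assumes "\<And>i. i \<in> N \<Longrightarrow> f i = g i" "\<pi> = \<tau>"
  shows "Wr (\<lambda>i\<in>N. f i) \<pi> = Wr (\<lambda>i\<in>N. g i) \<tau>"
  using assms restrict_ext[of N f g] by simp

lemma group_W: "group W"
proof (rule groupI)
  show "\<one>\<^bsub>W\<^esub> \<in> carrier W" by (simp add: wreath_one_eq)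
  fix x assume x: "x \<in> carrier W"
  then obtain a \<pi> where x': "x = Wr a \<pi>" "a \<in> P" "\<pi> permutes N" by (auto simp: carrier_W)
  show "\<one>\<^bsub>W\<^esub> \<otimes>\<^bsub>W\<^esub> x = x"
  proof -
    have "(\<lambda>i\<in>N. (\<lambda>i\<in>N. \<one>) i \<otimes> a (pinv id i)) = (\<lambda>i\<in>N. a i)"
      by (rule restrict_ext) (use PiE_mem[OF x'(2)] in \<open>simp add: inv_id\<close>)
    also have "\<dots> = a" using x'(2) by (rule PiE_restrict)
    finally show ?thesis by (simp add: x'(1) wreath_one_eq wreath_mult_eq)
  qed
  show "\<exists>y\<in>carrier W. y \<otimes>\<^bsub>W\<^esub> x = \<one>\<^bsub>W\<^esub>"
  \<comment> \<open>Multiplying by an element over \<open>pinv \<pi>\<close> brings coordinate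
    \<open>\<pi> i\<close> of \<open>a\<close> to position \<open>i\<close>, which dictates the
    coordinates of the inverse.\<close>
  proof (rule bexI[of _ "Wr (\<lambda>i\<in>N. inv (a (\<pi> i))) (pinv \<pi>)"])
    have m: "a (\<pi> i) \<in> carrier G" if "i \<in> N" for i using x' perm_in[OF x'(3) that] by blast
    then show "Wr (\<lambda>i\<in>N. inv (a (\<pi> i))) (pinv \<pi>) \<in> carrier W"
      using x' by (auto simp: permutes_inv)
    show "Wr (\<lambda>i\<in>N. inv (a (\<pi> i))) (pinv \<pi>) \<otimes>\<^bsub>W\<^esub> x = \<one>\<^bsub>W\<^esub>"
      unfolding x'(1) wreath_mult_eq wreath_one_eq permutes_inv_inv[OF x'(3)]
      by (rule Wr_restrict_eqI) (use m permutes_inv_o(2)[OF x'(3)] in simp_all)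
  qed
  fix y assume "y \<in> carrier W"
  then obtain b \<tau> where y': "y = Wr b \<tau>" "b \<in> P" "\<tau> permutes N" by (auto simp: carrier_W)
  have b: "b (pinv \<pi> i) \<in> carrier G" if "i \<in> N" for i using y' inv_perm_in[OF x'(3) that] by blast
  show "x \<otimes>\<^bsub>W\<^esub> y \<in> carrier W"
    using x' y' b by (auto simp: wreath_mult_eq permutes_compose)
  fix z assume "z \<in> carrier W"
  then obtain c \<sigma> where z': "z = Wr c \<sigma>" "c \<in> P" "\<sigma> permutes N" by (auto simp: carrier_W)
  have inv: "pinv (\<pi> \<circ> \<tau>) = pinv \<tau> \<circ> pinv \<pi>"
    by (rule o_inv_distrib[OF permutes_bij[OF x'(3)] permutes_bij[OF y'(3)]])
  have c: "c (pinv \<tau> (pinv \<pi> i)) \<in> carrier G" if "i \<in> N" for i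
    using z' inv_perm_in[OF y'(3) inv_perm_in[OF x'(3) that]] by blast
  have a: "a i \<in> carrier G" if "i \<in> N" for i using x' that by blast
  show "x \<otimes>\<^bsub>W\<^esub> y \<otimes>\<^bsub>W\<^esub> z = x \<otimes>\<^bsub>W\<^esub> (y \<otimes>\<^bsub>W\<^esub> z)"
    unfolding x'(1) y'(1) z'(1) wreath_mult_eq inv
    by (rule Wr_restrict_eqI) (use a b c inv_perm_in[OF x'(3)] in \<open>simp_all add: G.m_assoc comp_assoc\<close>)
qed

sublocale W: group W by (rule group_W)

abbreviation wreath_prod (infixl "\<star>" 70) where
  "x \<star> y \<equiv> x \<otimes>\<^bsub>W\<^esub> y"

abbreviation wreath_inv ("winv _" [81] 80) where
  "winv x \<equiv> inv\<^bsub>W\<^esub> x"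


lemma finite_P: "finite P"
  using fin_G by (intro finite_PiE) auto

lemma finite_W: "finite (carrier W)"
proof -
  have "carrier W = (\<lambda>(a,\<pi>). Wr a \<pi>) ` (P \<times> {\<pi>. \<pi> permutes N})" by (auto simp: carrier_W)
  then show ?thesis using finite_P finite_permutations[of N] by simp
qed

lemma inv_W:
  assumes "a \<in> P" "\<pi> permutes N"
  shows "winv (Wr a \<pi>) = Wr (\<lambda>i\<in>N. inv (a (\<pi> i))) (pinv \<pi>)"
proof (rule W.inv_equality)
  have m: "a (\<pi> i) \<in> carrier G" if "i \<in> N" for i using assms perm_in[OF assms(2) that] by blast
  then show "Wr (\<lambda>i\<in>N. inv (a (\<pi> i))) (pinv \<pi>) \<in> carrier W"
    using assms by (auto simp: permutes_inv)
  show "Wr (\<lambda>i\<in>N. inv (a (\<pi> i))) (pinv \<pi>) \<star> Wr a \<pi> = \<one>\<^bsub>W\<^esub>"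
    unfolding wreath_mult_eq wreath_one_eq permutes_inv_inv[OF assms(2)]
    by (rule Wr_restrict_eqI) (use m permutes_inv_o(2)[OF assms(2)] in simp_all)
qed (use assms in simp)

lemma subgroup_stab: "subgroup (stab n l) (sym_group n)"
proof -
  interpret S: group "sym_group n" by (rule sym_group_is_group)
  have inv: "inv\<^bsub>sym_group n\<^esub> \<pi> = pinv \<pi>" if "\<pi> permutes N" for \<pi>
    using that by (intro S.inv_equality) (auto simp: sym_group_def permutes_inv permutes_inv_o)
  show ?thesis
  proof (rule S.subgroupI)
    show "stab n l \<subseteq> carrier (sym_group n)" by (auto simp: stab_def sym_group_def)
    show "stab n l \<noteq> {}" using permutes_id[of N] by (auto simp: stab_def intro!: exI[of _ id])
    fix \<pi> assume p: "\<pi> \<in> stab n l"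
    then have pp: "\<pi> permutes N" by (simp add: stab_def)
    have "l (pinv \<pi> i) = l i" if "i \<in> N" for i
    proof -
      have "l (\<pi> (pinv \<pi> i)) = l (pinv \<pi> i)"
        using p inv_perm_in[OF pp that] by (simp add: stab_def)
      then show ?thesis using permutes_inverses(1)[OF pp] by simp
    qed
    then show "inv\<^bsub>sym_group n\<^esub> \<pi> \<in> stab n l" using pp by (simp add: inv stab_def permutes_inv)
    fix \<tau> assume t: "\<tau> \<in> stab n l"
    have "(\<pi> \<circ> \<tau>) permutes N" using p t by (simp add: stab_def permutes_compose)
    moreover have "l (\<pi> (\<tau> i)) = l i" if "i \<in> N" for i
    proof -
      have "\<tau> i \<in> N" using t that perm_in by (simp add: stab_def)
      then show ?thesis using p t that by (simp add: stab_def)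
    qed
    ultimately show "\<pi> \<otimes>\<^bsub>sym_group n\<^esub> \<tau> \<in> stab n l"
      by (simp add: stab_def sym_group_def)
  qed
qed

lemma inv_stab: "\<pi> \<in> stab n l \<Longrightarrow> pinv \<pi> \<in> stab n l"
proof -
  interpret S: group "sym_group n" by (rule sym_group_is_group)
  assume p: "\<pi> \<in> stab n l"
  then have "\<pi> permutes N" by (simp add: stab_def)
  then have "inv\<^bsub>sym_group n\<^esub> \<pi> = pinv \<pi>"
    by (intro S.inv_equality) (auto simp: sym_group_def permutes_inv permutes_inv_o)
  then show ?thesis using subgroup.m_inv_closed[OF subgroup_stab p] by simp
qed

lemma stab_permutes: "\<pi> \<in> stab n l \<Longrightarrow> \<pi> permutes N"
  by (simp add: stab_def)

lemma subgroup_stab_wreath: "subgroup (stab_wreath l) W"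
proof (rule W.subgroupI)
  show "stab_wreath l \<subseteq> carrier W" by (auto simp: stab_wreath_def stab_def)
  have "(\<lambda>i\<in>N. \<one>) \<in> P" by auto
  moreover have "id \<in> stab n l" by (simp add: stab_def permutes_id)
  ultimately have "Wr (\<lambda>i\<in>N. \<one>) id \<in> stab_wreath l" by simp
  then show "stab_wreath l \<noteq> {}" by blast
  fix x assume "x \<in> stab_wreath l"
  then obtain a \<pi> where x: "x = Wr a \<pi>" "a \<in> P" "\<pi> \<in> stab n l" by (auto simp: stab_wreath_def)
  have m: "a (\<pi> i) \<in> carrier G" if "i \<in> N" for i using x perm_in[OF stab_permutes[OF x(3)] that] by blast
  then show "winv x \<in> stab_wreath l"
    using inv_stab[OF x(3)] by (auto simp: x(1) inv_W[OF x(2) stab_permutes[OF x(3)]])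
  fix y assume "y \<in> stab_wreath l"
  then obtain b \<tau> where y: "y = Wr b \<tau>" "b \<in> P" "\<tau> \<in> stab n l" by (auto simp: stab_wreath_def)
  have b: "b (pinv \<pi> i) \<in> carrier G" if "i \<in> N" for i
    using y inv_perm_in[OF stab_permutes[OF x(3)] that] by blast
  have "\<pi> \<circ> \<tau> \<in> stab n l"
    using subgroup.m_closed[OF subgroup_stab x(3) y(3)] by (simp add: sym_group_def)
  then show "x \<star> y \<in> stab_wreath l" using x y b by (auto simp: wreath_mult_eq)
qed

text \<open>Coordinate \<open>i\<close> of the conjugate is an inner conjugate of coordinate
  \<open>\<pi> i\<close>. This shift of coordinates is what makes the wreath product act on
  labellings.\<close>

lemma base_conj:
  assumes c: "c \<in> P" "\<pi> permutes N" and b: "b \<in> P"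
  shows "winv (Wr c \<pi>) \<star> Wr b id \<star> Wr c \<pi> = Wr (\<lambda>i\<in>N. inv (c (\<pi> i)) \<otimes> b (\<pi> i) \<otimes> c (\<pi> i)) id"
proof -
  have m: "c (\<pi> i) \<in> carrier G" "b (\<pi> i) \<in> carrier G" if "i \<in> N" for i using c b perm_in[OF c(2) that] by blast+
  show ?thesis
    unfolding inv_W[OF c] wreath_mult_eq inv_id permutes_inv_inv[OF c(2)]
    by (rule Wr_restrict_eqI) (use m perm_in[OF c(2)] permutes_inv_o(2)[OF c(2)] in \<open>simp_all add: permutes_inv_inv[OF c(2)]\<close>)
qed

lemma subgroup_base: "subgroup base W"
proof (rule W.subgroupI)
  show "base \<subseteq> carrier W" by (auto simp: base_def permutes_id)
  have "(\<lambda>i\<in>N. \<one>) \<in> P" by auto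
  then have "Wr (\<lambda>i\<in>N. \<one>) id \<in> base" by simp
  then show "base \<noteq> {}" by blast
  fix x assume "x \<in> base"
  then obtain a where x: "x = Wr a id" "a \<in> P" by (auto simp: base_def)
  then show "winv x \<in> base" by (auto simp: inv_W permutes_id)
  fix y assume "y \<in> base"
  then obtain b where y: "y = Wr b id" "b \<in> P" by (auto simp: base_def)
  then show "x \<star> y \<in> base" using x by (auto simp: wreath_mult_eq)
qed

lemma base_normal:
  assumes "t \<in> carrier W" "z \<in> base"
  shows "winv t \<star> z \<star> t \<in> base"
proof -
  obtain c \<pi> where t: "t = Wr c \<pi>" "c \<in> P" "\<pi> permutes N" using assms by (auto simp: carrier_W)
  obtain b where z: "z = Wr b id" "b \<in> P" using assms by (auto simp: base_def)
  have m: "c (\<pi> i) \<in> carrier G" "b (\<pi> i) \<in> carrier G" if "i \<in> N" for i using t z perm_in[OF t(3) that] by blast+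
  then show ?thesis using t z by (auto simp: base_conj)
qed

lemma base_subset: "base \<subseteq> stab_wreath l"
  by (auto simp: base_def stab_def permutes_id)

lemma bij_base: "bij_betw (\<lambda>a. Wr a id) P base"
  by (auto simp: bij_betw_def inj_on_def base_def)

lemma finite_base: "finite base"
  using bij_betw_finite[OF bij_base] finite_P by simp

lemma sum_stab_wreath:
  "(\<Sum>h\<in>stab_wreath l. F h) = (\<Sum>\<pi>\<in>stab n l. \<Sum>a\<in>P. F (Wr a \<pi>))"
proof -
  have "(\<Sum>\<pi>\<in>stab n l. \<Sum>a\<in>P. F (Wr a \<pi>)) = (\<Sum>p\<in>stab n l \<times> P. F (Wr (snd p) (fst p)))"
    unfolding sum.cartesian_product by (simp add: case_prod_beta)
  also have "\<dots> = (\<Sum>h\<in>stab_wreath l. F h)"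
  proof (rule sum.reindex_bij_betw[of _ _ _ F])
    show "bij_betw (\<lambda>p. Wr (snd p) (fst p)) (stab n l \<times> P) (stab_wreath l)"
      by (rule bij_betw_byWitness[where f' = "\<lambda>h. case h of Wr a \<pi> \<Rightarrow> (\<pi>,a)"]) (auto simp: stab_wreath_def)
  qed
  finally show ?thesis by simp
qed

end

section \<open>Orthogonality under independent conjugations\<close>

context group
begin

text \<open>Conjugation replaces each coefficient by a combination of coefficients of the same
  representation with weights that do not depend on \<open>x\<close>, so the two sides may be
  conjugated by different elements.\<close>

lemma coeff_orth_conj:
  assumes o: "coeff_orth d \<rho> e \<eta>" and r: "mat_rep G d \<rho>" "mat_rep G e \<eta>"
    and c: "c \<in> carrier G" "c' \<in> carrier G" and i: "i < d" "j < d" "k < e" "l < e"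
  shows "(\<Sum>x\<in>carrier G. \<rho> (inv c \<otimes> x \<otimes> c) $$ (i,j) * \<eta> (inv c' \<otimes> inv x \<otimes> c') $$ (k,l)) = 0" (is "?L = _")
proof -
  have expand: "\<theta> (inv z \<otimes> x \<otimes> z) $$ (a,b) = (\<Sum>p<m. \<Sum>q<m. \<theta> x $$ (p,q) * (\<theta> (inv z) $$ (a,p) * \<theta> z $$ (q,b)))"
    if "mat_rep G m \<theta>" "z \<in> carrier G" "x \<in> carrier G" "a < m" "b < m" for m \<theta> z x a b
  proof -
    have "\<theta> (inv z \<otimes> x \<otimes> z) = \<theta> (inv z) * \<theta> x * \<theta> z" using that by (simp add: mat_rep_mult)
    then show ?thesis
      using mult3_index[OF mat_rep_carrier[OF that(1) inv_closed[OF that(2)]] mat_rep_carrier[OF that(1,3)]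
          mat_rep_carrier[OF that(1,2)] that(4,5)] by simp
  qed
  let ?k = "\<lambda>a b p q. (\<rho> (inv c) $$ (i,a) * \<rho> c $$ (b,j)) * (\<eta> (inv c') $$ (k,p) * \<eta> c' $$ (q,l))"
  have "?L =
    (\<Sum>x\<in>carrier G. \<Sum>a<d. \<Sum>b<d. \<Sum>p<e. \<Sum>q<e. ?k a b p q * (\<rho> x $$ (a,b) * \<eta> (inv x) $$ (p,q)))"
    by (rule sum.cong[OF refl])
      (simp add: expand[OF r(1) c(1) _ i(1,2)] expand[OF r(2) c(2) _ i(3,4)],
        simp only: sum_distrib_right, simp only: sum_distrib_left mult_ac)
  also have "\<dots> = (\<Sum>a<d. \<Sum>b<d. \<Sum>p<e. \<Sum>q<e. ?k a b p q * coeff_sum \<rho> (a,b) \<eta> (p,q))"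
    by (simp only: sum_swap2[where A = "carrier G"] sum_distrib_left)
  also have "\<dots> = 0" using o by (simp add: coeff_orth_def)
  finally show ?thesis .
qed

end

section \<open>Tensor representations of the base group indexed by labellings\<close>

locale wreath_irreps = wreath_group G n for G :: "wreath_elem monoid" (structure) and n +
  fixes \<rho>s :: "(wreath_elem \<Rightarrow> complex mat) list" and D :: "nat \<Rightarrow> nat"
  assumes irreps: "traversal_family G {..<length \<rho>s} (\<lambda>i. \<rho>s ! i)"
    and D: "k < length \<rho>s \<Longrightarrow> G.irrep (D k) (\<rho>s ! k)"
begin

abbreviation labelling :: "(nat \<Rightarrow> nat) \<Rightarrow> bool" where
  "labelling l \<equiv> \<forall>i\<in>N. l i < length \<rho>s"

text \<open>Coordinates are numbered from 1 and list positions from 0, hence \<open>Suc i\<close>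
  here and \<open>i - 1\<close> as the argument of \<open>digit\<close> below.\<close>

definition dims :: "(nat \<Rightarrow> nat) \<Rightarrow> nat list" where
  "dims l = map (\<lambda>i. D (l (Suc i))) [0..<n]"

abbreviation tdim :: "(nat \<Rightarrow> nat) \<Rightarrow> nat" where
  "tdim l \<equiv> prod_list (dims l)"

definition tens :: "(nat \<Rightarrow> nat) \<Rightarrow> (nat \<Rightarrow> wreath_elem) \<Rightarrow> complex mat" where
  "tens l = outer_tensor (map (\<lambda>i. \<rho>s ! l (Suc i)) [0..<n])"

lemma tens_foldr:
  "tens l a = foldr kronecker (map (\<lambda>i. (\<rho>s ! l (Suc i)) (a (Suc i))) [0..<n]) (1\<^sub>m 1)"
  unfolding tens_def outer_tensor_def by (rule arg_cong2[of _ _ _ _ "foldr kronecker"]) auto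

lemma tens_factors:
  assumes "labelling l" "a \<in> P"
  shows "list_all2 (\<lambda>M d. M \<in> carrier_mat d d) (map (\<lambda>i. (\<rho>s ! l (Suc i)) (a (Suc i))) [0..<n]) (dims l)"
proof -
  have "(\<rho>s ! l (Suc i)) (a (Suc i)) \<in> carrier_mat (D (l (Suc i))) (D (l (Suc i)))" if "i < n" for i
  proof -
    have m: "Suc i \<in> N" using that by simp
    then have "a (Suc i) \<in> carrier G" "l (Suc i) < length \<rho>s" using assms by blast+
    then show ?thesis using G.mat_rep_carrier[OF G.irrep_mat_rep[OF D]] by blast
  qed
  then show ?thesis by (simp add: dims_def list_all2_conv_all_nth)
qed

lemma tens_carrier: "labelling l \<Longrightarrow> a \<in> P \<Longrightarrow> tens l a \<in> carrier_mat (tdim l) (tdim l)"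
  unfolding tens_foldr by (rule foldr_kronecker_carrier[OF tens_factors])

lemma length_dims [simp]: "length (dims l) = n"
  by (simp add: dims_def)

lemma digit_dims: "p < tdim l \<Longrightarrow> i \<in> N \<Longrightarrow> digit (dims l) (i - 1) p < D (l i)"
  using digit_less[of p "dims l" "i - 1"] by (auto simp: dims_def)

lemma digit_dims_inject:
  assumes "p < tdim l" "q < tdim l"
  shows "p = q \<longleftrightarrow> (\<forall>i\<in>N. digit (dims l) (i - 1) p = digit (dims l) (i - 1) q)"
proof
  assume h: "\<forall>i\<in>N. digit (dims l) (i - 1) p = digit (dims l) (i - 1) q"
  show "p = q"
  proof (rule digit_inject[OF assms])
    fix i assume "i < length (dims l)"
    then have "Suc i \<in> N" by simp
    from bspec[OF h this] show "digit (dims l) i p = digit (dims l) i q" by simp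
  qed
qed simp

lemma tens_index:
  assumes "labelling l" "a \<in> P" "p < tdim l" "q < tdim l"
  shows "tens l a $$ (p,q) = (\<Prod>i\<in>N. (\<rho>s ! l i) (a i) $$ (digit (dims l) (i - 1) p, digit (dims l) (i - 1) q))"
  unfolding tens_foldr foldr_kronecker_index[OF tens_factors[OF assms(1,2)] assms(3,4)]
  by (simp add: One_nat_def prod.atLeast1_atMost_eq)

lemma tens_trace:
  assumes "labelling l" "a \<in> P"
  shows "(\<Sum>p<tdim l. tens l a $$ (p,p)) = (\<Prod>i\<in>N. \<Sum>r<D (l i). (\<rho>s ! l i) (a i) $$ (r,r))"
  unfolding tens_foldr foldr_kronecker_trace[OF tens_factors[OF assms]]
  by (simp add: One_nat_def prod.atLeast1_atMost_eq dims_def)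

lemma rho_orth:
  assumes "k < length \<rho>s" "k' < length \<rho>s" "k \<noteq> k'"
  shows "G.coeff_orth (D k) (\<rho>s ! k) (D k') (\<rho>s ! k')"
proof -
  have tr: "traversal G (set \<rho>s)" and inj: "inj_on (\<lambda>i. \<rho>s ! i) {..<length \<rho>s}"
    using irreps by (simp_all add: traversal_family_def lessThan_atLeast0 nth_image)
  have "\<rho>s ! k \<noteq> \<rho>s ! k'" using inj_on_eq_iff[OF inj, of k k'] assms by simp
  then show ?thesis
    by (rule G.traversal_coeff_orth[OF tr nth_mem[OF assms(1)] nth_mem[OF assms(2)] _ D[OF assms(1)] D[OF assms(2)]])
qed

text \<open>The Schur constant of the tensor representation, as the product of the constants of its
  factors.\<close>

definition tconst :: "(nat \<Rightarrow> nat) \<Rightarrow> complex" where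
  "tconst l = (\<Prod>i\<in>N. of_nat (card (carrier G)) / of_nat (D (l i)))"

lemma tconst_nonzero: "labelling l \<Longrightarrow> tconst l \<noteq> 0"
proof -
  assume l: "labelling l"
  have "carrier G \<noteq> {}" using G.one_closed by blast
  then have c: "card (carrier G) \<noteq> 0" using fin_G by simp
  have "of_nat (card (carrier G)) / of_nat (D (l i)) \<noteq> (0::complex)" if "i \<in> N" for i
  proof -
    have "l i < length \<rho>s" using l that by blast
    then have "D (l i) \<noteq> 0" using G.irrep_dim_pos[OF D] by blast
    then show ?thesis using c by simp
  qed
  then show ?thesis unfolding tconst_def prod_zero_iff[OF finite_atLeastAtMost] by blast
qed

text \<open>Coefficients are products over the coordinates, so the sum over G^n is a product of
  Schur sums over G. By \<open>digit_dims_inject\<close> the conditions on the single digits combine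
  into equality of the indices.\<close>

lemma tens_self_orth:
  assumes l: "labelling l" and p: "p < tdim l" "u < tdim l" "v < tdim l" "s < tdim l"
  shows "(\<Sum>a\<in>P. tens l a $$ (p,u) * tens l (\<lambda>i\<in>N. inv (a i)) $$ (v,s)) =
    (if p = s \<and> u = v then tconst l else 0)" (is "?L = _")
proof -
  let ?d = "\<lambda>i. digit (dims l) (i - 1)"
  let ?f = "\<lambda>i x. (\<rho>s ! l i) x $$ (?d i p, ?d i u) * (\<rho>s ! l i) (inv x) $$ (?d i v, ?d i s)"
  have "?L = (\<Sum>a\<in>P. \<Prod>i\<in>N. ?f i (a i))"
  proof (rule sum.cong[OF refl])
    fix a assume a: "a \<in> P"
    have a': "(\<lambda>i\<in>N. inv (a i)) \<in> P"
      unfolding restrict_PiE_iff using PiE_mem[OF a] G.inv_closed by blast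
    show "tens l a $$ (p,u) * tens l (\<lambda>i\<in>N. inv (a i)) $$ (v,s) = (\<Prod>i\<in>N. ?f i (a i))"
      unfolding tens_index[OF l a p(1,2)] tens_index[OF l a' p(3,4)] prod.distrib[symmetric]
      by (rule prod.cong[OF refl]) (simp only: restrict_apply')
  qed
  also have "\<dots> = (\<Prod>i\<in>N. \<Sum>x\<in>carrier G. ?f i x)"
    by (rule prod_sum_PiE[symmetric]) (use fin_G in auto)
  also have "\<dots> = (\<Prod>i\<in>N. if ?d i p = ?d i s \<and> ?d i u = ?d i v
      then of_nat (card (carrier G)) / of_nat (D (l i)) else 0)"
  proof (rule prod.cong[OF refl])
    fix i assume i: "i \<in> N"
    then have "l i < length \<rho>s" using l by blast
    then have "G.irrep (D (l i)) (\<rho>s ! l i)" by (rule D)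
    from G.schur_orthogonality[OF this] show "(\<Sum>x\<in>carrier G. ?f i x) = (if ?d i p = ?d i s \<and> ?d i u = ?d i v
      then of_nat (card (carrier G)) / of_nat (D (l i)) else 0)"
      using digit_dims[OF p(1) i] digit_dims[OF p(2) i] digit_dims[OF p(3) i] digit_dims[OF p(4) i] by simp
  qed
  also have "\<dots> = (if p = s \<and> u = v then tconst l else 0)"
  proof (cases "p = s \<and> u = v")
    case False
    then obtain i where "i \<in> N" "\<not> (?d i p = ?d i s \<and> ?d i u = ?d i v)"
      using digit_dims_inject[OF p(1,4)] digit_dims_inject[OF p(2,3)] by blast
    then have "(\<Prod>i\<in>N. if ?d i p = ?d i s \<and> ?d i u = ?d i v
      then of_nat (card (carrier G)) / of_nat (D (l i)) else 0 :: complex) = 0"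
      by (intro prod_zero) auto
    then show ?thesis unfolding if_not_P[OF False] .
  qed (simp add: tconst_def)
  finally show ?thesis .
qed

text \<open>After reindexing by the two permutations, the factor at coordinate \<open>m\<close>
  pairs the representations labelled \<open>l (pinv \<pi> m)\<close> and
  \<open>l' (pinv \<pi>' m)\<close>. One coordinate with different labels makes the whole product
  vanish.\<close>

lemma tens_twisted_orth:
  assumes l: "labelling l" "labelling l'" and c: "c \<in> P" "c' \<in> P" and \<pi>: "\<pi> permutes N" "\<pi>' permutes N"
    and m: "m \<in> N" "l (pinv \<pi> m) \<noteq> l' (pinv \<pi>' m)"
    and p: "p < tdim l" "q < tdim l" "r < tdim l'" "s < tdim l'"
  shows "(\<Sum>b\<in>P. tens l (\<lambda>i\<in>N. inv (c (\<pi> i)) \<otimes> b (\<pi> i) \<otimes> c (\<pi> i)) $$ (p,q) *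
    tens l' (\<lambda>i\<in>N. inv (c' (\<pi>' i)) \<otimes> inv (b (\<pi>' i)) \<otimes> c' (\<pi>' i)) $$ (r,s)) = 0" (is "?L = _")
proof -
  let ?i = "pinv \<pi>" and ?i' = "pinv \<pi>'"
  let ?d = "\<lambda>i. digit (dims l) (i - 1)" and ?d' = "\<lambda>i. digit (dims l') (i - 1)"
  let ?F = "\<lambda>m x. (\<rho>s ! l (?i m)) (inv (c m) \<otimes> x \<otimes> c m) $$ (?d (?i m) p, ?d (?i m) q)"
  let ?F' = "\<lambda>m x. (\<rho>s ! l' (?i' m)) (inv (c' m) \<otimes> inv x \<otimes> c' m) $$ (?d' (?i' m) r, ?d' (?i' m) s)"
  have 1: "tens l (\<lambda>i\<in>N. inv (c (\<pi> i)) \<otimes> b (\<pi> i) \<otimes> c (\<pi> i)) $$ (p,q) = (\<Prod>m\<in>N. ?F m (b m))" if b: "b \<in> P" for b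
  proof -
    have "c (\<pi> i) \<in> carrier G \<and> b (\<pi> i) \<in> carrier G" if "i \<in> N" for i using c b perm_in[OF \<pi>(1) that] by blast
    then have a: "(\<lambda>i\<in>N. inv (c (\<pi> i)) \<otimes> b (\<pi> i) \<otimes> c (\<pi> i)) \<in> P" by auto
    have "tens l (\<lambda>i\<in>N. inv (c (\<pi> i)) \<otimes> b (\<pi> i) \<otimes> c (\<pi> i)) $$ (p,q) = (\<Prod>i\<in>N. ?F (\<pi> i) (b (\<pi> i)))"
      unfolding tens_index[OF l(1) a p(1,2)]
      by (rule prod.cong[OF refl]) (simp only: restrict_apply' permutes_inverses(2)[OF \<pi>(1)])
    also have "\<dots> = (\<Prod>m\<in>N. ?F m (b m))"
      by (rule prod.reindex_bij_betw) (rule permutes_imp_bij[OF \<pi>(1)])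
    finally show ?thesis .
  qed
  have 2: "tens l' (\<lambda>i\<in>N. inv (c' (\<pi>' i)) \<otimes> inv (b (\<pi>' i)) \<otimes> c' (\<pi>' i)) $$ (r,s) = (\<Prod>m\<in>N. ?F' m (b m))" if b: "b \<in> P" for b
  proof -
    have "c' (\<pi>' i) \<in> carrier G \<and> b (\<pi>' i) \<in> carrier G" if "i \<in> N" for i using c b perm_in[OF \<pi>(2) that] by blast
    then have a: "(\<lambda>i\<in>N. inv (c' (\<pi>' i)) \<otimes> inv (b (\<pi>' i)) \<otimes> c' (\<pi>' i)) \<in> P" by auto
    have "tens l' (\<lambda>i\<in>N. inv (c' (\<pi>' i)) \<otimes> inv (b (\<pi>' i)) \<otimes> c' (\<pi>' i)) $$ (r,s) = (\<Prod>i\<in>N. ?F' (\<pi>' i) (b (\<pi>' i)))"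
      unfolding tens_index[OF l(2) a p(3,4)]
      by (rule prod.cong[OF refl]) (simp only: restrict_apply' permutes_inverses(2)[OF \<pi>(2)])
    also have "\<dots> = (\<Prod>m\<in>N. ?F' m (b m))"
      by (rule prod.reindex_bij_betw) (rule permutes_imp_bij[OF \<pi>(2)])
    finally show ?thesis .
  qed
  have "?L =
    (\<Sum>b\<in>P. \<Prod>m\<in>N. ?F m (b m) * ?F' m (b m))"
    by (rule sum.cong[OF refl]) (simp only: 1 2 prod.distrib)
  also have "\<dots> = (\<Prod>m\<in>N. \<Sum>x\<in>carrier G. ?F m x * ?F' m x)"
    by (rule prod_sum_PiE[symmetric]) (use fin_G in auto)
  also have "\<dots> = 0"
  proof (rule prod_zero)
    have im: "?i m \<in> N" "?i' m \<in> N" using inv_perm_in \<pi> m(1) by blast+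
    have k: "l (?i m) < length \<rho>s" "l' (?i' m) < length \<rho>s" using l im by blast+
    have cm: "c m \<in> carrier G" "c' m \<in> carrier G" using c m(1) by blast+
    have "(\<Sum>x\<in>carrier G. ?F m x * ?F' m x) = 0"
      by (rule G.coeff_orth_conj[OF rho_orth[OF k m(2)] G.irrep_mat_rep[OF D[OF k(1)]] G.irrep_mat_rep[OF D[OF k(2)]] cm
            digit_dims[OF p(1) im(1)] digit_dims[OF p(2) im(1)] digit_dims[OF p(3) im(2)] digit_dims[OF p(4) im(2)]])
    then show "\<exists>m\<in>N. (\<Sum>x\<in>carrier G. ?F m x * ?F' m x) = 0" using m(1) by blast
  qed simp
  finally show ?thesis .
qed

end

section \<open>Extensions tensored with inflated representations of the stabiliser\<close>

context wreath_irreps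
begin

abbreviation stab_group :: "(nat \<Rightarrow> nat) \<Rightarrow> (nat \<Rightarrow> nat) monoid" where
  "stab_group l \<equiv> (sym_group n)\<lparr>carrier := stab n l\<rparr>"

abbreviation sub_wreath :: "(nat \<Rightarrow> nat) \<Rightarrow> wreath_elem monoid" where
  "sub_wreath l \<equiv> W\<lparr>carrier := stab_wreath l\<rparr>"

lemma group_stab_group: "group (stab_group l)"
  by (rule subgroup.subgroup_is_group[OF subgroup_stab sym_group_is_group])

lemma finite_stab: "finite (stab n l)"
  by (rule finite_subset[OF _ finite_permutations[of N]]) (auto simp: stab_def)

lemma inv_stab_group: "\<pi> \<in> stab n l \<Longrightarrow> inv\<^bsub>stab_group l\<^esub> \<pi> = pinv \<pi>"
  using group.m_inv_consistent[OF sym_group_is_group subgroup_stab] sym_group_inv_equality[of \<pi> n]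
  by (simp add: stab_permutes sym_group_carrier)

lemma mat_rep_stab_group_iff:
  "mat_rep (stab_group l) e \<sigma> \<longleftrightarrow> (\<forall>\<pi>\<in>stab n l. \<sigma> \<pi> \<in> carrier_mat e e) \<and> \<sigma> id = 1\<^sub>m e \<and>
     (\<forall>\<pi>\<in>stab n l. \<forall>\<tau>\<in>stab n l. \<sigma> (\<pi> \<circ> \<tau>) = \<sigma> \<pi> * \<sigma> \<tau>)"
  by (simp add: mat_rep_def sym_group_def)

definition extends :: "(nat \<Rightarrow> nat) \<Rightarrow> (wreath_elem \<Rightarrow> complex mat) \<Rightarrow> bool" where
  "extends l E \<longleftrightarrow> labelling l \<and> mat_rep (sub_wreath l) (tdim l) E \<and> (\<forall>a\<in>P. E (Wr a id) = tens l a)"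

lemma extends_carrier: "extends l E \<Longrightarrow> h \<in> stab_wreath l \<Longrightarrow> E h \<in> carrier_mat (tdim l) (tdim l)"
  by (simp add: extends_def W.mat_rep_subgroup_iff)

lemma extends_mult:
  "extends l E \<Longrightarrow> x \<in> stab_wreath l \<Longrightarrow> y \<in> stab_wreath l \<Longrightarrow> E (x \<star> y) = E x * E y"
  by (simp add: extends_def W.mat_rep_subgroup_iff)

lemma extends_inv:
  assumes E: "extends l E" and x: "x \<in> stab_wreath l"
  shows "E (winv x) * E x = 1\<^sub>m (tdim l)"
proof -
  interpret H: subgroup "stab_wreath l" W by (rule subgroup_stab_wreath)
  have "E \<one>\<^bsub>W\<^esub> = 1\<^sub>m (tdim l)" using E by (simp add: extends_def W.mat_rep_subgroup_iff)
  then show ?thesis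
    using extends_mult[OF E H.m_inv_closed[OF x] x] H.mem_carrier[OF x] by simp
qed

abbreviation tensor_inflate ::
  "(wreath_elem \<Rightarrow> complex mat) \<Rightarrow> ((nat \<Rightarrow> nat) \<Rightarrow> complex mat) \<Rightarrow> wreath_elem \<Rightarrow> complex mat" where
  "tensor_inflate E \<sigma> \<equiv> inner_tensor E (inflate \<sigma>)"

lemma tensor_inflate_index:
  assumes E: "extends l E" and s: "mat_rep (stab_group l) e \<sigma>" and h: "Wr a \<pi> \<in> stab_wreath l"
    and i: "i < tdim l * e" "j < tdim l * e"
  shows "tensor_inflate E \<sigma> (Wr a \<pi>) $$ (i,j) = E (Wr a \<pi>) $$ (i div e, j div e) * \<sigma> \<pi> $$ (i mod e, j mod e)"
proof -
  have "\<sigma> \<pi> \<in> carrier_mat e e" using s h by (simp add: mat_rep_stab_group_iff)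
  then show ?thesis using kronecker_index[OF extends_carrier[OF E h] _ i] by (simp add: inner_tensor_def)
qed

lemma mat_rep_tensor_inflate:
  assumes E: "extends l E" and s: "mat_rep (stab_group l) e \<sigma>"
  shows "mat_rep (sub_wreath l) (tdim l * e) (tensor_inflate E \<sigma>)"
  unfolding W.mat_rep_subgroup_iff
proof (intro conjI ballI)
  have sc: "\<sigma> \<pi> \<in> carrier_mat e e" if "\<pi> \<in> stab n l" for \<pi> using s that by (simp add: mat_rep_stab_group_iff)
  fix x assume x: "x \<in> stab_wreath l"
  then obtain a \<pi> where x': "x = Wr a \<pi>" "\<pi> \<in> stab n l" by (auto simp: stab_wreath_def)
  show "tensor_inflate E \<sigma> x \<in> carrier_mat (tdim l * e) (tdim l * e)"
    using kronecker_carrier[OF extends_carrier[OF E x] sc[OF x'(2)]] by (simp add: inner_tensor_def x')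
  fix y assume y: "y \<in> stab_wreath l"
  then obtain b \<tau> where y': "y = Wr b \<tau>" "\<tau> \<in> stab n l" by (auto simp: stab_wreath_def)
  have "\<sigma> (\<pi> \<circ> \<tau>) = \<sigma> \<pi> * \<sigma> \<tau>" using s x' y' by (simp add: mat_rep_stab_group_iff)
  then have "tensor_inflate E \<sigma> (x \<star> y) = kronecker (E x * E y) (\<sigma> \<pi> * \<sigma> \<tau>)"
    using extends_mult[OF E x y] by (simp add: inner_tensor_def x' y' wreath_mult_eq)
  also have "\<dots> = tensor_inflate E \<sigma> x * tensor_inflate E \<sigma> y"
    using kronecker_mult[OF extends_carrier[OF E x] extends_carrier[OF E y] sc[OF x'(2)] sc[OF y'(2)]]
    by (simp add: inner_tensor_def x' y')
  finally show "tensor_inflate E \<sigma> (x \<star> y) = tensor_inflate E \<sigma> x * tensor_inflate E \<sigma> y" .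
next
  have "E \<one>\<^bsub>W\<^esub> = 1\<^sub>m (tdim l)" using E by (simp add: extends_def W.mat_rep_subgroup_iff)
  moreover have "\<sigma> id = 1\<^sub>m e" using s by (simp add: mat_rep_stab_group_iff)
  ultimately show "tensor_inflate E \<sigma> \<one>\<^bsub>W\<^esub> = 1\<^sub>m (tdim l * e)"
    by (simp add: inner_tensor_def wreath_one_eq kronecker_one)
qed

lemma Wr_split:
  assumes "a \<in> P"
  shows "Wr a \<pi> = Wr a id \<star> Wr (\<lambda>i\<in>N. \<one>) \<pi>"
proof -
  have "(\<lambda>i\<in>N. a i \<otimes> (\<lambda>i\<in>N. \<one>) (pinv id i)) = (\<lambda>i\<in>N. a i)"
    by (rule restrict_ext) (use PiE_mem[OF assms] in \<open>simp add: inv_id\<close>)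
  also have "\<dots> = a" using assms by (rule PiE_restrict)
  finally show ?thesis by (simp add: wreath_mult_eq)
qed

lemma inv_Wr_id: "a \<in> P \<Longrightarrow> winv (Wr a id) = Wr (\<lambda>i\<in>N. inv (a i)) id"
  by (simp add: inv_W permutes_id inv_id)

lemma inv_in_P: "a \<in> P \<Longrightarrow> (\<lambda>i\<in>N. inv (a i)) \<in> P"
  unfolding restrict_PiE_iff using PiE_mem G.inv_closed by blast

lemma one_in_P: "(\<lambda>i\<in>N. \<one>) \<in> P"
  unfolding restrict_PiE_iff by blast

lemma id_in_stab: "id \<in> stab n l"
  by (simp add: stab_def permutes_id)

text \<open>Over \<pi>, the extension is \<open>tens l a\<close> times its value \<open>F\<close> at
  the element with trivial coordinates, and its inverse is \<open>F'\<close> times the tensor at the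
  inverse of \<open>a\<close>. Orthogonality of the tensor coefficients contracts the sum to an
  entry of \<open>F' * F\<close>, which is the identity matrix.\<close>

lemma extends_fibre_orth:
  assumes E: "extends l E" and \<pi>: "\<pi> \<in> stab n l"
    and p: "p < tdim l" "q < tdim l" "r < tdim l" "s < tdim l"
  shows "(\<Sum>a\<in>P. E (Wr a \<pi>) $$ (p,q) * E (winv (Wr a \<pi>)) $$ (r,s)) = (if p = s \<and> q = r then tconst l else 0)" (is "?L = _")
proof -
  interpret H: subgroup "stab_wreath l" W by (rule subgroup_stab_wreath)
  have l: "labelling l" using E by (simp add: extends_def)
  let ?y = "Wr (\<lambda>i\<in>N. \<one>) \<pi>" and ?d = "tdim l"
  let ?F = "E ?y" and ?F' = "E (winv ?y)" and ?T' = "\<lambda>a. tens l (\<lambda>i\<in>N. inv (a i))"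
  have y: "?y \<in> stab_wreath l" using one_in_P \<pi> by simp
  note yi = H.m_inv_closed[OF y]
  note Fc = extends_carrier[OF E y] extends_carrier[OF E yi]
  have "?L =
    (\<Sum>a\<in>P. \<Sum>u<?d. \<Sum>v<?d. (?F $$ (u,q) * ?F' $$ (r,v)) * (tens l a $$ (p,u) * ?T' a $$ (v,s)))"
  proof (rule sum.cong[OF refl])
    fix a assume a: "a \<in> P"
    have x: "Wr a id \<in> stab_wreath l" using a id_in_stab by simp
    note xi = H.m_inv_closed[OF x]
    have 1: "E (Wr a \<pi>) = tens l a * ?F"
      using extends_mult[OF E x y] E a by (simp add: Wr_split[OF a, of \<pi>, symmetric] extends_def)
    have "winv (Wr a \<pi>) = winv ?y \<star> winv (Wr a id)"
      unfolding Wr_split[OF a, of \<pi>] by (rule W.inv_mult_group[OF H.mem_carrier[OF x] H.mem_carrier[OF y]])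
    then have "E (winv (Wr a \<pi>)) = ?F' * E (winv (Wr a id))" using extends_mult[OF E yi xi] by simp
    also have "E (winv (Wr a id)) = ?T' a"
      unfolding inv_Wr_id[OF a] using E inv_in_P[OF a] by (simp add: extends_def)
    finally have 2: "E (winv (Wr a \<pi>)) = ?F' * ?T' a" .
    note T = tens_carrier[OF l a] tens_carrier[OF l inv_in_P[OF a]]
    have "E (Wr a \<pi>) $$ (p,q) = (\<Sum>u<?d. tens l a $$ (p,u) * ?F $$ (u,q))"
      unfolding 1 using T(1) Fc(1) p by (simp add: scalar_prod_def atLeast0LessThan)
    moreover have "E (winv (Wr a \<pi>)) $$ (r,s) = (\<Sum>v<?d. ?F' $$ (r,v) * ?T' a $$ (v,s))"
      unfolding 2 using T(2) Fc(2) p by (simp add: scalar_prod_def atLeast0LessThan)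
    ultimately show "E (Wr a \<pi>) $$ (p,q) * E (winv (Wr a \<pi>)) $$ (r,s) =
      (\<Sum>u<?d. \<Sum>v<?d. (?F $$ (u,q) * ?F' $$ (r,v)) * (tens l a $$ (p,u) * ?T' a $$ (v,s)))"
      by (simp only: sum_product mult_ac)
  qed
  also have "\<dots> = (\<Sum>u<?d. \<Sum>v<?d. \<Sum>a\<in>P. (?F $$ (u,q) * ?F' $$ (r,v)) * (tens l a $$ (p,u) * ?T' a $$ (v,s)))"
    by (rule sum_swap2)
  also have "\<dots> = (\<Sum>u<?d. \<Sum>v<?d. if v = u then (if p = s then tconst l * (?F' $$ (r,u) * ?F $$ (u,q)) else 0) else 0)"
  proof (intro sum.cong refl)
    fix u v assume "u \<in> {..<?d}" "v \<in> {..<?d}"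
    then have "(\<Sum>a\<in>P. tens l a $$ (p,u) * ?T' a $$ (v,s)) = (if p = s \<and> u = v then tconst l else 0)"
      using tens_self_orth[OF l p(1) _ _ p(4)] by simp
    then show "(\<Sum>a\<in>P. (?F $$ (u,q) * ?F' $$ (r,v)) * (tens l a $$ (p,u) * ?T' a $$ (v,s))) =
      (if v = u then (if p = s then tconst l * (?F' $$ (r,u) * ?F $$ (u,q)) else 0) else 0)"
      unfolding sum_distrib_left[symmetric] by simp
  qed
  also have "\<dots> = (if p = s then tconst l * (\<Sum>u<?d. ?F' $$ (r,u) * ?F $$ (u,q)) else 0)"
    by (simp add: sum.delta sum_distrib_left)
  also have "(\<Sum>u<?d. ?F' $$ (r,u) * ?F $$ (u,q)) = (?F' * ?F) $$ (r,q)"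
    using Fc p by (simp add: scalar_prod_def atLeast0LessThan)
  also have "\<dots> = (if r = q then 1 else 0)" using extends_inv[OF E y] p by simp
  finally show ?thesis by auto
qed

text \<open>The inflated factors depend on the permutation alone and leave the inner sum over G^n,
  which \<open>extends_fibre_orth\<close> evaluates to the same constant for every
  permutation.\<close>

lemma tensor_inflate_coeff:
  assumes E: "extends l E" and s: "mat_rep (stab_group l) e \<sigma>" "mat_rep (stab_group l) f \<tau>"
    and i: "i < tdim l * e" "j < tdim l * e" "k < tdim l * f" "m < tdim l * f"
  shows "(\<Sum>h\<in>stab_wreath l. tensor_inflate E \<sigma> h $$ (i,j) * tensor_inflate E \<tau> (winv h) $$ (k,m)) =
    (if i div e = m div f \<and> j div e = k div f
     then tconst l * (\<Sum>\<pi>\<in>stab n l. \<sigma> \<pi> $$ (i mod e, j mod e) * \<tau> (inv\<^bsub>stab_group l\<^esub> \<pi>) $$ (k mod f, m mod f)) else 0)" (is "?L = _")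
proof -
  interpret H: subgroup "stab_wreath l" W by (rule subgroup_stab_wreath)
  note b = div_mod_bounds[OF i(1)] div_mod_bounds[OF i(2)] div_mod_bounds[OF i(3)] div_mod_bounds[OF i(4)]
  let ?c = "\<lambda>\<pi>. \<sigma> \<pi> $$ (i mod e, j mod e) * \<tau> (inv\<^bsub>stab_group l\<^esub> \<pi>) $$ (k mod f, m mod f)"
  have "?L =
    (\<Sum>\<pi>\<in>stab n l. \<Sum>a\<in>P. ?c \<pi> * (E (Wr a \<pi>) $$ (i div e, j div e) * E (winv (Wr a \<pi>)) $$ (k div f, m div f)))"
    unfolding sum_stab_wreath
  proof (intro sum.cong refl)
    fix \<pi> a assume \<pi>: "\<pi> \<in> stab n l" and a: "a \<in> P"
    have h: "Wr a \<pi> \<in> stab_wreath l" using a \<pi> by simp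
    let ?a' = "\<lambda>i\<in>N. inv (a (\<pi> i))"
    have hi: "winv (Wr a \<pi>) = Wr ?a' (pinv \<pi>)" by (rule inv_W[OF a stab_permutes[OF \<pi>]])
    have h': "Wr ?a' (pinv \<pi>) \<in> stab_wreath l" using H.m_inv_closed[OF h] unfolding hi .
    show "tensor_inflate E \<sigma> (Wr a \<pi>) $$ (i,j) * tensor_inflate E \<tau> (winv (Wr a \<pi>)) $$ (k,m) =
      ?c \<pi> * (E (Wr a \<pi>) $$ (i div e, j div e) * E (winv (Wr a \<pi>)) $$ (k div f, m div f))"
      unfolding hi tensor_inflate_index[OF E s(1) h i(1,2)] tensor_inflate_index[OF E s(2) h' i(3,4)]
        inv_stab_group[OF \<pi>] by (simp only: mult_ac)
  qed
  also have "\<dots> = (\<Sum>\<pi>\<in>stab n l. ?c \<pi> * (if i div e = m div f \<and> j div e = k div f then tconst l else 0))"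
  proof (intro sum.cong refl)
    fix \<pi> assume \<pi>: "\<pi> \<in> stab n l"
    show "(\<Sum>a\<in>P. ?c \<pi> * (E (Wr a \<pi>) $$ (i div e, j div e) * E (winv (Wr a \<pi>)) $$ (k div f, m div f))) =
      ?c \<pi> * (if i div e = m div f \<and> j div e = k div f then tconst l else 0)"
      unfolding sum_distrib_left[symmetric]
      by (subst extends_fibre_orth[OF E \<pi>]) (use b in auto)
  qed
  also have "\<dots> = (if i div e = m div f \<and> j div e = k div f then tconst l * (\<Sum>\<pi>\<in>stab n l. ?c \<pi>) else 0)"
    by (simp add: sum_distrib_left mult.commute)
  finally show ?thesis .
qed

text \<open>Conjugates of base elements stay in the base group. There the inflated factors are
  constant and the extensions are the tensor representations, so the claim reduces to
  \<open>tens_twisted_orth\<close>.\<close>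

lemma tensor_inflate_twisted_orth:
  assumes E: "extends l E" "extends l' E'"
    and s: "mat_rep (stab_group l) e \<sigma>" "mat_rep (stab_group l') f \<tau>"
    and t: "Wr c \<pi> \<in> carrier W" "Wr c' \<pi>' \<in> carrier W"
    and m: "m \<in> N" "l (pinv \<pi> m) \<noteq> l' (pinv \<pi>' m)"
  shows "W.twisted_orth base (tdim l * e) (tensor_inflate E \<sigma>) (tdim l' * f) (tensor_inflate E' \<tau>) (Wr c \<pi>) (Wr c' \<pi>')"
  unfolding W.twisted_orth_def
proof (intro allI impI)
  fix u q r v assume u: "u < tdim l * e" "q < tdim l * e" "r < tdim l' * f" "v < tdim l' * f"
  note bd = div_mod_bounds[OF u(1)] div_mod_bounds[OF u(2)] div_mod_bounds[OF u(3)] div_mod_bounds[OF u(4)]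
  have l: "labelling l" "labelling l'" using E by (simp_all add: extends_def)
  have c: "c \<in> P" "c' \<in> P" and \<pi>: "\<pi> permutes N" "\<pi>' permutes N" using t by simp_all
  let ?x = "\<lambda>b. \<lambda>i\<in>N. inv (c (\<pi> i)) \<otimes> b (\<pi> i) \<otimes> c (\<pi> i)"
  let ?y = "\<lambda>b. \<lambda>i\<in>N. inv (c' (\<pi>' i)) \<otimes> inv (b (\<pi>' i)) \<otimes> c' (\<pi>' i)"
  let ?k = "\<sigma> id $$ (u mod e, q mod e) * \<tau> id $$ (r mod f, v mod f)"
  have "(\<Sum>z\<in>base. tensor_inflate E \<sigma> (winv (Wr c \<pi>) \<star> z \<star> Wr c \<pi>) $$ (u,q) *
      tensor_inflate E' \<tau> (winv (Wr c' \<pi>') \<star> winv z \<star> Wr c' \<pi>') $$ (r,v)) =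
    (\<Sum>b\<in>P. tensor_inflate E \<sigma> (winv (Wr c \<pi>) \<star> Wr b id \<star> Wr c \<pi>) $$ (u,q) *
      tensor_inflate E' \<tau> (winv (Wr c' \<pi>') \<star> winv (Wr b id) \<star> Wr c' \<pi>') $$ (r,v))"
    by (rule sum.reindex_bij_betw[OF bij_base, symmetric])
  also have "\<dots> = (\<Sum>b\<in>P. ?k * (tens l (?x b) $$ (u div e, q div e) * tens l' (?y b) $$ (r div f, v div f)))"
  proof (rule sum.cong[OF refl])
    fix b assume b: "b \<in> P"
    have x: "winv (Wr c \<pi>) \<star> Wr b id \<star> Wr c \<pi> = Wr (?x b) id"
      by (rule base_conj[OF c(1) \<pi>(1) b])
    have "(\<lambda>i\<in>N. inv (c' (\<pi>' i)) \<otimes> (\<lambda>i\<in>N. inv (b i)) (\<pi>' i) \<otimes> c' (\<pi>' i)) = ?y b"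
      by (rule restrict_ext) (simp only: restrict_apply' perm_in[OF \<pi>(2)])
    then have y: "winv (Wr c' \<pi>') \<star> winv (Wr b id) \<star> Wr c' \<pi>' = Wr (?y b) id"
      unfolding inv_Wr_id[OF b] using base_conj[OF c(2) \<pi>(2) inv_in_P[OF b]] by simp
    have bb: "Wr b id \<in> base" "winv (Wr b id) \<in> base" using b inv_in_P[OF b] by (simp_all add: inv_Wr_id[OF b])
    have xb: "?x b \<in> P" using base_normal[OF t(1) bb(1)] unfolding x by simp
    have yb: "?y b \<in> P" using base_normal[OF t(2) bb(2)] unfolding y by simp
    have xs: "Wr (?x b) id \<in> stab_wreath l" and ys: "Wr (?y b) id \<in> stab_wreath l'"
      using xb yb id_in_stab by simp_all
    have "E (Wr (?x b) id) = tens l (?x b)" "E' (Wr (?y b) id) = tens l' (?y b)"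
      using E xb yb by (simp_all add: extends_def)
    then show "tensor_inflate E \<sigma> (winv (Wr c \<pi>) \<star> Wr b id \<star> Wr c \<pi>) $$ (u,q) *
      tensor_inflate E' \<tau> (winv (Wr c' \<pi>') \<star> winv (Wr b id) \<star> Wr c' \<pi>') $$ (r,v) =
      ?k * (tens l (?x b) $$ (u div e, q div e) * tens l' (?y b) $$ (r div f, v div f))"
      unfolding x y tensor_inflate_index[OF E(1) s(1) xs u(1,2)] tensor_inflate_index[OF E(2) s(2) ys u(3,4)]
      by (simp only: mult_ac)
  qed
  also have "\<dots> = 0"
    unfolding sum_distrib_left[symmetric]
    using tens_twisted_orth[OF l c \<pi> m, of "u div e" "q div e" "r div f" "v div f"] bd by simp
  finally show "(\<Sum>z\<in>base. tensor_inflate E \<sigma> (winv (Wr c \<pi>) \<star> z \<star> Wr c \<pi>) $$ (u,q) *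
      tensor_inflate E' \<tau> (winv (Wr c' \<pi>') \<star> winv z \<star> Wr c' \<pi>') $$ (r,v)) = 0" .
qed

text \<open>Since the members of \<open>T\<close> separate functions on the stabiliser, the vanishing of all induced
  coefficients forces the sums over single cosets of the base group to vanish.\<close>

lemma base_sum_eq_0:
  assumes E: "extends l E" and T: "traversal (stab_group l) T" and ts: "W.left_transversal (stab_wreath l) ts"
    and z: "\<And>\<sigma> e. \<sigma> \<in> T \<Longrightarrow> group.irrep (stab_group l) e \<sigma> \<Longrightarrow>
      W.rep_sum (length ts * (tdim l * e)) (W.induced_mat ts (stab_wreath l) (tdim l * e) (tensor_inflate E \<sigma>)) f
        = 0\<^sub>m (length ts * (tdim l * e)) (length ts * (tdim l * e))"
    and x: "x \<in> carrier W" "y \<in> carrier W" and p: "p < tdim l" "q < tdim l"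
  shows "(\<Sum>a\<in>P. f (x \<star> Wr a id \<star> y) * tens l a $$ (p,q)) = 0"
proof -
  interpret S: group "stab_group l" by (rule group_stab_group)
  let ?g = "\<lambda>\<pi> a. f (x \<star> Wr a \<pi> \<star> y) * E (Wr a \<pi>) $$ (p,q)"
  have "(\<Sum>a\<in>P. ?g id a) = 0"
  proof (rule S.traversal_separates[OF T, of "\<lambda>\<pi>. \<Sum>a\<in>P. ?g \<pi> a" id])
    show "finite (carrier (stab_group l))" "id \<in> carrier (stab_group l)" using finite_stab id_in_stab by simp_all
    fix \<sigma> e assume s: "\<sigma> \<in> T" and e: "S.irrep e \<sigma>"
    note sr = S.irrep_mat_rep[OF e]
    show "S.rep_sum e \<sigma> (\<lambda>\<pi>. \<Sum>a\<in>P. ?g \<pi> a) = 0\<^sub>m e e"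
      unfolding S.rep_sum_eq_0_iff[OF sr]
    proof (intro allI impI)
      fix r s' assume r: "r < e" "s' < e"
      note lt = mult_add_less[OF p(1) r(1)] mult_add_less[OF p(2) r(2)]
      have "0 = (\<Sum>h\<in>stab_wreath l. f (x \<star> h \<star> y) * tensor_inflate E \<sigma> h $$ (p * e + r, q * e + s'))"
        by (rule W.rep_sum_induced_mat[symmetric, OF subgroup_stab_wreath ts mat_rep_tensor_inflate[OF E sr]
              finite_W z[OF s e] x lt])
      also have "\<dots> = (\<Sum>\<pi>\<in>stab n l. \<Sum>a\<in>P. ?g \<pi> a * \<sigma> \<pi> $$ (r,s'))"
        unfolding sum_stab_wreath
      proof (intro sum.cong refl)
        fix \<pi> a assume "\<pi> \<in> stab n l" "a \<in> P"
        then have h: "Wr a \<pi> \<in> stab_wreath l" by simp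
        show "f (x \<star> Wr a \<pi> \<star> y) * tensor_inflate E \<sigma> (Wr a \<pi>) $$ (p * e + r, q * e + s') = ?g \<pi> a * \<sigma> \<pi> $$ (r,s')"
          unfolding tensor_inflate_index[OF E sr h lt] using r by simp
      qed
      finally show "(\<Sum>\<pi>\<in>carrier (stab_group l). (\<Sum>a\<in>P. ?g \<pi> a) * \<sigma> \<pi> $$ (r,s')) = 0"
        by (simp add: sum_distrib_right)
    qed
  qed
  moreover have "E (Wr a id) = tens l a" if "a \<in> P" for a using E that by (simp add: extends_def)
  ultimately show ?thesis by simp
qed

end

section \<open>Traversals of wreath products\<close>

context wreath_irreps
begin

lemma stab_of_label_eq:
  assumes \<pi>: "\<pi> permutes N" "\<pi>' permutes N"
    and eq: "\<And>m. m \<in> N \<Longrightarrow> l (pinv \<pi> m) = l' (pinv \<pi>' m)" and i: "i \<in> N"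
  shows "l ((pinv \<pi> \<circ> \<pi>') i) = l' i"
  using eq[OF perm_in[OF \<pi>(2) i]] permutes_inverses(2)[OF \<pi>(2)] by simp

text \<open>The translated labelling determines the coset: if both translates agreed,
  \<open>pinv \<pi> \<circ> \<pi>'\<close> would fix \<open>l\<close>, and the two representatives
  would lie in one coset.\<close>

lemma label_distinct_cosets:
  assumes ts: "W.left_transversal (stab_wreath l) ts" and j: "j < length ts" "k < length ts" "j \<noteq> k"
    and t: "ts ! j = Wr c \<pi>" "ts ! k = Wr c' \<pi>'"
  shows "\<exists>m\<in>N. l (pinv \<pi> m) \<noteq> l (pinv \<pi>' m)"
proof (rule ccontr)
  assume "\<not> ?thesis"
  then have eq: "l (pinv \<pi> m) = l (pinv \<pi>' m)" if "m \<in> N" for m using that by blast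
  interpret H: subgroup "stab_wreath l" W by (rule subgroup_stab_wreath)
  have "ts ! j \<in> carrier W" "ts ! k \<in> carrier W"
    using ts j by (auto simp: W.left_transversal_def)
  then have c: "c \<in> P" "\<pi> permutes N" "c' \<in> P" "\<pi>' permutes N" and tk: "Wr c' \<pi>' \<in> carrier W" "Wr c \<pi> \<in> carrier W"
    using t by simp_all
  have "(pinv \<pi> \<circ> \<pi>') permutes N" by (rule permutes_compose[OF c(4) permutes_inv[OF c(2)]])
  then have st: "pinv \<pi> \<circ> \<pi>' \<in> stab n l"
    using stab_of_label_eq[where l = l and l' = l, OF c(2,4) eq] by (simp add: stab_def)
  have "winv (Wr c \<pi>) \<star> Wr c' \<pi>' \<in> carrier W" using tk by simp
  then have "winv (Wr c \<pi>) \<star> Wr c' \<pi>' \<in> stab_wreath l"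
    unfolding inv_W[OF c(1,2)] wreath_mult_eq using st by simp
  moreover have "winv (Wr c' \<pi>') \<star> Wr c' \<pi>' \<in> stab_wreath l" using tk by simp
  moreover have "\<exists>!i. i < length ts \<and> winv (ts ! i) \<star> Wr c' \<pi>' \<in> stab_wreath l"
    using ts tk(1) unfolding W.left_transversal_def by blast
  ultimately have "j = k" using j(1,2) unfolding t[symmetric] by blast
  then show False using j by simp
qed

text \<open>Taking the trace turns the coefficients of a tensor representation into a product of
  characters. Conjugation by a pure permutation carries this from the labelling \<open>l\<close> to
  every labelling \<open>v\<close> in its orbit.\<close>

lemma trace_sum_eq_0:
  assumes E: "extends l E" and T: "traversal (stab_group l) T" and ts: "W.left_transversal (stab_wreath l) ts"
    and z: "\<And>\<sigma> e. \<sigma> \<in> T \<Longrightarrow> group.irrep (stab_group l) e \<sigma> \<Longrightarrow>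
      W.rep_sum (length ts * (tdim l * e)) (W.induced_mat ts (stab_wreath l) (tdim l * e) (tensor_inflate E \<sigma>)) f
        = 0\<^sub>m (length ts * (tdim l * e)) (length ts * (tdim l * e))"
    and v: "\<pi> permutes N" "\<And>m. m \<in> N \<Longrightarrow> v m = l (\<pi> m)" and g: "g \<in> carrier W"
  shows "(\<Sum>b\<in>P. f (Wr b id \<star> g) * (\<Prod>m\<in>N. \<Sum>r<D (v m). (\<rho>s ! v m) (b m) $$ (r,r))) = 0"
proof -
  have l: "labelling l" using E by (simp add: extends_def)
  let ?t = "Wr (\<lambda>i\<in>N. \<one>) \<pi>" and ?c = "\<lambda>k x. \<Sum>r<D k. (\<rho>s ! k) x $$ (r,r)"
  let ?y = "\<lambda>a. \<lambda>i\<in>N. a (\<pi> i)"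
  have t: "?t \<in> carrier W" using one_in_P v(1) by simp
  have conj: "winv ?t \<star> Wr a id \<star> ?t = Wr (?y a) id" if a: "a \<in> P" for a
    unfolding base_conj[OF one_in_P v(1) a]
    by (rule Wr_restrict_eqI[OF _ refl]) (simp only: restrict_apply' perm_in[OF v(1)] G.inv_one G.l_one G.r_one PiE_mem[OF a])
  \<comment> \<open>The translating elements are chosen as \<open>winv ?t\<close> and
    \<open>?t \<star> g\<close>, so that the base element appears conjugated by \<open>?t\<close> in
    front of \<open>g\<close>.\<close>
  have "0 = (\<Sum>p<tdim l. \<Sum>a\<in>P. f (winv ?t \<star> Wr a id \<star> (?t \<star> g)) * tens l a $$ (p,p))"
    by (rule sum.neutral[symmetric]) (use base_sum_eq_0[OF E T ts z] t g in auto)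
  also have "\<dots> = (\<Sum>a\<in>P. f (winv ?t \<star> Wr a id \<star> (?t \<star> g)) * (\<Sum>p<tdim l. tens l a $$ (p,p)))"
    by (subst sum.swap) (simp only: sum_distrib_left)
  also have "\<dots> = (\<Sum>a\<in>P. f (Wr (?y a) id \<star> g) * (\<Prod>m\<in>N. ?c (v m) (?y a m)))"
  proof (rule sum.cong[OF refl])
    fix a assume a: "a \<in> P"
    have "winv ?t \<star> Wr a id \<star> (?t \<star> g) = Wr (?y a) id \<star> g"
      unfolding conj[OF a, symmetric] using a t g by (simp add: W.m_assoc permutes_id)
    moreover have "(\<Sum>p<tdim l. tens l a $$ (p,p)) = (\<Prod>m\<in>N. ?c (v m) (?y a m))"
    proof -
      have "(\<Prod>m\<in>N. ?c (v m) (?y a m)) = (\<Prod>m\<in>N. ?c (l (\<pi> m)) (a (\<pi> m)))"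
        by (rule prod.cong[OF refl]) (simp only: v(2) restrict_apply')
      also have "\<dots> = (\<Prod>i\<in>N. ?c (l i) (a i))"
        by (rule prod.reindex_bij_betw[OF permutes_imp_bij[OF v(1)], of "\<lambda>i. ?c (l i) (a i)"])
      finally show ?thesis using tens_trace[OF l a] by simp
    qed
    ultimately show "f (winv ?t \<star> Wr a id \<star> (?t \<star> g)) * (\<Sum>p<tdim l. tens l a $$ (p,p)) =
      f (Wr (?y a) id \<star> g) * (\<Prod>m\<in>N. ?c (v m) (?y a m))" by (simp only:)
  qed
  also have "\<dots> = (\<Sum>b\<in>P. f (Wr b id \<star> g) * (\<Prod>m\<in>N. ?c (v m) (b m)))"
  proof (rule sum.reindex_bij_betw[of ?y P P "\<lambda>b. f (Wr b id \<star> g) * (\<Prod>m\<in>N. ?c (v m) (b m))"])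
    have yP: "(\<lambda>i\<in>N. a (\<tau> i)) \<in> P" if "a \<in> P" "\<tau> permutes N" for a \<tau>
      unfolding restrict_PiE_iff using PiE_mem[OF that(1)] perm_in[OF that(2)] by blast
    have yy: "(\<lambda>i\<in>N. (\<lambda>i\<in>N. a (\<tau> i)) (\<tau>' i)) = a" if "a \<in> P" "\<tau>' permutes N" "\<And>i. \<tau> (\<tau>' i) = i" for a \<tau> \<tau>'
    proof -
      have "(\<lambda>i\<in>N. (\<lambda>i\<in>N. a (\<tau> i)) (\<tau>' i)) = restrict a N"
        by (rule restrict_ext) (simp only: restrict_apply' perm_in[OF that(2)] that(3))
      then show ?thesis using PiE_restrict[OF that(1)] by simp
    qed
    note inv = permutes_inv[OF v(1)]
    show "bij_betw ?y P P"
      by (rule bij_betw_byWitness[where f' = "\<lambda>b. \<lambda>i\<in>N. b (pinv \<pi> i)"])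
        (use yP[OF _ v(1)] yP[OF _ inv] yy[OF _ inv permutes_inverses(1)[OF v(1)]]
          yy[OF _ v(1) permutes_inverses(2)[OF v(1)]] in blast)+
  qed
  finally show ?thesis by simp
qed

text \<open>The indicator of the unit of G^n is the product over the coordinates of the indicators
  in G. Expanding each factor by \<open>traversal_delta\<close> and multiplying out yields one term
  for each labelling.\<close>

lemma base_delta:
  assumes b: "b \<in> P"
  shows "(\<Sum>v\<in>(\<Pi>\<^sub>E m\<in>N. {..<length \<rho>s}). (\<Prod>m\<in>N. of_nat (D (v m)) / of_nat (card (carrier G))) *
      (\<Prod>m\<in>N. \<Sum>r<D (v m). (\<rho>s ! v m) (b m) $$ (r,r))) = (if b = (\<lambda>i\<in>N. \<one>) then 1 else 0)" (is "?L = _")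
proof -
  let ?F = "\<lambda>m k. of_nat (D k) / of_nat (card (carrier G)) * (\<Sum>r<D k. (\<rho>s ! k) (b m) $$ (r,r))"
  have "?L = (\<Sum>v\<in>(\<Pi>\<^sub>E m\<in>N. {..<length \<rho>s}). \<Prod>m\<in>N. ?F m (v m))"
    by (simp only: prod.distrib)
  also have "\<dots> = (\<Prod>m\<in>N. \<Sum>k<length \<rho>s. ?F m k)"
    by (rule prod_sum_PiE[symmetric]) auto
  also have "\<dots> = (\<Prod>m\<in>N. if b m = \<one> then 1 else 0)"
    by (rule prod.cong[OF refl], rule G.traversal_delta[OF fin_G irreps D PiE_mem[OF b]])
  also have "\<dots> = (if b = (\<lambda>i\<in>N. \<one>) then 1 else 0)"
  proof (cases "b = (\<lambda>i\<in>N. \<one>)")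
    case False
    have "\<exists>m\<in>N. b m \<noteq> \<one>"
    proof (rule ccontr)
      assume "\<not> ?thesis"
      then have "restrict b N = (\<lambda>i\<in>N. \<one>)" by (intro restrict_ext) blast
      then show False using False PiE_restrict[OF b] by simp
    qed
    then have "(\<Prod>m\<in>N. if b m = \<one> then 1 else 0 :: complex) = 0" by (intro prod_zero) auto
    then show ?thesis unfolding if_not_P[OF False] .
  qed simp
  finally show ?thesis .
qed

lemma base_stable: "W.conj_stable base (stab_wreath l)"
  using finite_base subgroup_base base_subset base_normal by (simp add: W.conj_stable_def)

text \<open>Together, \<open>inj\<close> and \<open>surj\<close> say that \<open>lab\<close> selects
  exactly one labelling from each orbit of the symmetric group. The first separates the members with
  different \<alpha>, the second makes every term of the Fourier inversion on G^n available.\<close>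

lemma wreath_traversal_family:
  fixes A :: "'i set" and lab :: "'i \<Rightarrow> nat \<Rightarrow> nat"
  assumes E: "\<And>\<alpha>. \<alpha> \<in> A \<Longrightarrow> extends (lab \<alpha>) (E \<alpha>)"
    and T: "\<And>\<alpha>. \<alpha> \<in> A \<Longrightarrow> traversal (stab_group (lab \<alpha>)) (T \<alpha>)"
    and H: "\<And>\<alpha>. \<alpha> \<in> A \<Longrightarrow> carrier (H \<alpha>) = stab_wreath (lab \<alpha>)"
    and inj: "\<And>\<alpha> \<beta> \<pi>. \<alpha> \<in> A \<Longrightarrow> \<beta> \<in> A \<Longrightarrow> \<pi> permutes N \<Longrightarrow> (\<And>i. i \<in> N \<Longrightarrow> lab \<alpha> (\<pi> i) = lab \<beta> i) \<Longrightarrow> \<alpha> = \<beta>"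
    and surj: "\<And>v. v \<in> (\<Pi>\<^sub>E m\<in>N. {..<length \<rho>s}) \<Longrightarrow> \<exists>\<alpha>\<in>A. \<exists>\<pi>. \<pi> permutes N \<and> (\<forall>i\<in>N. v i = lab \<alpha> (\<pi> i))"
  shows "traversal_family W (SIGMA \<alpha>:A. T \<alpha>)
    (\<lambda>(\<alpha>, \<sigma>). induced_rep W (H \<alpha>) (tensor_inflate (E \<alpha>) \<sigma>))"
proof -
  let ?I = "SIGMA \<alpha>:A. T \<alpha>"
  have "\<exists>ts. W.left_transversal (stab_wreath (lab \<alpha>)) ts \<and> (\<forall>V d. dim_row (V \<one>\<^bsub>W\<^esub>) = d \<longrightarrow>
      induced_rep W (H \<alpha>) V = W.induced_mat ts (stab_wreath (lab \<alpha>)) d V)" if "\<alpha> \<in> A" for \<alpha>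
    using W.induced_rep_eq_induced_mat[OF subgroup_stab_wreath H[OF that] finite_W] by metis
  then obtain ts where ts: "\<And>\<alpha>. \<alpha> \<in> A \<Longrightarrow> W.left_transversal (stab_wreath (lab \<alpha>)) (ts \<alpha>)"
    and ind: "\<And>\<alpha> V d. \<alpha> \<in> A \<Longrightarrow> dim_row (V \<one>\<^bsub>W\<^esub>) = d \<Longrightarrow>
      induced_rep W (H \<alpha>) V = W.induced_mat (ts \<alpha>) (stab_wreath (lab \<alpha>)) d V"
    by metis
  define e where "e \<alpha> \<sigma> = (SOME e. group.irrep (stab_group (lab \<alpha>)) e \<sigma>)" for \<alpha> \<sigma>
  have e: "group.irrep (stab_group (lab \<alpha>)) (e \<alpha> \<sigma>) \<sigma>" if "\<alpha> \<in> A" "\<sigma> \<in> T \<alpha>" for \<alpha> \<sigma>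
    using group.traversal_dim[OF group_stab_group T[OF that(1)] that(2)] unfolding e_def by (metis someI)
  note sr = group.irrep_mat_rep[OF group_stab_group e]
  define d where "d \<alpha> \<sigma> = tdim (lab \<alpha>) * e \<alpha> \<sigma>" for \<alpha> \<sigma>
  define V where "V \<alpha> \<sigma> = W.induced_mat (ts \<alpha>) (stab_wreath (lab \<alpha>)) (d \<alpha> \<sigma>) (tensor_inflate (E \<alpha>) \<sigma>)" for \<alpha> \<sigma>
  have tr: "mat_rep (sub_wreath (lab \<alpha>)) (d \<alpha> \<sigma>) (tensor_inflate (E \<alpha>) \<sigma>)" if "\<alpha> \<in> A" "\<sigma> \<in> T \<alpha>" for \<alpha> \<sigma>
    unfolding d_def by (rule mat_rep_tensor_inflate[OF E[OF that(1)] sr[OF that]])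
  have V: "induced_rep W (H \<alpha>) (tensor_inflate (E \<alpha>) \<sigma>) = V \<alpha> \<sigma>" if "\<alpha> \<in> A" "\<sigma> \<in> T \<alpha>" for \<alpha> \<sigma>
  proof -
    have "tensor_inflate (E \<alpha>) \<sigma> \<one>\<^bsub>W\<^esub> = 1\<^sub>m (d \<alpha> \<sigma>)"
      using tr[OF that] by (simp add: W.mat_rep_subgroup_iff)
    then show ?thesis unfolding V_def by (intro ind[OF that(1)]) simp
  qed
  define dd where "dd = (\<lambda>(\<alpha>,\<sigma>). length (ts \<alpha>) * d \<alpha> \<sigma>)"
  let ?V = "\<lambda>(\<alpha>, \<sigma>). induced_rep W (H \<alpha>) (tensor_inflate (E \<alpha>) \<sigma>)"
  have tW: "ts \<alpha> ! j \<in> carrier W" if "\<alpha> \<in> A" "j < length (ts \<alpha>)" for \<alpha> j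
    using ts[OF that(1)] that(2) by (auto simp: W.left_transversal_def)
  have tsW: "\<exists>c \<pi>. ts \<alpha> ! j = Wr c \<pi> \<and> \<pi> permutes N" if "\<alpha> \<in> A" "j < length (ts \<alpha>)" for \<alpha> j
    using tW[OF that] by (auto simp: carrier_W)
  have tw_same: "W.twisted_orth base (d \<alpha> \<sigma>) (tensor_inflate (E \<alpha>) \<sigma>) (d \<alpha> \<tau>) (tensor_inflate (E \<alpha>) \<tau>) (ts \<alpha> ! j) (ts \<alpha> ! k)"
    if a: "\<alpha> \<in> A" "\<sigma> \<in> T \<alpha>" "\<tau> \<in> T \<alpha>" and j: "j < length (ts \<alpha>)" "k < length (ts \<alpha>)" "j \<noteq> k" for \<alpha> \<sigma> \<tau> j k
  proof -
    obtain c \<pi> c' \<pi>' where t: "ts \<alpha> ! j = Wr c \<pi>" "ts \<alpha> ! k = Wr c' \<pi>'" using tsW a j by metis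
    obtain m where m: "m \<in> N" "lab \<alpha> (pinv \<pi> m) \<noteq> lab \<alpha> (pinv \<pi>' m)"
      using label_distinct_cosets[OF ts[OF a(1)] j t] by blast
    show ?thesis unfolding d_def t
      by (rule tensor_inflate_twisted_orth[OF E[OF a(1)] E[OF a(1)] sr[OF a(1,2)] sr[OF a(1,3)] _ _ m])
        (use tW[OF a(1) j(1)] tW[OF a(1) j(2)] t in simp_all)
  qed
  have tw_diff: "W.twisted_orth base (d \<alpha> \<sigma>) (tensor_inflate (E \<alpha>) \<sigma>) (d \<beta> \<tau>) (tensor_inflate (E \<beta>) \<tau>) (ts \<alpha> ! j) (ts \<beta> ! k)"
    if a: "\<alpha> \<in> A" "\<sigma> \<in> T \<alpha>" and b: "\<beta> \<in> A" "\<tau> \<in> T \<beta>" and ab: "\<alpha> \<noteq> \<beta>"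
      and j: "j < length (ts \<alpha>)" "k < length (ts \<beta>)" for \<alpha> \<sigma> \<beta> \<tau> j k
  proof -
    obtain c \<pi> where t: "ts \<alpha> ! j = Wr c \<pi>" "\<pi> permutes N" using tsW a j by metis
    obtain c' \<pi>' where t': "ts \<beta> ! k = Wr c' \<pi>'" "\<pi>' permutes N" using tsW b j by metis
    have "\<exists>m\<in>N. lab \<alpha> (pinv \<pi> m) \<noteq> lab \<beta> (pinv \<pi>' m)"
    proof (rule ccontr)
      assume "\<not> ?thesis"
      then have eq: "lab \<alpha> (pinv \<pi> m) = lab \<beta> (pinv \<pi>' m)" if "m \<in> N" for m using that by blast
      have "\<alpha> = \<beta>"
        by (rule inj[OF a(1) b(1) permutes_compose[OF t'(2) permutes_inv[OF t(2)]] stab_of_label_eq[where l = "lab \<alpha>" and l' = "lab \<beta>", OF t(2) t'(2) eq]])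
      then show False using ab by simp
    qed
    then obtain m where m: "m \<in> N" "lab \<alpha> (pinv \<pi> m) \<noteq> lab \<beta> (pinv \<pi>' m)" by blast
    show ?thesis unfolding d_def t t'
      by (rule tensor_inflate_twisted_orth[OF E[OF a(1)] E[OF b(1)] sr[OF a] sr[OF b] _ _ m])
        (use tW[OF a(1) j(1)] tW[OF b(1) j(2)] t t' in simp_all)
  qed
  \<comment> \<open>A non-zero \<open>c\<close> serves the case \<sigma> = \<tau>, while
    \<open>c = 0\<close> serves two different members of \<open>T \<alpha>\<close>, possibly of
    different degrees.\<close>
  have same: "W.coeff_sum (V \<alpha> \<sigma>) (i,j) (V \<alpha> \<tau>) (k,m) = (if i = m \<and> j = k then tconst (lab \<alpha>) * c else 0)"
    if a: "\<alpha> \<in> A" "\<sigma> \<in> T \<alpha>" "\<tau> \<in> T \<alpha>" and c: "c = 0 \<or> e \<alpha> \<sigma> = e \<alpha> \<tau>"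
      and s: "\<And>p q r s. p < e \<alpha> \<sigma> \<Longrightarrow> q < e \<alpha> \<sigma> \<Longrightarrow> r < e \<alpha> \<tau> \<Longrightarrow> s < e \<alpha> \<tau> \<Longrightarrow>
        group.coeff_sum (stab_group (lab \<alpha>)) \<sigma> (p,q) \<tau> (r,s) = (if p = s \<and> q = r then c else 0)"
      and i: "i < length (ts \<alpha>) * d \<alpha> \<sigma>" "j < length (ts \<alpha>) * d \<alpha> \<sigma>" "k < length (ts \<alpha>) * d \<alpha> \<tau>" "m < length (ts \<alpha>) * d \<alpha> \<tau>"
    for \<alpha> \<sigma> \<tau> c i j k m
    unfolding V_def
  proof (rule W.induced_same_orth[OF subgroup_stab_wreath ts[OF a(1)] tr[OF a(1,2)] tr[OF a(1,3)] finite_W base_stable tw_same[OF a] _ _ i])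
    show "tconst (lab \<alpha>) * c = 0 \<or> d \<alpha> \<sigma> = d \<alpha> \<tau>" using c by (auto simp: d_def)
    fix p q r s' assume "p < d \<alpha> \<sigma>" "q < d \<alpha> \<sigma>" "r < d \<alpha> \<tau>" "s' < d \<alpha> \<tau>"
    note p = this[unfolded d_def]
    note b = div_mod_bounds[OF p(1)] div_mod_bounds[OF p(2)] div_mod_bounds[OF p(3)] div_mod_bounds[OF p(4)]
    have eq: "x = y \<longleftrightarrow> x div e \<alpha> \<sigma> = y div e \<alpha> \<sigma> \<and> x mod e \<alpha> \<sigma> = y mod e \<alpha> \<sigma>" for x y :: nat
      by (metis div_mult_mod_eq)
    have se: "(\<Sum>\<pi>\<in>stab n (lab \<alpha>). \<sigma> \<pi> $$ (p mod e \<alpha> \<sigma>, q mod e \<alpha> \<sigma>) *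
        \<tau> (inv\<^bsub>stab_group (lab \<alpha>)\<^esub> \<pi>) $$ (r mod e \<alpha> \<tau>, s' mod e \<alpha> \<tau>)) =
      (if p mod e \<alpha> \<sigma> = s' mod e \<alpha> \<tau> \<and> q mod e \<alpha> \<sigma> = r mod e \<alpha> \<tau> then c else 0)"
      using s[of "p mod e \<alpha> \<sigma>" "q mod e \<alpha> \<sigma>" "r mod e \<alpha> \<tau>" "s' mod e \<alpha> \<tau>"] b by simp
    show "(\<Sum>h\<in>stab_wreath (lab \<alpha>). tensor_inflate (E \<alpha>) \<sigma> h $$ (p,q) * tensor_inflate (E \<alpha>) \<tau> (winv h) $$ (r,s')) =
      (if p = s' \<and> q = r then tconst (lab \<alpha>) * c else 0)"
    proof (cases "c = 0")
      case True
      then show ?thesis unfolding tensor_inflate_coeff[OF E[OF a(1)] sr[OF a(1,2)] sr[OF a(1,3)] p] se by simp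
    next
      case False
      then have "e \<alpha> \<tau> = e \<alpha> \<sigma>" using c by simp
      then show ?thesis
        unfolding tensor_inflate_coeff[OF E[OF a(1)] sr[OF a(1,2)] sr[OF a(1,3)] p] se
        using eq[of p s'] eq[of q r] by simp
    qed
  qed
  show ?thesis
  proof (rule W.traversal_familyI[OF finite_W, where D = dd])
    fix i assume "i \<in> ?I"
    then obtain \<alpha> \<sigma> where i: "i = (\<alpha>,\<sigma>)" "\<alpha> \<in> A" "\<sigma> \<in> T \<alpha>" by blast
    interpret S: group "stab_group (lab \<alpha>)" by (rule group_stab_group)
    have "ts \<alpha> \<noteq> []"
      using ts[OF i(2)] W.one_closed unfolding W.left_transversal_def by fastforce
    moreover have "e \<alpha> \<sigma> > 0" by (rule S.irrep_dim_pos[OF e[OF i(2,3)]])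
    moreover have "tdim (lab \<alpha>) > 0"
    proof -
      have "0 \<notin> set (dims (lab \<alpha>))"
      proof
        assume "0 \<in> set (dims (lab \<alpha>))"
        then obtain k where k: "k < n" "D (lab \<alpha> (Suc k)) = 0" by (auto simp: dims_def)
        then have "lab \<alpha> (Suc k) < length \<rho>s" using E[OF i(2)] by (auto simp: extends_def)
        then show False using G.irrep_dim_pos[OF D] k by fastforce
      qed
      then have "tdim (lab \<alpha>) \<noteq> 0" by (simp only: prod_list_zero_iff not_False_eq_True)
      then show ?thesis by (simp only: neq0_conv)
    qed
    ultimately show "dd i > 0" by (simp add: dd_def d_def i)
    show "mat_rep W (dd i) (?V i)"
      unfolding i dd_def prod.case V[OF i(2,3)] unfolding V_def
      by (rule W.mat_rep_induced_mat[OF subgroup_stab_wreath ts[OF i(2)] tr[OF i(2,3)]])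
    obtain c where c: "c \<noteq> 0" and s: "\<And>p q r s. p < e \<alpha> \<sigma> \<Longrightarrow> q < e \<alpha> \<sigma> \<Longrightarrow> r < e \<alpha> \<sigma> \<Longrightarrow> s < e \<alpha> \<sigma> \<Longrightarrow>
      S.coeff_sum \<sigma> (p,q) \<sigma> (r,s) = (if p = s \<and> q = r then c else 0)"
      using S.irrep_self_orth[OF e[OF i(2,3)]] finite_stab[of "lab \<alpha>"] unfolding S.self_orth_def by auto
    have "tconst (lab \<alpha>) * c \<noteq> 0" using c tconst_nonzero E[OF i(2)] by (simp add: extends_def)
    then show "W.self_orth (dd i) (?V i)"
      unfolding i dd_def prod.case V[OF i(2,3)] W.self_orth_def
      by (intro exI[of _ "tconst (lab \<alpha>) * c"] conjI allI impI, assumption) (rule same[OF i(2,3,3) disjI2[OF refl] s])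
  next
    fix i j assume "i \<in> ?I" "j \<in> ?I" and ij: "i \<noteq> j"
    then obtain \<alpha> \<sigma> \<beta> \<tau> where i: "i = (\<alpha>,\<sigma>)" "\<alpha> \<in> A" "\<sigma> \<in> T \<alpha>" and j: "j = (\<beta>,\<tau>)" "\<beta> \<in> A" "\<tau> \<in> T \<beta>" by blast
    show "W.coeff_orth (dd i) (?V i) (dd j) (?V j)"
    proof (cases "\<alpha> = \<beta>")
      case False
      show ?thesis
        unfolding i(1) j(1) dd_def prod.case V[OF i(2,3)] V[OF j(2,3)] unfolding V_def
        by (rule W.induced_coeff_orth[OF subgroup_stab_wreath ts[OF i(2)] tr[OF i(2,3)]
              subgroup_stab_wreath ts[OF j(2)] tr[OF j(2,3)] base_stable base_stable])
          (use tw_diff[OF i(2,3) j(2,3) False] in auto)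
    next
      case True
      interpret S: group "stab_group (lab \<alpha>)" by (rule group_stab_group)
      have t: "\<tau> \<in> T \<alpha>" using j True by simp
      have "\<sigma> \<noteq> \<tau>" using ij i(1) j(1) True by simp
      then have o: "S.coeff_orth (e \<alpha> \<sigma>) \<sigma> (e \<alpha> \<tau>) \<tau>"
        by (rule S.traversal_coeff_orth[OF T[OF i(2)] i(3) t _ e[OF i(2,3)] e[OF i(2) t]])
      then show ?thesis
        unfolding i(1) j(1) dd_def prod.case True[symmetric] V[OF i(2,3)] V[OF i(2) t] W.coeff_orth_def
        using same[OF i(2,3) t disjI1[OF refl]] by (simp add: S.coeff_orth_def)
    qed
  next
    fix f g assume z: "\<And>i. i \<in> ?I \<Longrightarrow> W.rep_sum (dd i) (?V i) f = 0\<^sub>m (dd i) (dd i)" and g: "g \<in> carrier W"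
    let ?Q = "\<Pi>\<^sub>E m\<in>N. {..<length \<rho>s}"
    let ?c = "\<lambda>v. \<Prod>m\<in>N. of_nat (D (v m)) / of_nat (card (carrier G)) :: complex"
    let ?X = "\<lambda>v b. \<Prod>m\<in>N. \<Sum>r<D (v m). (\<rho>s ! v m) (b m) $$ (r,r)"
    have 0: "(\<Sum>b\<in>P. f (Wr b id \<star> g) * ?X v b) = 0" if v: "v \<in> ?Q" for v
    proof -
      obtain \<alpha> \<pi> where a: "\<alpha> \<in> A" "\<pi> permutes N" "\<And>m. m \<in> N \<Longrightarrow> v m = lab \<alpha> (\<pi> m)"
        using surj[OF v] by blast
      interpret S: group "stab_group (lab \<alpha>)" by (rule group_stab_group)
      show ?thesis
      proof (rule trace_sum_eq_0[OF E[OF a(1)] T[OF a(1)] ts[OF a(1)] _ a(2,3) g])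
        fix \<sigma> e' assume s: "\<sigma> \<in> T \<alpha>" and e': "S.irrep e' \<sigma>"
        have ee: "e' = e \<alpha> \<sigma>" by (rule S.mat_rep_dim_unique[OF S.irrep_mat_rep[OF e'] sr[OF a(1) s]])
        have "(\<alpha>,\<sigma>) \<in> ?I" using a(1) s by simp
        from z[OF this] show "W.rep_sum (length (ts \<alpha>) * (tdim (lab \<alpha>) * e'))
          (W.induced_mat (ts \<alpha>) (stab_wreath (lab \<alpha>)) (tdim (lab \<alpha>) * e') (tensor_inflate (E \<alpha>) \<sigma>)) f
          = 0\<^sub>m (length (ts \<alpha>) * (tdim (lab \<alpha>) * e')) (length (ts \<alpha>) * (tdim (lab \<alpha>) * e'))"
          unfolding dd_def prod.case V[OF a(1) s] unfolding V_def d_def ee .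
      qed
    qed
    \<comment> \<open>The translate of \<open>f\<close> by \<open>g\<close> is restricted to the
      base group and evaluated at its unit, where \<open>base_delta\<close> expands the
      value.\<close>
    have "f g = (\<Sum>b\<in>P. if b = (\<lambda>i\<in>N. \<one>) then f (Wr b id \<star> g) else 0)"
      using one_in_P finite_P W.l_one[OF g] by (simp add: sum.delta wreath_one_eq)
    also have "\<dots> = (\<Sum>b\<in>P. f (Wr b id \<star> g) * (if b = (\<lambda>i\<in>N. \<one>) then 1 else 0))"
      by (rule sum.cong[OF refl]) simp
    also have "\<dots> = (\<Sum>b\<in>P. \<Sum>v\<in>?Q. ?c v * (f (Wr b id \<star> g) * ?X v b))"
    proof (rule sum.cong[OF refl])
      fix b assume b: "b \<in> P"
      show "f (Wr b id \<star> g) * (if b = (\<lambda>i\<in>N. \<one>) then 1 else 0) = (\<Sum>v\<in>?Q. ?c v * (f (Wr b id \<star> g) * ?X v b))"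
        unfolding base_delta[OF b, symmetric] sum_distrib_left by (rule sum.cong[OF refl]) (simp only: mult_ac)
    qed
    also have "\<dots> = (\<Sum>v\<in>?Q. \<Sum>b\<in>P. ?c v * (f (Wr b id \<star> g) * ?X v b))" by (rule sum.swap)
    also have "\<dots> = (\<Sum>v\<in>?Q. 0)"
    proof (rule sum.cong[OF refl])
      fix v assume v: "v \<in> ?Q"
      show "(\<Sum>b\<in>P. ?c v * (f (Wr b id \<star> g) * ?X v b)) = 0"
        unfolding sum_distrib_left[symmetric] 0[OF v] by simp
    qed
    finally show "f g = 0" by simp
  qed
qed

end

section \<open>Young subgroups as stabilisers of labellings\<close>

lemma block_Cons_0 [simp]: "block (a # \<alpha>) 0 = {0<..a}"
  by (simp add: block_def)

lemma mem_block_Cons_Suc [simp]: "j \<in> block (a # \<alpha>) (Suc k) \<longleftrightarrow> a < j \<and> j - a \<in> block \<alpha> k"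
  by (auto simp: block_def)

lemma ex_block:
  "j < sum_list \<alpha> \<Longrightarrow> \<exists>k<length \<alpha>. Suc j \<in> block \<alpha> k"
proof (induction \<alpha> arbitrary: j)
  case (Cons a \<alpha>)
  show ?case
  proof (cases "j < a")
    case True
    then have "Suc j \<in> block (a # \<alpha>) 0" by simp
    then show ?thesis by (intro exI[of _ 0]) simp
  next
    case False
    then have "j - a < sum_list \<alpha>" using Cons.prems by auto
    then obtain k where "k < length \<alpha>" "Suc (j - a) \<in> block \<alpha> k" using Cons.IH by blast
    then have "Suc k < length (a # \<alpha>)" "Suc j \<in> block (a # \<alpha>) (Suc k)" using False by (auto simp: Suc_diff_le)
    then show ?thesis by blast
  qed
qed simp

lemma block_less: "j \<in> block \<alpha> k \<Longrightarrow> k < length \<alpha> \<Longrightarrow> 0 < j \<and> j \<le> sum_list \<alpha>"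
proof (induction \<alpha> arbitrary: j k)
  case (Cons a \<alpha>)
  show ?case
  proof (cases k)
    case 0
    then show ?thesis using Cons.prems by auto
  next
    case (Suc k')
    then have "a < j" "j - a \<le> sum_list \<alpha>" using Cons.IH[of "j - a" k'] Cons.prems by auto
    then show ?thesis by auto
  qed
qed simp

lemma card_block: "k < length \<alpha> \<Longrightarrow> card (block \<alpha> k) = \<alpha> ! k"
  by (simp add: block_def take_Suc_conv_app_nth)

text \<open>Stated for arbitrary entries because it is applied both to the block numbers and to the
  representations. Blocks consist of numbers from 1 on, hence \<open>Suc j\<close> for list position
  \<open>j\<close>.\<close>

lemma concat_replicate_nth:
  "length xs = length \<alpha> \<Longrightarrow> k < length \<alpha> \<Longrightarrow> Suc j \<in> block \<alpha> k \<Longrightarrow>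
    concat (map2 (\<lambda>x m. replicate m x) xs \<alpha>) ! j = xs ! k"
proof (induction \<alpha> arbitrary: xs j k)
  case (Cons a \<alpha>)
  then obtain x xs' where xs: "xs = x # xs'" by (cases xs) auto
  show ?case
  proof (cases k)
    case 0
    then show ?thesis using Cons.prems by (simp add: xs nth_append)
  next
    case (Suc k')
    then have "a \<le> j" "Suc (j - a) \<in> block \<alpha> k'" using Cons.prems by (auto simp: Suc_diff_le)
    then show ?thesis using Cons.IH[of xs' k' "j - a"] Cons.prems Suc by (simp add: xs nth_append)
  qed
qed simp

lemma length_concat_replicate:
  "length xs = length \<alpha> \<Longrightarrow> length (concat (map2 (\<lambda>x m. replicate m x) xs \<alpha>)) = sum_list \<alpha>"
  by (induction xs \<alpha> rule: list_induct2) auto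

text \<open>The same concatenation as in \<open>young_tensor\<close>, applied to the block numbers;
  this makes the tensor factor in position \<open>i\<close> the representation with index
  \<open>block_label \<alpha> i\<close>.\<close>

definition block_label :: "nat list \<Rightarrow> nat \<Rightarrow> nat" where
  "block_label \<alpha> i = concat (map2 (\<lambda>x m. replicate m x) [0..<length \<alpha>] \<alpha>) ! (i - 1)"

lemma block_label_iff:
  assumes i: "i \<in> {1..sum_list \<alpha>}" and k: "k < length \<alpha>"
  shows "i \<in> block \<alpha> k \<longleftrightarrow> block_label \<alpha> i = k"
proof -
  obtain j where j: "i = Suc j" "j < sum_list \<alpha>" using i by (cases i) auto
  have 1: "block_label \<alpha> i = k'" if "k' < length \<alpha>" "i \<in> block \<alpha> k'" for k'
    using concat_replicate_nth[of "[0..<length \<alpha>]" \<alpha> k' j] that j by (simp add: block_label_def)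
  obtain k' where "k' < length \<alpha>" "i \<in> block \<alpha> k'" using ex_block[OF j(2)] j by blast
  then show ?thesis using 1 k by blast
qed

lemma block_label_less:
  assumes i: "i \<in> {1..sum_list \<alpha>}"
  shows "block_label \<alpha> i < length \<alpha>"
proof -
  obtain j where j: "i = Suc j" "j < sum_list \<alpha>" using i by (cases i) auto
  obtain k where "k < length \<alpha>" "i \<in> block \<alpha> k" using ex_block[OF j(2)] j by blast
  then show ?thesis using block_label_iff[OF i] by blast
qed

lemma block_eq_label:
  assumes "k < length \<alpha>"
  shows "block \<alpha> k = {i \<in> {1..sum_list \<alpha>}. block_label \<alpha> i = k}"
  using block_label_iff[of _ \<alpha> k] block_less[of _ \<alpha> k] assms by fastforce

text \<open>The blocks are the fibres of \<open>block_label\<close>. A permutation that keeps labels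
  maps each fibre into itself, and by finiteness onto itself.\<close>

lemma carrier_young_group: "carrier (young_group \<alpha>) = stab (sum_list \<alpha>) (block_label \<alpha>)"
proof (intro equalityI subsetI)
  fix \<pi> assume "\<pi> \<in> carrier (young_group \<alpha>)"
  then have p: "\<pi> permutes {1..sum_list \<alpha>}" and b: "\<And>k. k < length \<alpha> \<Longrightarrow> \<pi> ` block \<alpha> k = block \<alpha> k"
    by (auto simp: young_group_def)
  have "block_label \<alpha> (\<pi> i) = block_label \<alpha> i" if i: "i \<in> {1..sum_list \<alpha>}" for i
  proof -
    note k = block_label_less[OF i]
    have "i \<in> block \<alpha> (block_label \<alpha> i)" using block_label_iff[OF i k] by simp
    then have "\<pi> i \<in> block \<alpha> (block_label \<alpha> i)" using b[OF k] by blast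
    then show ?thesis using block_eq_label[OF k] by blast
  qed
  then show "\<pi> \<in> stab (sum_list \<alpha>) (block_label \<alpha>)" using p by (simp add: stab_def)
next
  fix \<pi> assume s: "\<pi> \<in> stab (sum_list \<alpha>) (block_label \<alpha>)"
  then have p: "\<pi> permutes {1..sum_list \<alpha>}" by (simp add: stab_def)
  have "\<pi> ` block \<alpha> k = block \<alpha> k" if k: "k < length \<alpha>" for k
  proof (rule card_subset_eq)
    show "finite (block \<alpha> k)" by (simp add: block_def)
    show "\<pi> ` block \<alpha> k \<subseteq> block \<alpha> k"
    proof (rule image_subsetI)
      fix i assume "i \<in> block \<alpha> k"
      then have i: "i \<in> {1..sum_list \<alpha>}" "block_label \<alpha> i = k" using block_eq_label[OF k] by blast+
      then have "block_label \<alpha> (\<pi> i) = k" using s unfolding stab_def by blast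
      moreover have "\<pi> i \<in> {1..sum_list \<alpha>}" using permutes_in_image[OF p, of i] i(1) by blast
      ultimately show "\<pi> i \<in> block \<alpha> k" using block_eq_label[OF k] by blast
    qed
    show "card (\<pi> ` block \<alpha> k) = card (block \<alpha> k)"
      by (rule card_image) (rule inj_on_subset[OF permutes_inj[OF p] subset_UNIV])
  qed
  then show "\<pi> \<in> carrier (young_group \<alpha>)" using p by (simp add: young_group_def)
qed

lemma young_tensor_block_label:
  assumes "length \<rho>s = length \<alpha>"
  shows "young_tensor \<rho>s \<alpha> = outer_tensor (map (\<lambda>i. \<rho>s ! block_label \<alpha> (Suc i)) [0..<sum_list \<alpha>])"
proof -
  have "concat (map2 (\<lambda>\<rho> m. replicate m \<rho>) \<rho>s \<alpha>) = map (\<lambda>i. \<rho>s ! block_label \<alpha> (Suc i)) [0..<sum_list \<alpha>]"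
  proof (rule nth_equalityI)
    fix j assume "j < length (concat (map2 (\<lambda>\<rho> m. replicate m \<rho>) \<rho>s \<alpha>))"
    then have j: "j < sum_list \<alpha>" using length_concat_replicate[OF assms] by simp
    obtain k where k: "k < length \<alpha>" "Suc j \<in> block \<alpha> k" using ex_block[OF j] by blast
    have "block_label \<alpha> (Suc j) = k" using block_label_iff[of "Suc j" \<alpha> k] j k by simp
    then show "concat (map2 (\<lambda>\<rho> m. replicate m \<rho>) \<rho>s \<alpha>) ! j = map (\<lambda>i. \<rho>s ! block_label \<alpha> (Suc i)) [0..<sum_list \<alpha>] ! j"
      using concat_replicate_nth[OF assms k] j by simp
  qed (simp add: length_concat_replicate[OF assms])
  then show ?thesis by (simp add: young_tensor_def)
qed

text \<open>The permutation maps each block of \<beta> onto the block of \<alpha> with the same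
  number, and the parts of a composition are the sizes of its blocks.\<close>

lemma block_label_inject:
  assumes a: "length \<alpha> = h" "sum_list \<alpha> = n" and b: "length \<beta> = h" "sum_list \<beta> = n"
    and p: "\<pi> permutes {1..n}" and eq: "\<And>i. i \<in> {1..n} \<Longrightarrow> block_label \<alpha> (\<pi> i) = block_label \<beta> i"
  shows "\<alpha> = \<beta>"
proof (rule nth_equalityI)
  fix k assume "k < length \<alpha>"
  then have k: "k < length \<alpha>" "k < length \<beta>" using a b by auto
  have "\<pi> ` block \<beta> k = block \<alpha> k"
  proof (intro equalityI subsetI)
    fix x assume "x \<in> \<pi> ` block \<beta> k"
    then obtain i where i: "x = \<pi> i" "i \<in> {1..n}" "block_label \<beta> i = k"
      unfolding block_eq_label[OF k(2)] b(2) by blast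
    have "\<pi> i \<in> {1..n}" using permutes_in_image[OF p, of i] i by blast
    then show "x \<in> block \<alpha> k" unfolding block_eq_label[OF k(1)] a(2) using i eq[OF i(2)] by simp
  next
    fix x assume "x \<in> block \<alpha> k"
    then have x: "x \<in> {1..n}" "block_label \<alpha> x = k" unfolding block_eq_label[OF k(1)] a(2) by blast+
    obtain i where i: "x = \<pi> i" using permutes_surj[OF p] by blast
    then have "i \<in> {1..n}" using permutes_in_image[OF p, of i] x by simp
    then show "x \<in> \<pi> ` block \<beta> k" unfolding block_eq_label[OF k(2)] b(2) using i x eq[of i] by auto
  qed
  then have "card (block \<alpha> k) = card (block \<beta> k)"
    using card_image[OF inj_on_subset[OF permutes_inj[OF p] subset_UNIV], of "block \<beta> k"] by simp
  then show "\<alpha> ! k = \<beta> ! k" using card_block k by simp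
qed (use a b in simp)

text \<open>Let \<alpha> count how often each label occurs in \<open>v\<close>. Then
  \<open>v\<close> and \<open>block_label \<alpha>\<close> take the same values with the same
  multiplicities, and so differ by a permutation of the positions.\<close>

lemma ex_block_label:
  assumes v: "\<And>i. i \<in> {1..n} \<Longrightarrow> v i < h"
  shows "\<exists>\<alpha>\<in>weak_compositions h n. \<exists>\<pi>. \<pi> permutes {1..n} \<and> (\<forall>i\<in>{1..n}. v i = block_label \<alpha> (\<pi> i))"
proof -
  define \<alpha> where "\<alpha> = map (\<lambda>k. card {i \<in> {1..n}. v i = k}) [0..<h]"
  have len: "length \<alpha> = h" by (simp add: \<alpha>_def)
  have "sum_list \<alpha> = (\<Sum>k<h. card {i \<in> {1..n}. v i = k})"
    by (simp add: \<alpha>_def interv_sum_list_conv_sum_set_nat atLeast0LessThan)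
  also have "\<dots> = card (\<Union>k<h. {i \<in> {1..n}. v i = k})"
    by (rule card_UN_disjoint[symmetric]) auto
  also have "(\<Union>k<h. {i \<in> {1..n}. v i = k}) = {1..n}" using v by auto
  finally have sum: "sum_list \<alpha> = n" by simp
  have cnt: "count (image_mset f (mset_set {1..n})) k = card {i \<in> {1..n}. f i = k}" for f :: "nat \<Rightarrow> nat" and k
  proof -
    have "f -` {k} \<inter> {1..n} = {i \<in> {1..n}. f i = k}" by blast
    then show ?thesis by (simp add: count_image_mset)
  qed
  have "image_mset v (mset_set {1..n}) = image_mset (block_label \<alpha>) (mset_set {1..n})"
  proof (rule multiset_eqI, unfold cnt)
    fix k
    show "card {i \<in> {1..n}. v i = k} = card {i \<in> {1..n}. block_label \<alpha> i = k}"
    proof (cases "k < h")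
      case True
      then show ?thesis using card_block[of k \<alpha>] block_eq_label[of k \<alpha>] len sum by (simp add: \<alpha>_def)
    next
      case False
      have "{i \<in> {1..n}. v i = k} = {}" using False v by auto
      moreover have "{i \<in> {1..n}. block_label \<alpha> i = k} = {}"
        using False block_label_less[of _ \<alpha>] len sum by auto
      ultimately show ?thesis by (simp only: card.empty)
    qed
  qed
  then obtain \<pi> where "\<pi> permutes {1..n}" "\<forall>i\<in>{1..n}. v i = block_label \<alpha> (\<pi> i)"
    by (rule image_mset_eq_implies_permutes[rotated]) auto
  then show ?thesis using len sum by (auto simp: weak_compositions_def)
qed

text \<open>Formulated for every finite group over \<open>wreath_elem\<close>, so that subgroups of
  symmetric groups and iterated wreath products are both instances.\<close>

theorem wreath_traversal:
  fixes G :: "wreath_elem monoid"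
  assumes G: "group G" "finite (carrier G)" and R: "traversal_family G {..<length \<rho>s} (\<lambda>i. \<rho>s ! i)"
    and E: "\<forall>\<alpha>\<in>weak_compositions (length \<rho>s) n. is_extension G \<rho>s \<alpha> (E \<alpha>)"
    and T: "\<forall>\<alpha>\<in>weak_compositions (length \<rho>s) n. traversal (young_group \<alpha>) (T \<alpha>)"
  shows "traversal_family (wreath G n (sym_group n))
        (SIGMA \<alpha>:weak_compositions (length \<rho>s) n. T \<alpha>)
        (\<lambda>(\<alpha>, \<sigma>). induced_rep (wreath G n (sym_group n)) (wreath G n (young_group \<alpha>))
                    (inner_tensor (E \<alpha>) (inflate \<sigma>)))"
proof -
  interpret G: group G by (rule G(1))
  have "\<exists>d. G.irrep d (\<rho>s ! k)" if "k < length \<rho>s" for k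
    using R that unfolding traversal_family_def traversal_def G.irreducible_rep_iff by blast
  then obtain D where D: "\<And>k. k < length \<rho>s \<Longrightarrow> G.irrep (D k) (\<rho>s ! k)" by metis
  interpret wreath_irreps G n \<rho>s D
    by unfold_locales (use G(2) R D in auto)
  let ?A = "weak_compositions (length \<rho>s) n"
  have A: "length \<alpha> = length \<rho>s" "sum_list \<alpha> = n" if "\<alpha> \<in> ?A" for \<alpha>
    using that by (auto simp: weak_compositions_def)
  have Y: "young_group \<alpha> = stab_group (block_label \<alpha>)" if "\<alpha> \<in> ?A" for \<alpha>
    using carrier_young_group[of \<alpha>] A[OF that] by (simp add: young_group_def)
  have cH: "carrier (wreath G n (young_group \<alpha>)) = stab_wreath (block_label \<alpha>)" if "\<alpha> \<in> ?A" for \<alpha>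
    using carrier_young_group[of \<alpha>] A[OF that] by (simp add: carrier_wreath stab_wreath_def)
  show ?thesis
  proof (rule wreath_traversal_family[where lab = block_label])
    fix \<alpha> assume a: "\<alpha> \<in> ?A"
    note A' = A[OF a]
    show "carrier (wreath G n (young_group \<alpha>)) = stab_wreath (block_label \<alpha>)" by (rule cH[OF a])
    show "traversal (stab_group (block_label \<alpha>)) (T \<alpha>)" using bspec[OF T a] unfolding Y[OF a] .
    have lab: "labelling (block_label \<alpha>)" using block_label_less[of _ \<alpha>] A' by simp
    have tens: "young_tensor \<rho>s \<alpha> = tens (block_label \<alpha>)"
      using young_tensor_block_label[of \<rho>s \<alpha>] A' by (simp add: tens_def)
    obtain d where d: "representation (wreath G n (young_group \<alpha>)) d (E \<alpha>)"
      and ext: "\<And>a. a \<in> P \<Longrightarrow> E \<alpha> (Wr a id) = tens (block_label \<alpha>) a"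
      using E a A' tens by (auto simp: is_extension_def)
    have sub: "wreath G n (young_group \<alpha>) = sub_wreath (block_label \<alpha>)"
      using wreath_subgroup_eq[of G n "young_group \<alpha>" "sym_group n"] cH[OF a] by simp
    interpret H: group "sub_wreath (block_label \<alpha>)"
      by (rule subgroup.subgroup_is_group[OF subgroup_stab_wreath group_W])
    have dr: "mat_rep (sub_wreath (block_label \<alpha>)) d (E \<alpha>)" using d unfolding sub H.representation_iff .
    \<comment> \<open>\<open>is_extension\<close> leaves the degree open; comparing the two
      descriptions of the value at the unit fixes it.\<close>
    have "E \<alpha> \<one>\<^bsub>W\<^esub> = tens (block_label \<alpha>) (\<lambda>i\<in>N. \<one>\<^bsub>G\<^esub>)" using ext[OF one_in_P] by (simp add: wreath_one_eq)
    then have "(1\<^sub>m d :: complex mat) \<in> carrier_mat (tdim (block_label \<alpha>)) (tdim (block_label \<alpha>))"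
      using tens_carrier[OF lab one_in_P] dr by (simp add: W.mat_rep_subgroup_iff)
    then have "d = tdim (block_label \<alpha>)" by auto
    then show "extends (block_label \<alpha>) (E \<alpha>)" using lab dr ext by (simp add: extends_def)
  next
    fix \<alpha> \<beta> \<pi> assume "\<alpha> \<in> ?A" "\<beta> \<in> ?A" "\<pi> permutes N" "\<And>i. i \<in> N \<Longrightarrow> block_label \<alpha> (\<pi> i) = block_label \<beta> i"
    then show "\<alpha> = \<beta>" using block_label_inject[OF A A, of \<alpha> \<beta> \<pi>] by blast
  next
    fix v assume v: "v \<in> (\<Pi>\<^sub>E m\<in>N. {..<length \<rho>s})"
    show "\<exists>\<alpha>\<in>?A. \<exists>\<pi>. \<pi> permutes N \<and> (\<forall>i\<in>N. v i = block_label \<alpha> (\<pi> i))"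
      by (rule ex_block_label) (use PiE_mem[OF v] in simp)
  qed
qed

section \<open>The two families of finite groups in the theorem\<close>

lemma group_base_sym_group: "group (base_sym_group N)"
proof -
  interpret S: group "sym_group N" by (rule sym_group_is_group)
  have inj: "inj_on Perm (carrier (sym_group N))" by (auto simp: inj_on_def)
  show ?thesis unfolding base_sym_group_def by (rule S.inj_imp_image_group_is_group[OF inj])
qed

lemma finite_base_sym_group: "finite (carrier (base_sym_group N))"
  by (simp add: base_sym_group_def image_group_carrier sym_group_def finite_permutations)

lemma iterated_wreath_group: "group (iterated_wreath r k) \<and> finite (carrier (iterated_wreath r k))"
proof (induction k)
  case 0
  have "group (iterated_wreath r 0)" by (rule groupI) auto
  then show ?case by simp
next
  case (Suc k)
  interpret G: group "iterated_wreath r k" using Suc by simp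
  interpret wreath_group "iterated_wreath r k" "r (Suc k)" by unfold_locales (use Suc in simp)
  show ?case using group_W finite_W by simp
qed

theorem theorem1:
  shows
  "(\<forall>N n K G \<rho>s E T.
      N > 0 \<longrightarrow> n > 0 \<longrightarrow>
      subgroup K (base_sym_group N) \<longrightarrow> G = (base_sym_group N)\<lparr>carrier := K\<rparr> \<longrightarrow>
      traversal_family G {..<length \<rho>s} (\<lambda>i. \<rho>s ! i) \<longrightarrow>
      (\<forall>\<alpha>\<in>weak_compositions (length \<rho>s) n. is_extension G \<rho>s \<alpha> (E \<alpha>)) \<longrightarrow>
      (\<forall>\<alpha>\<in>weak_compositions (length \<rho>s) n. traversal (young_group \<alpha>) (T \<alpha>)) \<longrightarrow>
      traversal_family (wreath G n (sym_group n))
        (SIGMA \<alpha>:weak_compositions (length \<rho>s) n. T \<alpha>)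
        (\<lambda>(\<alpha>, \<sigma>). induced_rep (wreath G n (sym_group n)) (wreath G n (young_group \<alpha>))
                    (inner_tensor (E \<alpha>) (inflate \<sigma>))))
   \<and>
   (\<forall>(r :: nat \<Rightarrow> nat) k \<rho>s E T.
      (\<forall>i\<ge>1. r i > 0) \<longrightarrow> k \<ge> 1 \<longrightarrow>
      traversal_family (iterated_wreath r (k - 1)) {..<length \<rho>s} (\<lambda>i. \<rho>s ! i) \<longrightarrow>
      (\<forall>\<alpha>\<in>weak_compositions (length \<rho>s) (r k).
         is_extension (iterated_wreath r (k - 1)) \<rho>s \<alpha> (E \<alpha>)) \<longrightarrow>
      (\<forall>\<alpha>\<in>weak_compositions (length \<rho>s) (r k). traversal (young_group \<alpha>) (T \<alpha>)) \<longrightarrow>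
      traversal_family (iterated_wreath r k)
        (SIGMA \<alpha>:weak_compositions (length \<rho>s) (r k). T \<alpha>)
        (\<lambda>(\<alpha>, \<sigma>). induced_rep (iterated_wreath r k)
                    (wreath (iterated_wreath r (k - 1)) (r k) (young_group \<alpha>))
                    (inner_tensor (E \<alpha>) (inflate \<sigma>))))"
proof (intro conjI allI impI, goal_cases)
  case (1 N n K G \<rho>s E T)
  have "group G" unfolding 1(4) by (rule subgroup.subgroup_is_group[OF 1(3) group_base_sym_group])
  moreover have "finite (carrier G)"
    using finite_subset[OF subgroup.subset[OF 1(3)] finite_base_sym_group] by (simp add: 1(4))
  ultimately show ?case by (rule wreath_traversal[OF _ _ 1(5-7)])
next
  case (2 r k \<rho>s E T)
  have "iterated_wreath r k = wreath (iterated_wreath r (k - 1)) (r k) (sym_group (r k))"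
    using 2(2) by (cases k) simp_all
  then show ?case
    using wreath_traversal[OF _ _ 2(3-5)] iterated_wreath_group[of r "k - 1"] by simp
qed

end
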